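(* Let $(\mathcal{B},\mathcal{L},\theta,\mathcal{I}_\alpha)$ be a generalized Boolean dynamical system, let $\partial E$ be its boundary path space and let $\mathbb{F}$ be the free group generated by $\mathcal{L}$. Then the pair $\Phi=(\{U_t\}_{t\in\mathbb{F}},\{\varphi_t\}_{t\in\mathbb{F}})$, with $U_t\subseteq\partial E$ and $\varphi_t:U_{t^{-1}}\to U_t$ as defined in the context, is a semi-saturated orthogonal partial action of $\mathbb{F}$ on $\partial E$.
   Context: Boolean algebras. A Boolean algebra is a set $\mathcal{B}$ with an element $\emptyset$ and operations $\cap,\cup,\setminus$ such that $(\mathcal{B},\cap,\cup)$ is a distributive lattice, $A\cap\emptyset=\emptyset$, $(A\cap B)\cup(A\setminus B)=A$ and $(A\cap B)\cap(A\setminus B)=\emptyset$ (no unit is required). $A\subseteq B$ means $A\cap B=A$. An ideal is a non-empty subset closed under $\cup$ and under intersection with arbitrary elements of $\mathcal{B}$; it is itself a Boolean algebra. A filter is a non-empty subset not containing $\emptyset$, upward closed and closed under $\cap$; an ultrafilter is a maximal filter. An action on $\mathcal{B}$ is a map $\mathcal{B}\to\mathcal{B}$ preserving $\cap,\cup,\setminus$ and $\emptyset$. Generalized Boolean dynamical system. A quadruple $(\mathcal{B},\mathcal{L},\theta,\mathcal{I}_\alpha)$ with $\mathcal{B}$ a Boolean algebra, $\mathcal{L}$ a set, $\{\theta_\alpha\}_{\alpha\in\mathcal{L}}$ actions on $\mathcal{B}$, and $\{\mathcal{I}_\alpha\}_{\alpha\in\mathcal{L}}$ ideals of $\mathcal{B}$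 with $\mathcal{R}_\alpha:=\{A\in\mathcal{B}:A\subseteq\theta_\alpha(B)\text{ for some }B\in\mathcal{B}\}\subseteq\mathcal{I}_\alpha$. $\mathcal{L}^*$ is the set of finite words in $\mathcal{L}$, including the empty word $\emptyset$; $|\alpha|$ is length. For $\alpha=\alpha_1\cdots\alpha_n$, $n\ge1$: $\theta_\alpha=\theta_{\alpha_n}\circ\cdots\circ\theta_{\alpha_1}$, $\theta_\emptyset=\mathrm{id}$, $\mathcal{I}_\alpha=\{A\in\mathcal{B}:A\subseteq\theta_{\alpha_2\cdots\alpha_n}(B)\text{ for some }B\in\mathcal{I}_{\alpha_1}\}$, $\mathcal{I}_\emptyset=\mathcal{B}$. $\mathcal{W}^*=\{\alpha\in\mathcal{L}^*:\mathcal{I}_\alpha\ne\{\emptyset\}\}$ and $\mathcal{W}^{\ge1}$ is the set of words of length $\ge1$ in $\mathcal{W}^*$. $X_\alpha$ is the set of ultrafilters in $\mathcal{I}_\alpha$ with the topology generated by the sets $\{\mathcal{F}\in X_\alpha:A\in\mathcal{F}\}$, $A\in\mathcal{I}_\alpha$. Boundary path space. $E^0=X_\emptyset$; $F^0=X_\emptyset\cup\{\emptyset\}$, where $\emptyset$ is an isolated point if $\mathcal{B}$ is unital and the point at infinity of the one-point compactification of $X_\emptyset$ otherwise. $E^1=\{e^\alpha_\eta:\alpha\in\mathcal{L},\eta\in X_\alpha\}$ with the topology of the disjoint union of the $X_\alpha$. For $\alpha\in\mathcal{L}$ put $f_{\emptyset[\alpha]}(\eta)=\{A\in\mathcal{B}:\theta_\alpha(A)\in\eta\}$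 (an ultrafilter of $\mathcal{B}$ or $\emptyset$). Define $d:E^1\to E^0$, $d(e^\alpha_\eta)=\{B\in\mathcal{B}:A\subseteq B\text{ for some }A\in\eta\}$ and $r:E^1\to F^0$, $r(e^\alpha_\eta)=f_{\emptyset[\alpha]}(\eta)$. For $n\ge 2$, $E^n$ is the subspace of $\prod_{i=1}^nE^1$ of $(e_1,\dots,e_n)$ with $d(e_i)=r(e_{i+1})$; $E^*=\bigsqcup_{n\ge0}E^n$; $E^\infty$ is the set of infinite sequences in $E^1$ with $d(e_i)=r(e_{i+1})$ for all $i$. For a path, $r$ is $r$ of its first edge, $d$ of a finite path is $d$ of its last edge; $r(v)=d(v)=v$ for $v\in E^0$. Put $F^0_{sce}=F^0\setminus\overline{r(E^1)}$, $F^0_{fin}=\{v\in F^0: v\text{ has a neighborhood }V\text{ with }r^{-1}(V)\text{ compact}\}$, $F^0_{rg}=F^0_{fin}\setminus\overline{F^0_{sce}}$, $E^0_{sg}=E^0\setminus F^0_{rg}$. Then $\partial E=E^\infty\sqcup\{\mu\in E^*:d(\mu)\in E^0_{sg}\}$. For $S\subseteq E^*$ let $\mathcal{Z}(S)$ be the set of $\mu\in\partial E$ with $r(\mu)\in S$ or $\mu_1\cdots\mu_i\in S$ for some $1\le i\le|\mu|$; the topology of $\partial E$ is generated by the sets $\mathcal{Z}(U)\cap\mathcal{Z}(K)^c$, $U\subseteq E^*$ open, $K\subseteq E^*$ compact. The sets $U_t$. Words are regarded as elements of $\mathbb{F}$, with $\emptyset$ the identity. $U_\emptyset=\partial E$.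 For $\alpha,\beta\in\mathcal{W}^{\ge1}$ with $\alpha\beta^{-1}$ in reduced form, $U_{\alpha\beta^{-1}}$ is the set of $(e^{\gamma_k}_{\eta_k})_{k=1}^N\in\partial E$ with $\gamma_1\cdots\gamma_{|\alpha|}=\alpha$ and $\eta_{|\alpha|}\cap\mathcal{I}_\beta\ne\emptyset$. For $\alpha\in\mathcal{W}^{\ge1}$, $U_\alpha=\{(e^{\gamma_k}_{\eta_k})_{k=1}^N\in\partial E:\gamma_1\cdots\gamma_{|\alpha|}=\alpha\}$. For $\beta\in\mathcal{W}^{\ge1}$, $U_{\beta^{-1}}=\{\mu\in\partial E:r(\mu)\cap\mathcal{I}_\beta\ne\emptyset\}$. For all other $t\in\mathbb{F}$, $U_t=\emptyset$. The maps $\varphi_t:U_{t^{-1}}\to U_t$. $\varphi_\emptyset=\mathrm{id}$. For $\beta\in\mathcal{W}^{\ge1}$, $\varphi_{\beta^{-1}}$ removes the first $|\beta|$ edges (if $|\mu|=|\beta|$ the result is $d(\mu)\in E^0$). For $\alpha=\alpha_1\cdots\alpha_n\in\mathcal{W}^{\ge1}$ and $\beta\in\mathcal{W}^*$ with $\alpha\beta^{-1}$ reduced and $U_{\beta\alpha^{-1}}\neq\emptyset$, $\varphi_{\alpha\beta^{-1}}(\mu)$ is obtained by removing the first $|\beta|$ edges of $\mu$ and adding at the beginning $e^{\alpha_1}_{\eta_1}\cdots e^{\alpha_n}_{\eta_n}$, where $\eta_n=\zeta\cap\mathcal{I}_{\alpha_n}$ with $\zeta=d(\mu_{|\beta|})$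 if $\beta\ne\emptyset$ and $\zeta=r(\mu)$ if $\beta=\emptyset$, and $\eta_i=f_{\emptyset[\alpha_{i+1}]}(\eta_{i+1})\cap\mathcal{I}_{\alpha_i}$ for $i=n-1,\dots,1$. All other $\varphi_t$ are empty maps. Partial actions. A partial action of a group $G$ on a topological space $X$ is a pair $(\{U_t\}_{t\in G},\{\phi_t\}_{t\in G})$ of open sets $U_t\subseteq X$ and homeomorphisms $\phi_t:U_{t^{-1}}\to U_t$ with $U_e=X$, $\phi_e=\mathrm{id}$; $\phi_s(U_{s^{-1}}\cap U_t)=U_s\cap U_{st}$; and $\phi_s(\phi_t(x))=\phi_{st}(x)$ for $x\in U_{t^{-1}}\cap U_{(st)^{-1}}$. When $G$ is a free group with word length $|\cdot|$, it is semi-saturated if $\phi_s\circ\phi_t=\phi_{st}$ (as partially defined maps) whenever $|st|=|s|+|t|$, and orthogonal if $U_a\cap U_b=\emptyset$ for distinct generators $a,b$. *)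

theory Defs
  imports "HOL-Analysis.Analysis" "HOL-Algebra.Group"
begin

section \<open>Boolean algebras without unit\<close>

class generalized_boolean_algebra = distrib_lattice + order_bot + minus +
  assumes inf_sup_diff: "sup (inf a b) (a - b) = a"
    and inf_inf_diff: "inf (inf a b) (a - b) = bot"

definition unital :: "'b::generalized_boolean_algebra itself \<Rightarrow> bool" where
  "unital _ \<longleftrightarrow> (\<exists>u::'b. \<forall>A. A \<le> u)"

definition ba_ideal :: "'b::generalized_boolean_algebra set \<Rightarrow> bool" where
  "ba_ideal J \<longleftrightarrow> J \<noteq> {} \<and> (\<forall>A\<in>J. \<forall>B\<in>J. sup A B \<in> J) \<and> (\<forall>A\<in>J. \<forall>B. inf A B \<in> J)"

definition ba_action :: "('b::generalized_boolean_algebra \<Rightarrow> 'b) \<Rightarrow> bool" where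
  "ba_action h \<longleftrightarrow> h bot = bot \<and> (\<forall>A B. h (inf A B) = inf (h A) (h B)
     \<and> h (sup A B) = sup (h A) (h B) \<and> h (A - B) = h A - h B)"

text \<open>Filters are taken relative to an ideal \<open>J\<close>, which is itself a Boolean algebra.\<close>

definition ba_filter :: "'b::generalized_boolean_algebra set \<Rightarrow> 'b set \<Rightarrow> bool" where
  "ba_filter J F \<longleftrightarrow> F \<subseteq> J \<and> F \<noteq> {} \<and> bot \<notin> F
     \<and> (\<forall>A\<in>F. \<forall>B\<in>J. A \<le> B \<longrightarrow> B \<in> F) \<and> (\<forall>A\<in>F. \<forall>B\<in>F. inf A B \<in> F)"

definition ultrafilters :: "'b::generalized_boolean_algebra set \<Rightarrow> 'b set set" where
  "ultrafilters J = {F. ba_filter J F \<and> (\<forall>G. ba_filter J G \<longrightarrow> F \<subseteq> G \<longrightarrow> G = F)}"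

definition ultrafilter_topology :: "'b::generalized_boolean_algebra set \<Rightarrow> 'b set topology" where
  "ultrafilter_topology J = topology_generated_by {{F \<in> ultrafilters J. A \<in> F} |A. A \<in> J}"


section \<open>The free group\<close>

text \<open>Elements are reduced words in the letters \<open>(a, True)\<close>, standing for the generator \<open>a\<close>,
  and \<open>(a, False)\<close>, standing for its inverse. The word length is thus \<^const>\<open>length\<close>.\<close>

definition letter_inv :: "'l \<times> bool \<Rightarrow> 'l \<times> bool" where
  "letter_inv x = (fst x, \<not> snd x)"

definition reduced :: "('l \<times> bool) list \<Rightarrow> bool" where
  "reduced = successively (\<lambda>x y. y \<noteq> letter_inv x)"

fun letter_mult :: "'l \<times> bool \<Rightarrow> ('l \<times> bool) list \<Rightarrow> ('l \<times> bool) list" where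
  "letter_mult x [] = [x]"
| "letter_mult x (y # w) = (if y = letter_inv x then w else x # y # w)"

definition free_group :: "'l set \<Rightarrow> ('l \<times> bool) list monoid" where
  "free_group L = \<lparr>carrier = {w \<in> lists (L \<times> UNIV). reduced w},
     monoid.mult = foldr letter_mult, one = []\<rparr>"

text \<open>The word \<open>\<alpha>\<beta>\<^sup>-\<^sup>1\<close>, without any cancellation:\<close>

definition quot_word :: "'l list \<Rightarrow> 'l list \<Rightarrow> ('l \<times> bool) list" where
  "quot_word \<alpha> \<beta> = map (\<lambda>a. (a, True)) \<alpha> @ map (\<lambda>b. (b, False)) (rev \<beta>)"

lemma letter_inv_inv [simp]: "letter_inv (letter_inv x) = x"
  by (simp add: letter_inv_def)

lemma letter_inv_neq [simp]: "letter_inv x \<noteq> x"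
  by (simp add: letter_inv_def prod_eq_iff)

lemma letter_mult_inv: "reduced w \<Longrightarrow> letter_mult (letter_inv x) (letter_mult x w) = w"
  by (cases w; cases "tl w") (auto simp: reduced_def)

lemma reduced_letter_mult: "reduced w \<Longrightarrow> reduced (letter_mult x w)"
  by (cases w; cases "tl w") (auto simp: reduced_def)

lemma reduced_foldr_letter_mult: "reduced w \<Longrightarrow> reduced (foldr letter_mult v w)"
  by (induction v) (auto simp: reduced_letter_mult)

lemma foldr_letter_mult_reduced: "reduced w \<Longrightarrow> foldr letter_mult w [] = w"
proof (induction w)
  case (Cons x w)
  then show ?case by (cases w) (auto simp: reduced_def)
qed simp

lemma foldr_letter_mult_assoc:
  assumes "reduced w"
  shows "foldr letter_mult (foldr letter_mult u v) w = foldr letter_mult u (foldr letter_mult v w)"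
proof (induction u)
  case (Cons x u)
  have "foldr letter_mult (letter_mult x z) w = letter_mult x (foldr letter_mult z w)" for z
  proof (cases z)
    case (Cons y z')
    then show ?thesis
      using letter_mult_inv[of "foldr letter_mult z' w" "letter_inv x"] assms
      by (auto simp: reduced_foldr_letter_mult)
  qed simp
  then show ?case using Cons by simp
qed simp

lemma foldr_letter_mult_inv:
  "reduced w \<Longrightarrow> foldr letter_mult (map letter_inv (rev v)) (foldr letter_mult v w) = w"
  by (induction v arbitrary: w) (auto simp: letter_mult_inv reduced_foldr_letter_mult)

lemma reduced_inverse: "reduced w \<Longrightarrow> reduced (map letter_inv (rev w))"
  unfolding reduced_def successively_map successively_rev
  by (erule successively_mono) (metis letter_inv_inv)

lemma lists_foldr_letter_mult:
  assumes "v \<in> lists (L \<times> UNIV)" "w \<in> lists (L \<times> UNIV)"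
  shows "foldr letter_mult v w \<in> lists (L \<times> UNIV)"
proof -
  have *: "letter_mult x z \<in> lists (L \<times> UNIV)" if "x \<in> L \<times> UNIV" "z \<in> lists (L \<times> UNIV)" for x z
    using that by (cases z) auto
  from assms(1) show ?thesis by (induction v) (use * assms(2) in simp_all)
qed

lemma group_free_group: "group (free_group L)"
proof (rule groupI)
  fix x assume x: "x \<in> carrier (free_group L)"
  show "\<exists>y\<in>carrier (free_group L). y \<otimes>\<^bsub>free_group L\<^esub> x = \<one>\<^bsub>free_group L\<^esub>"
  proof (rule bexI[of _ "map letter_inv (rev x)"])
    show "map letter_inv (rev x) \<otimes>\<^bsub>free_group L\<^esub> x = \<one>\<^bsub>free_group L\<^esub>"
      using x foldr_letter_mult_inv[of "[]" x] foldr_letter_mult_reduced[of x]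
      by (simp add: free_group_def reduced_def)
    show "map letter_inv (rev x) \<in> carrier (free_group L)"
      using x by (auto simp: free_group_def reduced_inverse letter_inv_def mem_Times_iff)
  qed
qed (auto simp: free_group_def reduced_foldr_letter_mult foldr_letter_mult_assoc
       lists_foldr_letter_mult simp del: in_lists_conv_set, simp add: reduced_def)


section \<open>Partial actions\<close>

text \<open>The map \<open>\<phi> t\<close> is a total function of which only the restriction to \<open>U (inv t)\<close> matters.\<close>

locale partial_action = group G for G (structure) +
  fixes X :: "'x topology"
    and U :: "'a \<Rightarrow> 'x set"
    and \<phi> :: "'a \<Rightarrow> 'x \<Rightarrow> 'x"
  assumes open_dom: "t \<in> carrier G \<Longrightarrow> openin X (U t)"
    and homeo: "t \<in> carrier G \<Longrightarrow>
      homeomorphic_map (subtopology X (U (inv t))) (subtopology X (U t)) (\<phi> t)"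
    and dom_one: "U \<one> = topspace X"
    and act_one: "x \<in> topspace X \<Longrightarrow> \<phi> \<one> x = x"
    and image_dom: "s \<in> carrier G \<Longrightarrow> t \<in> carrier G \<Longrightarrow>
      \<phi> s ` (U (inv s) \<inter> U t) = U s \<inter> U (s \<otimes> t)"
    and act_mult: "s \<in> carrier G \<Longrightarrow> t \<in> carrier G \<Longrightarrow>
      x \<in> U (inv t) \<inter> U (inv (s \<otimes> t)) \<Longrightarrow> \<phi> s (\<phi> t x) = \<phi> (s \<otimes> t) x"

definition semi_saturated ::
  "'l set \<Rightarrow> (('l \<times> bool) list \<Rightarrow> 'x set) \<Rightarrow> (('l \<times> bool) list \<Rightarrow> 'x \<Rightarrow> 'x) \<Rightarrow> bool" where
  "semi_saturated L U \<phi> \<longleftrightarrow>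
    (let G = free_group L in
     \<forall>s\<in>carrier G. \<forall>t\<in>carrier G. length (s \<otimes>\<^bsub>G\<^esub> t) = length s + length t \<longrightarrow>
       {x \<in> U (inv\<^bsub>G\<^esub> t). \<phi> t x \<in> U (inv\<^bsub>G\<^esub> s)} = U (inv\<^bsub>G\<^esub> (s \<otimes>\<^bsub>G\<^esub> t)) \<and>
       (\<forall>x\<in>U (inv\<^bsub>G\<^esub> (s \<otimes>\<^bsub>G\<^esub> t)). \<phi> s (\<phi> t x) = \<phi> (s \<otimes>\<^bsub>G\<^esub> t) x))"

definition orthogonal_domains :: "'l set \<Rightarrow> (('l \<times> bool) list \<Rightarrow> 'x set) \<Rightarrow> bool" where
  "orthogonal_domains L U \<longleftrightarrow>
    (\<forall>a\<in>L. \<forall>b\<in>L. a \<noteq> b \<longrightarrow> U [(a, True)] \<inter> U [(b, True)] = {})"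


section \<open>Generalized Boolean dynamical systems and their boundary path spaces\<close>

text \<open>The edge \<open>e\<^sup>\<alpha>\<^sub>\<eta>\<close> is the pair \<open>(\<alpha>, \<eta>)\<close>. Edges of paths are numbered from 0.\<close>

type_synonym ('l, 'b) edge = "'l \<times> 'b set"

datatype ('l, 'b) gpath =
    Vertex "'b set"
  | Fin_path "('l, 'b) edge list"
  | Inf_path "nat \<Rightarrow> ('l, 'b) edge"

fun plen :: "('l, 'b) gpath \<Rightarrow> enat" where
  "plen (Vertex v) = 0"
| "plen (Fin_path p) = enat (length p)"
| "plen (Inf_path f) = \<infinity>"

fun edge_at :: "('l, 'b) gpath \<Rightarrow> nat \<Rightarrow> ('l, 'b) edge" where
  "edge_at (Vertex v) i = undefined"
| "edge_at (Fin_path p) i = p ! i"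
| "edge_at (Inf_path f) i = f i"

definition initial_path :: "nat \<Rightarrow> ('l, 'b) gpath \<Rightarrow> ('l, 'b) gpath" where
  "initial_path n \<mu> = Fin_path (map (edge_at \<mu>) [0..<n])"

definition starts_with :: "'l list \<Rightarrow> ('l, 'b) gpath \<Rightarrow> bool" where
  "starts_with \<alpha> \<mu> \<longleftrightarrow> enat (length \<alpha>) \<le> plen \<mu> \<and> (\<forall>i<length \<alpha>. fst (edge_at \<mu> i) = \<alpha> ! i)"

fun prepend :: "('l, 'b) edge list \<Rightarrow> ('l, 'b) gpath \<Rightarrow> ('l, 'b) gpath" where
  "prepend p (Vertex v) = Fin_path p"
| "prepend p (Fin_path q) = Fin_path (p @ q)"
| "prepend p (Inf_path f) = Inf_path (\<lambda>i. if i < length p then p ! i else f (i - length p))"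

fun edge_dom :: "('l, 'b::generalized_boolean_algebra) edge \<Rightarrow> 'b set" where
  "edge_dom (\<alpha>, \<eta>) = {B. \<exists>A\<in>\<eta>. A \<le> B}"

fun remove_edges :: "nat \<Rightarrow> ('l, 'b::generalized_boolean_algebra) gpath \<Rightarrow> ('l, 'b) gpath" where
  "remove_edges n (Vertex v) = Vertex v"
| "remove_edges n (Fin_path p) =
    (if n < length p then Fin_path (drop n p) else Vertex (edge_dom (last p)))"
| "remove_edges n (Inf_path f) = Inf_path (\<lambda>i. f (n + i))"

locale generalized_boolean_dynamical_system =
  fixes L :: "'l set"
    and \<theta> :: "'l \<Rightarrow> 'b::generalized_boolean_algebra \<Rightarrow> 'b"
    and \<I> :: "'l \<Rightarrow> 'b set"
  assumes action: "\<alpha> \<in> L \<Longrightarrow> ba_action (\<theta> \<alpha>)"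
    and ideal: "\<alpha> \<in> L \<Longrightarrow> ba_ideal (\<I> \<alpha>)"
    and range_subset: "\<alpha> \<in> L \<Longrightarrow> {A. \<exists>B. A \<le> \<theta> \<alpha> B} \<subseteq> \<I> \<alpha>"
begin

definition word_action :: "'l list \<Rightarrow> 'b \<Rightarrow> 'b" where
  "word_action \<alpha> = fold \<theta> \<alpha>"

fun word_ideal :: "'l list \<Rightarrow> 'b set" where
  "word_ideal [] = UNIV"
| "word_ideal (a # \<alpha>) = {A. \<exists>B\<in>\<I> a. A \<le> word_action \<alpha> B}"

definition W_star :: "'l list set" where
  "W_star = {\<alpha> \<in> lists L. word_ideal \<alpha> \<noteq> {bot}}"

definition W_ge1 :: "'l list set" where
  "W_ge1 = {\<alpha> \<in> W_star. length \<alpha> \<ge> 1}"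

definition E0 :: "'b set set" where
  "E0 = ultrafilters UNIV"

definition E0_topology :: "'b set topology" where
  "E0_topology = ultrafilter_topology UNIV"

text \<open>The extra point of \<open>F\<^sup>0\<close> is the empty set, which is not an ultrafilter.\<close>

definition F0 :: "'b set set" where
  "F0 = insert {} E0"

definition F0_topology :: "'b set topology" where
  "F0_topology =
    (if unital TYPE('b) then topology_generated_by (insert {{}} {V. openin E0_topology V})
     else pullback_topology F0 (\<lambda>v. if v = {} then None else Some v)
            (Alexandroff_compactification E0_topology))"

definition E1 :: "('l, 'b) edge set" where
  "E1 = (SIGMA \<alpha>:L. ultrafilters (\<I> \<alpha>))"

definition E1_topology :: "('l, 'b) edge topology" where
  "E1_topology = sum_topology (\<lambda>\<alpha>. ultrafilter_topology (\<I> \<alpha>)) L"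

text \<open>\<open>f_map \<alpha>\<close> is the map \<open>f\<close> with index \<open>\<emptyset>[\<alpha>]\<close>.\<close>

definition f_map :: "'l \<Rightarrow> 'b set \<Rightarrow> 'b set" where
  "f_map \<alpha> \<eta> = {A. \<theta> \<alpha> A \<in> \<eta>}"

definition edge_range :: "('l, 'b) edge \<Rightarrow> 'b set" where
  "edge_range e = f_map (fst e) (snd e)"

fun path_range :: "('l, 'b) gpath \<Rightarrow> 'b set" where
  "path_range (Vertex v) = v"
| "path_range (Fin_path p) = edge_range (hd p)"
| "path_range (Inf_path f) = edge_range (f 0)"

fun path_dom :: "('l, 'b) gpath \<Rightarrow> 'b set" where
  "path_dom (Vertex v) = v"
| "path_dom (Fin_path p) = edge_dom (last p)"
| "path_dom (Inf_path f) = undefined"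

definition E_n :: "nat \<Rightarrow> ('l, 'b) gpath set" where
  "E_n n = (if n = 0 then Vertex ` E0
     else {Fin_path p |p. length p = n \<and> p \<in> lists E1
             \<and> successively (\<lambda>e e'. edge_dom e = edge_range e') p})"

definition E_n_topology :: "nat \<Rightarrow> ('l, 'b) gpath topology" where
  "E_n_topology n = (if n = 0 then pullback_topology (E_n 0) path_dom E0_topology
     else pullback_topology (E_n n) (\<lambda>\<mu>. restrict (edge_at \<mu>) {..<n})
            (product_topology (\<lambda>_. E1_topology) {..<n}))"

definition E_star :: "('l, 'b) gpath set" where
  "E_star = (\<Union>n. E_n n)"

text \<open>The disjoint union topology, transported along \<open>\<mu> \<mapsto> (|\<mu>|, \<mu>)\<close>.\<close>

definition E_star_topology :: "('l, 'b) gpath topology" where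
  "E_star_topology =
    pullback_topology E_star (\<lambda>\<mu>. (the_enat (plen \<mu>), \<mu>)) (sum_topology E_n_topology UNIV)"

definition E_inf :: "('l, 'b) gpath set" where
  "E_inf = {Inf_path f |f. \<forall>i. f i \<in> E1 \<and> edge_dom (f i) = edge_range (f (Suc i))}"

definition F0_sce :: "'b set set" where
  "F0_sce = F0 - F0_topology closure_of (edge_range ` E1)"

definition F0_fin :: "'b set set" where
  "F0_fin = {v \<in> F0. \<exists>V N. openin F0_topology N \<and> v \<in> N \<and> N \<subseteq> V \<and> V \<subseteq> F0
     \<and> compactin E1_topology {e \<in> E1. edge_range e \<in> V}}"

definition F0_rg :: "'b set set" where
  "F0_rg = F0_fin - F0_topology closure_of F0_sce"

definition E0_sg :: "'b set set" where
  "E0_sg = E0 - F0_rg"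

definition boundary :: "('l, 'b) gpath set" where
  "boundary = E_inf \<union> {\<mu> \<in> E_star. path_dom \<mu> \<in> E0_sg}"

definition Z :: "('l, 'b) gpath set \<Rightarrow> ('l, 'b) gpath set" where
  "Z S = {\<mu> \<in> boundary. Vertex (path_range \<mu>) \<in> S
     \<or> (\<exists>i. 1 \<le> i \<and> enat i \<le> plen \<mu> \<and> initial_path i \<mu> \<in> S)}"

definition boundary_topology :: "('l, 'b) gpath topology" where
  "boundary_topology = topology_generated_by
     {Z V \<inter> (boundary - Z K) |V K. openin E_star_topology V \<and> compactin E_star_topology K}"

definition U :: "('l \<times> bool) list \<Rightarrow> ('l, 'b) gpath set" where
  "U t = (if t = [] then boundary else
     {\<mu> \<in> boundary.
       (\<exists>\<alpha>\<in>W_ge1. \<exists>\<beta>\<in>W_ge1. t = quot_word \<alpha> \<beta> \<and> reduced t \<and> starts_with \<alpha> \<mu>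
          \<and> snd (edge_at \<mu> (length \<alpha> - 1)) \<inter> word_ideal \<beta> \<noteq> {})
     \<or> (\<exists>\<alpha>\<in>W_ge1. t = quot_word \<alpha> [] \<and> starts_with \<alpha> \<mu>)
     \<or> (\<exists>\<beta>\<in>W_ge1. t = quot_word [] \<beta> \<and> path_range \<mu> \<inter> word_ideal \<beta> \<noteq> {})})"

text \<open>The edges added in front of a path: the last one is determined by \<open>\<zeta>\<close>, and each other
  one by the range of its successor.\<close>

fun edges_over :: "'b set \<Rightarrow> 'l list \<Rightarrow> ('l, 'b) edge list" where
  "edges_over \<zeta> [] = []"
| "edges_over \<zeta> [a] = [(a, \<zeta> \<inter> \<I> a)]"
| "edges_over \<zeta> (a # b # \<alpha>) =
    (let p = edges_over \<zeta> (b # \<alpha>) in (a, f_map b (snd (hd p)) \<inter> \<I> a) # p)"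

definition quot_map :: "'l list \<Rightarrow> 'l list \<Rightarrow> ('l, 'b) gpath \<Rightarrow> ('l, 'b) gpath" where
  "quot_map \<alpha> \<beta> \<mu> =
    (if \<alpha> = [] then remove_edges (length \<beta>) \<mu>
     else prepend
       (edges_over (if \<beta> = [] then path_range \<mu> else edge_dom (edge_at \<mu> (length \<beta> - 1))) \<alpha>)
       (remove_edges (length \<beta>) \<mu>))"

text \<open>If \<open>t = quot_word \<alpha> \<beta>\<close>, then \<open>\<alpha>\<close> and \<open>\<beta>\<close> are recovered as below. All that matters are the
  values of \<open>\<phi> t\<close> on \<open>U t\<^sup>-\<^sup>1\<close>; for the remaining \<open>t\<close> this set is empty, so that \<open>\<phi> t\<close> stands
  for the empty map.\<close>

definition \<phi> :: "('l \<times> bool) list \<Rightarrow> ('l, 'b) gpath \<Rightarrow> ('l, 'b) gpath" where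
  "\<phi> t \<mu> = (if t = [] then \<mu>
     else quot_map (map fst (takeWhile snd t)) (rev (map fst (dropWhile snd t))) \<mu>)"

end

end

(* Let S_a be the partial bijection of the boundary path space that removes a first edge with label a.
   Sending a letter a to the inverse of S_a and a^-1 to S_a, every word yields a composite of partial
   bijections; cancelling a pair of adjacent inverse letters can only enlarge this composite, which
   gives the axioms of a partial action, and semi-saturation because no cancellation occurs when
   lengths add up. The composite is empty unless the word is alpha beta^-1, since no path
   starts with two different labels, and otherwise its graph is that of phi_t on U_(t^-1). The edges
   removed by the shift along alpha are determined by what remains, an ultrafilter on a vertex being
   recovered from its trace on any ideal that it meets.
   For the topology, the finite paths labelled by alpha are parametrised continuously by the
   ultrafilters xi that meet I_alpha. So the sets C(alpha, A) of such paths with A in xi, where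
   A is in I_alpha, form a compact open base of the Hausdorff space E^*, and the boundary topology is
   generated by the sets Z(C(alpha, A)) and their complements. The maps S_a and their inverses
   carry these sets to open sets. *)

theory Submission
  imports Defs
begin

section \<open>Ultrafilters of Boolean algebras without unit\<close>

text \<open>Relations make composition and inversion total operations. The axioms then follow from
  one inclusion for products of words, and continuity becomes openness for the inverse word.
  Matching the relations with the sets U_t needs a bridge: U_t tests the last edge of a prefix,
  whereas the range of a shift is described by the range of the remaining path. The missing unit
  shapes the topology. A cylinder of labels \<alpha> is shown to be compact only for A in the word
  ideal of \<alpha>, yet undoing S_a turns C(\<alpha>, A) into C(a\<alpha>, A), where A may fall
  outside the smaller ideal of a\<alpha>. Openness of such sets, and of their complements within the
  domain of S_a, is restored by cutting A down locally. The compact sets K in the definition of the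
  topology are arbitrary. Finitely many cylinders cover K, Hausdorffness makes K closed, and a path
  has at most one initial segment in each cylinder; so the complement of Z(K) is a finite
  intersection of manageable sets.\<close>

context generalized_boolean_algebra
begin

lemma diff_le: "a - b \<le> a"
  by (metis inf_sup_diff sup_ge2)

lemma inf_diff_self: "inf (a - b) b = bot"
proof -
  have "inf (a - b) b = inf (inf a b) (a - b)"
    by (metis diff_le inf.absorb1 inf.commute inf.left_commute inf.assoc)
  then show ?thesis by (simp add: inf_inf_diff)
qed

lemma le_sup_diff: "a \<le> sup (a - b) b"
  by (metis inf_sup_diff inf_le2 sup.commute sup.mono order_refl)

lemma sup_bot_absorb: "sup a bot = a" "sup bot a = a"
  by (simp_all add: sup_absorb1 sup_absorb2)

end

lemma ba_filter_up: "ba_filter J F \<Longrightarrow> A \<in> F \<Longrightarrow> B \<in> J \<Longrightarrow> A \<le> B \<Longrightarrow> B \<in> F"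
  and ba_filter_inf: "ba_filter J F \<Longrightarrow> A \<in> F \<Longrightarrow> B \<in> F \<Longrightarrow> inf A B \<in> F"
  and ba_filter_bot: "ba_filter J F \<Longrightarrow> bot \<notin> F"
  and ba_filter_sub: "ba_filter J F \<Longrightarrow> A \<in> F \<Longrightarrow> A \<in> J"
  and ba_filter_nonempty: "ba_filter J F \<Longrightarrow> F \<noteq> {}"
  by (auto simp: ba_filter_def)

lemma ba_ideal_down: "ba_ideal J \<Longrightarrow> A \<in> J \<Longrightarrow> B \<le> A \<Longrightarrow> B \<in> J"
  unfolding ba_ideal_def by (metis inf.absorb2)

lemma ba_ideal_UNIV: "ba_ideal UNIV"
  by (simp add: ba_ideal_def)

text \<open>Relative complements replace complements in a unit. If \<open>A - B\<close> is missing
  from a maximal \<open>F\<close>, the filter generated by \<open>F\<close> and \<open>A - B\<close>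
  is improper, so some \<open>X\<close> in \<open>F\<close> is disjoint from \<open>A - B\<close>,
  and \<open>inf X A\<close> lies below \<open>inf A B\<close>. Conversely, a larger filter cannot
  contain a new \<open>C\<close>, because \<open>A - C\<close> and \<open>C\<close> are
  disjoint.\<close>

lemma ultrafilters_iff:
  assumes J: "ba_ideal J"
  shows "F \<in> ultrafilters J \<longleftrightarrow>
    ba_filter J F \<and> (\<forall>A\<in>F. \<forall>B\<in>J. inf A B \<in> F \<or> A - B \<in> F)"
proof (intro iffI conjI ballI)
  assume F: "F \<in> ultrafilters J"
  then show filt: "ba_filter J F" by (simp add: ultrafilters_def)
  fix A B assume A: "A \<in> F" and B: "B \<in> J"
  show "inf A B \<in> F \<or> A - B \<in> F"
  proof (rule disjCI)
    assume nin: "A - B \<notin> F"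
    \<comment> \<open>The candidate for a strictly larger filter; \<open>bot \<in> G\<close> is the
      only way in which it can fail.\<close>
    define G where "G = {C \<in> J. \<exists>X\<in>F. inf X (A - B) \<le> C}"
    have AB: "A - B \<in> J"
      using ba_ideal_down[OF J ba_filter_sub[OF filt A]] diff_le by blast
    have FG: "F \<subseteq> G"
    proof
      fix X assume "X \<in> F"
      then show "X \<in> G" using ba_filter_sub[OF filt] inf_le1[of X "A - B"] unfolding G_def by blast
    qed
    have inG: "A - B \<in> G" using A AB inf_le2[of A "A - B"] unfolding G_def by blast
    have "\<not> ba_filter J G"
      using F FG inG nin unfolding ultrafilters_def by auto
    moreover have "ba_filter J G" if "bot \<notin> G"
      unfolding ba_filter_def
    proof (intro conjI ballI impI that)
      show "G \<subseteq> J" by (auto simp: G_def)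
      show "G \<noteq> {}" using inG by blast
      fix C D assume C: "C \<in> G"
      { assume "D \<in> J" "C \<le> D" then show "D \<in> G" using C unfolding G_def by (blast intro: order_trans) }
      assume D: "D \<in> G"
      obtain X Y where XY: "X \<in> F" "Y \<in> F" "inf X (A - B) \<le> C" "inf Y (A - B) \<le> D"
        using C D by (auto simp: G_def)
      have "inf (inf X Y) (A - B) \<le> inf C D"
        using XY(3,4) by (meson dual_order.trans inf.boundedI inf.cobounded1 inf.cobounded2)
      moreover have "inf C D \<in> J" using C J by (auto simp: G_def ba_ideal_def)
      ultimately show "inf C D \<in> G" using ba_filter_inf[OF filt XY(1,2)] by (auto simp: G_def)
    qed
    ultimately have "bot \<in> G" by blast
    then obtain X where X: "X \<in> F" "inf X (A - B) = bot"
      by (auto simp: G_def bot_unique)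
    have "inf X A \<le> inf A B"
    proof -
      have "inf X A = inf X (sup (inf A B) (A - B))" by (simp add: inf_sup_diff)
      also have "\<dots> = inf X (inf A B)" by (simp add: inf_sup_distrib1 X sup_bot_absorb)
      finally show ?thesis by (metis inf_le2)
    qed
    moreover have "inf A B \<in> J" using J ba_filter_sub[OF filt A] by (auto simp: ba_ideal_def)
    ultimately show "inf A B \<in> F"
      using ba_filter_up[OF filt ba_filter_inf[OF filt X(1) A]] by blast
  qed
next
  assume *: "ba_filter J F \<and> (\<forall>A\<in>F. \<forall>B\<in>J. inf A B \<in> F \<or> A - B \<in> F)"
  show "F \<in> ultrafilters J"
    unfolding ultrafilters_def
  proof (intro CollectI conjI allI impI)
    show "ba_filter J F" using * by blast
    fix G assume G: "ba_filter J G" and FG: "F \<subseteq> G"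
    have "C \<in> F" if C: "C \<in> G" for C
    proof -
      obtain A where A: "A \<in> F" using * ba_filter_nonempty by blast
      have "A - C \<notin> F"
        using ba_filter_inf[OF G _ C, of "A - C"] FG ba_filter_bot[OF G] by (auto simp: inf_diff_self)
      then have "inf A C \<in> F" using * A ba_filter_sub[OF G C] by blast
      then show ?thesis using * ba_filter_up ba_filter_sub[OF G C] inf_le2 by blast
    qed
    then show "G = F" using FG by blast
  qed
qed

lemma ultrafilters_filter: "F \<in> ultrafilters J \<Longrightarrow> ba_filter J F"
  by (simp add: ultrafilters_def)

lemma ultrafilter_extension:
  assumes "ba_filter J F"
  obtains G where "G \<in> ultrafilters J" "F \<subseteq> G"
proof -
  define \<A> where "\<A> = {G. ba_filter J G \<and> F \<subseteq> G}"
  have "\<exists>M\<in>\<A>. \<forall>X\<in>\<A>. M \<subseteq> X \<longrightarrow> X = M"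
  proof (rule subset_Zorn_nonempty)
    show "\<A> \<noteq> {}" using assms by (auto simp: \<A>_def)
    fix \<C> assume \<C>: "\<C> \<noteq> {}" "subset.chain \<A> \<C>"
    then have filt: "\<And>G. G \<in> \<C> \<Longrightarrow> ba_filter J G \<and> F \<subseteq> G"
      by (auto simp: subset.chain_def \<A>_def)
    have ch: "\<And>G H. G \<in> \<C> \<Longrightarrow> H \<in> \<C> \<Longrightarrow> G \<subseteq> H \<or> H \<subseteq> G"
      using \<C>(2) by (auto simp: subset.chain_def)
    have "ba_filter J (\<Union>\<C>)"
      unfolding ba_filter_def
    proof (intro conjI ballI impI)
      show "\<Union>\<C> \<subseteq> J" using filt ba_filter_sub by blast
      show "bot \<notin> \<Union>\<C>" using filt ba_filter_bot by blast
      show "\<Union>\<C> \<noteq> {}" using \<C>(1) filt ba_filter_nonempty by blast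
      fix A B assume A: "A \<in> \<Union>\<C>"
      { assume "B \<in> J" "A \<le> B" then show "B \<in> \<Union>\<C>" using A filt ba_filter_up by blast }
      assume B: "B \<in> \<Union>\<C>"
      obtain G where "G \<in> \<C>" "A \<in> G" "B \<in> G" using A B ch by blast
      then show "inf A B \<in> \<Union>\<C>" using filt ba_filter_inf by blast
    qed
    then show "\<Union>\<C> \<in> \<A>" using filt \<C>(1) by (auto simp: \<A>_def)
  qed
  then obtain M where M: "M \<in> \<A>" "\<And>X. X \<in> \<A> \<Longrightarrow> M \<subseteq> X \<Longrightarrow> X = M" by blast
  have "M \<in> ultrafilters J" using M unfolding ultrafilters_def \<A>_def by blast
  then show ?thesis using that M(1) by (auto simp: \<A>_def)
qed

lemma ultrafilter_sup_iff:
  assumes "F \<in> ultrafilters UNIV"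
  shows "sup A B \<in> F \<longleftrightarrow> A \<in> F \<or> B \<in> F"
proof
  note filt = ultrafilters_filter[OF assms]
  assume s: "sup A B \<in> F"
  show "A \<in> F \<or> B \<in> F"
  proof (rule disjCI)
    assume "B \<notin> F"
    then have "inf (sup A B) B \<notin> F" by (simp add: inf.absorb2)
    then have d: "sup A B - B \<in> F"
      using assms s by (auto simp: ultrafilters_iff[OF ba_ideal_UNIV])
    have "sup A B - B \<le> A"
    proof -
      have "sup A B - B = inf (sup A B - B) (sup A B)" by (simp add: diff_le inf.absorb1)
      also have "\<dots> = inf (sup A B - B) A" by (simp add: inf_sup_distrib1 inf_diff_self sup_bot_absorb)
      finally show ?thesis by (metis inf_le2)
    qed
    then show "A \<in> F" using ba_filter_up[OF filt d] by simp
  qed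
next
  assume "A \<in> F \<or> B \<in> F"
  then show "sup A B \<in> F"
    using ba_filter_up[OF ultrafilters_filter[OF assms]] by (metis UNIV_I sup_ge1 sup_ge2)
qed

section \<open>The topology on ultrafilters and its compact basic sets\<close>

lemma topspace_ultrafilter_topology [simp]:
  "topspace (ultrafilter_topology J) = ultrafilters J"
  unfolding ultrafilter_topology_def topology_generated_by_topspace
proof (intro equalityI subsetI)
  fix F assume F: "F \<in> ultrafilters J"
  then obtain A where "A \<in> F" using ba_filter_nonempty[OF ultrafilters_filter] by blast
  then show "F \<in> \<Union>{{F \<in> ultrafilters J. A \<in> F} |A. A \<in> J}"
    using F ba_filter_sub[OF ultrafilters_filter[OF F]] by blast
qed auto

lemma openin_ultrafilter_basic:
  "A \<in> J \<Longrightarrow> openin (ultrafilter_topology J) {F \<in> ultrafilters J. A \<in> F}"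
  unfolding ultrafilter_topology_def by (rule topology_generated_by_Basis) blast

text \<open>The basic sets of \<open>A\<close> and \<open>B\<close> intersect in the one of
  \<open>inf A B\<close>, so the generating sets form a base and not only a subbase.\<close>

lemma ultrafilter_neighbourhood:
  assumes "openin (ultrafilter_topology J) V" and "F \<in> V"
  obtains A where "A \<in> F" "{G \<in> ultrafilters J. A \<in> G} \<subseteq> V"
proof -
  have "generate_topology_on {{F \<in> ultrafilters J. A \<in> F} |A. A \<in> J} V"
    using assms(1) unfolding ultrafilter_topology_def openin_topology_generated_by_iff .
  then have "\<forall>F\<in>V. F \<in> ultrafilters J \<and> (\<exists>A\<in>F. {G \<in> ultrafilters J. A \<in> G} \<subseteq> V)"
  proof induction
    case (Int a b)
    show ?case
    proof
      fix F assume F: "F \<in> a \<inter> b"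
      obtain A where A: "A \<in> F" "{G \<in> ultrafilters J. A \<in> G} \<subseteq> a"
          and uf: "F \<in> ultrafilters J"
        using bspec[OF Int.IH(1), of F] F by auto
      obtain B where B: "B \<in> F" "{G \<in> ultrafilters J. B \<in> G} \<subseteq> b"
        using bspec[OF Int.IH(2), of F] F by auto
      note AB = A B
      have "inf A B \<in> F" using ba_filter_inf[OF ultrafilters_filter[OF uf]] AB by blast
      moreover have "A \<in> G \<and> B \<in> G" if "G \<in> ultrafilters J" "inf A B \<in> G" for G
        using that ba_filter_up[OF ultrafilters_filter[OF that(1)] that(2)]
          ba_filter_sub[OF ultrafilters_filter[OF uf]] AB by auto
      ultimately show "F \<in> ultrafilters J \<and> (\<exists>A\<in>F. {G \<in> ultrafilters J. A \<in> G} \<subseteq> a \<inter> b)"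
        using AB uf by blast
    qed
  next
    case (UN K)
    show ?case
    proof
      fix F assume "F \<in> \<Union>K"
      then obtain k where k: "k \<in> K" "F \<in> k" by blast
      then obtain A where "F \<in> ultrafilters J" "A \<in> F" "{G \<in> ultrafilters J. A \<in> G} \<subseteq> k"
        using UN.IH by blast
      then show "F \<in> ultrafilters J \<and> (\<exists>A\<in>F. {G \<in> ultrafilters J. A \<in> G} \<subseteq> \<Union>K)"
        using k by blast
    qed
  qed auto
  then show ?thesis using that assms(2) by blast
qed

text \<open>The elements whose basic set has a finite subcover form an ideal \<open>I\<close>. If
  \<open>A\<close> were outside \<open>I\<close>, some ultrafilter would contain \<open>A\<close>
  and avoid \<open>I\<close>; but each of its points has a basic neighbourhood inside a single
  member of the cover, and the element defining it is in \<open>I\<close>.\<close>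

lemma compactin_ultrafilter_basic:
  "compactin (ultrafilter_topology UNIV) {F \<in> ultrafilters UNIV. (A::'b::generalized_boolean_algebra) \<in> F}"
proof (unfold compactin_def, intro conjI allI impI)
  let ?D = "\<lambda>X. {F \<in> ultrafilters UNIV. (X::'b) \<in> F}"
  show "?D A \<subseteq> topspace (ultrafilter_topology UNIV)" by auto
  fix \<U> assume \<U>: "Ball \<U> (openin (ultrafilter_topology UNIV)) \<and> ?D A \<subseteq> \<Union>\<U>"
  define I where "I = {X. \<exists>\<V>. finite \<V> \<and> \<V> \<subseteq> \<U> \<and> ?D X \<subseteq> \<Union>\<V>}"
  have I_I: "X \<in> I" if "finite \<V>" "\<V> \<subseteq> \<U>" "?D X \<subseteq> \<Union>\<V>" for \<V> X
    using that by (auto simp: I_def)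
  have I_sup: "sup X Y \<in> I" if XY: "X \<in> I" "Y \<in> I" for X Y
  proof -
    obtain \<V> \<W> where "finite \<V>" "\<V> \<subseteq> \<U>" "?D X \<subseteq> \<Union>\<V>" "finite \<W>" "\<W> \<subseteq> \<U>" "?D Y \<subseteq> \<Union>\<W>"
      using XY by (auto simp: I_def)
    moreover have "?D (sup X Y) = ?D X \<union> ?D Y"
      using ultrafilter_sup_iff[of _ X Y] by auto
    ultimately have "finite (\<V> \<union> \<W>)" "\<V> \<union> \<W> \<subseteq> \<U>" "?D (sup X Y) \<subseteq> \<Union>(\<V> \<union> \<W>)"
      by (simp_all only: finite_Un Un_least Union_Un_distrib Un_mono)
    then show ?thesis by (rule I_I)
  qed
  have I_down: "X \<in> I" if Y: "Y \<in> I" and XY: "X \<le> Y" for X Y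
  proof -
    have "?D X \<subseteq> ?D Y" using XY ba_filter_up[OF ultrafilters_filter] by blast
    moreover obtain \<V> where "finite \<V>" "\<V> \<subseteq> \<U>" "?D Y \<subseteq> \<Union>\<V>" using Y by (auto simp: I_def)
    ultimately show ?thesis by (blast intro: I_I)
  qed
  have "?D bot = {}" using ba_filter_bot[OF ultrafilters_filter] by blast
  then have I_bot: "bot \<in> I" by (intro I_I[of "{}"]) auto
  have "A \<in> I"
  proof (rule ccontr)
    assume A: "A \<notin> I"
    \<comment> \<open>The elements that contain \<open>A\<close> modulo \<open>I\<close>; this
      filter is proper because \<open>A \<notin> I\<close>.\<close>
    define F where "F = {X. \<exists>Y\<in>I. A \<le> sup X Y}"
    have AF: "A \<in> F" using I_bot unfolding F_def by (intro CollectI bexI[of _ bot]) auto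
    have "ba_filter UNIV F"
      unfolding ba_filter_def
    proof (intro conjI ballI impI)
      show "F \<noteq> {}" using AF by blast
      show "bot \<notin> F" using A I_down by (auto simp: F_def sup_bot_absorb)
      fix X X' assume X: "X \<in> F"
      { assume "X \<le> X'"
        then show "X' \<in> F" using X unfolding F_def by (blast intro: order_trans[OF _ sup_mono[OF _ order_refl]]) }
      assume X': "X' \<in> F"
      obtain Y Y' where Y: "Y \<in> I" "Y' \<in> I" "A \<le> sup X Y" "A \<le> sup X' Y'"
        using X X' by (auto simp: F_def)
      have "A \<le> sup X (sup Y Y')" "A \<le> sup X' (sup Y Y')"
        using Y(3,4) by (meson order.trans sup.mono order_refl sup_ge1 sup_ge2)+
      then have "A \<le> sup (inf X X') (sup Y Y')" by (simp add: sup_inf_distrib2)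
      then show "inf X X' \<in> F" using I_sup[OF Y(1,2)] unfolding F_def by blast
    qed auto
    then obtain \<xi> where \<xi>: "\<xi> \<in> ultrafilters UNIV" "F \<subseteq> \<xi>" by (rule ultrafilter_extension)
    then obtain V where V: "V \<in> \<U>" "\<xi> \<in> V" using \<U> AF by blast
    then obtain B where B: "B \<in> \<xi>" "?D B \<subseteq> V" using \<U> ultrafilter_neighbourhood by metis
    then have "B \<in> I" using V by (intro I_I[of "{V}"]) auto
    \<comment> \<open>\<open>A\<close> lies below \<open>sup (A - B) B\<close> with \<open>B\<close>
      in \<open>I\<close>. So \<xi> contains both \<open>A - B\<close> and \<open>B\<close>, which
      are disjoint.\<close>
    then have "A - B \<in> F" using le_sup_diff unfolding F_def by blast
    then show False
      using \<xi> B ba_filter_inf[OF ultrafilters_filter[OF \<xi>(1)], of "A - B" B]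
        ba_filter_bot[OF ultrafilters_filter[OF \<xi>(1)]] by (auto simp: inf_diff_self)
  qed
  then show "\<exists>\<F>. finite \<F> \<and> \<F> \<subseteq> \<U> \<and> ?D A \<subseteq> \<Union>\<F>" unfolding I_def by blast
qed

text \<open>With \<open>ultrafilter_upclosure\<close> this gives a bijection between the
  ultrafilters of the ideal \<open>J\<close> and the ultrafilters of the whole algebra that meet
  \<open>J\<close>: restriction in one direction, upward closure in the other.\<close>

lemma ultrafilter_restrict:
  assumes J: "ba_ideal J" and \<xi>: "\<xi> \<in> ultrafilters UNIV" and ne: "\<xi> \<inter> J \<noteq> {}"
  shows "\<xi> \<inter> J \<in> ultrafilters J" and "{B. \<exists>A\<in>\<xi> \<inter> J. A \<le> B} = \<xi>"
proof -
  note filt = ultrafilters_filter[OF \<xi>]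
  have Ji: "\<And>A B. A \<in> J \<Longrightarrow> inf A B \<in> J" using J by (simp add: ba_ideal_def)
  have Jd: "\<And>A B. A \<in> J \<Longrightarrow> A - B \<in> J" using ba_ideal_down[OF J] diff_le by blast
  have pr: "\<And>A B. A \<in> \<xi> \<Longrightarrow> inf A B \<in> \<xi> \<or> A - B \<in> \<xi>"
    using \<xi> by (simp add: ultrafilters_iff[OF ba_ideal_UNIV])
  have "ba_filter J (\<xi> \<inter> J)"
    using ne filt Ji unfolding ba_filter_def by auto
  then show "\<xi> \<inter> J \<in> ultrafilters J"
    unfolding ultrafilters_iff[OF J] using pr Ji Jd by blast
  obtain C where C: "C \<in> \<xi>" "C \<in> J" using ne by blast
  show "{B. \<exists>A\<in>\<xi> \<inter> J. A \<le> B} = \<xi>"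
  proof (intro equalityI subsetI)
    fix B assume "B \<in> \<xi>"
    then have "inf C B \<in> \<xi> \<inter> J" using C Ji ba_filter_inf[OF filt] by blast
    then show "B \<in> {B. \<exists>A\<in>\<xi> \<inter> J. A \<le> B}" using inf_le2 by blast
  qed (use ba_filter_up[OF filt] in auto)
qed

lemma ultrafilter_upclosure:
  assumes J: "ba_ideal J" and \<eta>: "\<eta> \<in> ultrafilters J"
  shows "{B. \<exists>A\<in>\<eta>. A \<le> B} \<in> ultrafilters UNIV" and "{B. \<exists>A\<in>\<eta>. A \<le> B} \<inter> J = \<eta>"
proof -
  let ?\<xi> = "{B. \<exists>A\<in>\<eta>. A \<le> B}"
  note filt = ultrafilters_filter[OF \<eta>]
  show "?\<xi> \<inter> J = \<eta>"
  proof (intro equalityI subsetI)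
    fix B assume "B \<in> ?\<xi> \<inter> J"
    then obtain A where "A \<in> \<eta>" "A \<le> B" "B \<in> J" by auto
    then show "B \<in> \<eta>" by (meson ba_filter_up[OF filt])
  qed (use ba_filter_sub[OF filt] in auto)
  have Ji: "\<And>A B. A \<in> J \<Longrightarrow> inf A B \<in> J" using J by (simp add: ba_ideal_def)
  have "ba_filter UNIV ?\<xi>"
    unfolding ba_filter_def
  proof (intro conjI ballI impI)
    show "?\<xi> \<noteq> {}" using ba_filter_nonempty[OF filt] by blast
    show "bot \<notin> ?\<xi>" using ba_filter_bot[OF filt] by (auto simp: bot_unique)
    fix A B assume A: "A \<in> ?\<xi>"
    { assume "A \<le> B" then show "B \<in> ?\<xi>" using A by (blast intro: order_trans) }
    assume "B \<in> ?\<xi>"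
    then obtain A' B' where "A' \<in> \<eta>" "B' \<in> \<eta>" "A' \<le> A" "B' \<le> B" using A by blast
    then show "inf A B \<in> ?\<xi>" using ba_filter_inf[OF filt] inf_mono by blast
  qed auto
  moreover have "inf A B \<in> ?\<xi> \<or> A - B \<in> ?\<xi>" if A: "A \<in> ?\<xi>" for A B
  proof -
    obtain A' where A': "A' \<in> \<eta>" "A' \<le> A" using A by blast
    \<comment> \<open>\<open>B\<close> need not lie in \<open>J\<close>, so the dichotomy in
      \<open>J\<close> is applied to \<open>inf A' B\<close> instead.\<close>
    have "inf A' (inf A B) \<in> \<eta> \<or> A' - (inf A' B) \<in> \<eta>"
    proof -
      have "inf A' (inf A' B) \<in> \<eta> \<or> A' - (inf A' B) \<in> \<eta>"
        using \<eta> A' Ji ba_filter_sub[OF filt] unfolding ultrafilters_iff[OF J] by blast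
      moreover have "inf A' (inf A' B) = inf A' (inf A B)"
        using A'(2) by (metis inf.absorb1 inf.assoc inf.left_idem)
      ultimately show ?thesis by simp
    qed
    moreover have "A' - inf A' B \<le> A - B"
    proof -
      let ?D = "A' - inf A' B"
      have "?D \<le> A'" by (rule diff_le)
      then have "inf ?D (inf A B) = bot"
        using inf_diff_self[of A' "inf A' B"] A'(2)
        by (metis inf.absorb1 inf.assoc inf.left_commute)
      moreover have "?D \<le> A" using \<open>?D \<le> A'\<close> A'(2) by simp
      ultimately have "?D = inf ?D (A - B)"
        by (metis inf.absorb1 inf_sup_diff inf_sup_distrib1 sup_bot_absorb)
      then show ?thesis by (metis inf_le2)
    qed
    ultimately show ?thesis using inf_le2 by blast
  qed
  ultimately show "?\<xi> \<in> ultrafilters UNIV" by (auto simp: ultrafilters_iff[OF ba_ideal_UNIV])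
qed

text \<open>The dichotomy of \<open>ultrafilters_iff\<close> uses only \<open>inf\<close> and
  difference, which \<open>h\<close> preserves, so it pulls back. Only non-emptiness can fail, since
  no \<open>h A\<close> need lie in \<eta>; hence the extra point \<open>{}\<close>.\<close>

lemma ultrafilter_preimage:
  assumes J: "ba_ideal J" and \<eta>: "\<eta> \<in> ultrafilters J" and h: "ba_action h" and hJ: "range h \<subseteq> J"
  shows "{A. h A \<in> \<eta>} \<in> insert {} (ultrafilters UNIV)"
proof -
  note filt = ultrafilters_filter[OF \<eta>]
  have hm: "h A \<le> h B" if "A \<le> B" for A B
    using h that unfolding ba_action_def by (metis inf.absorb_iff1)
  have "{A. h A \<in> \<eta>} \<in> ultrafilters UNIV" if "{A. h A \<in> \<eta>} \<noteq> {}"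
    unfolding ultrafilters_iff[OF ba_ideal_UNIV]
  proof
    show "ba_filter UNIV {A. h A \<in> \<eta>}"
      unfolding ba_filter_def
    proof (intro conjI ballI impI)
      show "bot \<notin> {A. h A \<in> \<eta>}" using h ba_filter_bot[OF filt] by (simp add: ba_action_def)
      fix A B assume A: "A \<in> {A. h A \<in> \<eta>}"
      { assume "A \<le> B"
        then show "B \<in> {A. h A \<in> \<eta>}" using A hm hJ ba_filter_up[OF filt, of "h A" "h B"] by blast }
      assume "B \<in> {A. h A \<in> \<eta>}"
      then show "inf A B \<in> {A. h A \<in> \<eta>}"
        using A h ba_filter_inf[OF filt] by (simp add: ba_action_def)
    qed (use that in auto)
    show "\<forall>A\<in>{A. h A \<in> \<eta>}. \<forall>B\<in>UNIV. inf A B \<in> {A. h A \<in> \<eta>} \<or> A - B \<in> {A. h A \<in> \<eta>}"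
      using \<eta> h hJ unfolding ultrafilters_iff[OF J] ba_action_def by auto
  qed
  then show ?thesis by blast
qed

section \<open>Partial actions of free groups from partial bijections\<close>

text \<open>\<open>O\<close> composes from left to right, so the last letter of a word acts first,
  as for a product of group elements acting from the left.\<close>

definition word_rel :: "'x set \<Rightarrow> ('l \<times> bool \<Rightarrow> 'x rel) \<Rightarrow> ('l \<times> bool) list \<Rightarrow> 'x rel" where
  "word_rel X h w = foldr (\<lambda>x R. R O h x) w (Id_on X)"

lemma word_rel_simps [simp]:
  "word_rel X h [] = Id_on X"
  "word_rel X h (x # w) = word_rel X h w O h x"
  by (simp_all add: word_rel_def)

text \<open>Injectivity of \<open>h x\<close> is contained in \<open>h_inv\<close> and
  \<open>h_sv\<close>: it is single-valuedness of \<open>h (letter_inv x)\<close>.\<close>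

locale letter_partial_bijections =
  fixes X :: "'x set" and h :: "'l \<times> bool \<Rightarrow> 'x rel"
  assumes h_sub: "h x \<subseteq> X \<times> X"
    and h_inv: "h (letter_inv x) = (h x)\<inverse>"
    and h_sv: "single_valued (h x)"
begin

lemma word_rel_sub: "word_rel X h w \<subseteq> X \<times> X"
proof (induction w)
  case (Cons x w)
  then show ?case using h_sub[of x] by auto
qed (auto simp: Id_on_def)

lemma word_rel_Id: "Id_on X O word_rel X h w = word_rel X h w" "word_rel X h w O Id_on X = word_rel X h w"
  using word_rel_sub[of w] by auto

lemma word_rel_append: "word_rel X h (v @ w) = word_rel X h w O word_rel X h v"
  by (induction v) (simp_all add: word_rel_Id O_assoc)

lemma word_rel_inverse: "word_rel X h (map letter_inv (rev w)) = (word_rel X h w)\<inverse>"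
proof (induction w)
  case (Cons x w)
  have "Id_on X O h (letter_inv x) = h (letter_inv x)"
    using h_sub[of "letter_inv x"] by auto
  then show ?case using Cons by (simp add: word_rel_append h_inv converse_relcomp)
qed auto

lemma word_rel_single_valued: "single_valued (word_rel X h w)"
  by (induction w) (auto intro: single_valued_relcomp h_sv)

text \<open>Undoing a letter and then applying it is the identity, but only where the letter can be
  undone. A cancellation therefore gives an inclusion and in general no equality.\<close>

lemma word_rel_letter_mult: "word_rel X h w O h x \<subseteq> word_rel X h (letter_mult x w)"
proof (cases w)
  case (Cons y v)
  have "(word_rel X h v O (h x)\<inverse>) O h x \<subseteq> word_rel X h v"
    using h_sv[of x] by (auto dest: single_valuedD)
  then show ?thesis using Cons by (auto simp: h_inv)
qed simp

lemma word_rel_mult: "word_rel X h t O word_rel X h s \<subseteq> word_rel X h (foldr letter_mult s t)"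
proof (induction s)
  case (Cons x s)
  have "word_rel X h t O word_rel X h (x # s) = (word_rel X h t O word_rel X h s) O h x"
    by (simp add: O_assoc)
  also have "\<dots> \<subseteq> word_rel X h (foldr letter_mult s t) O h x"
    by (intro relcomp_mono Cons.IH order_refl)
  also have "\<dots> \<subseteq> word_rel X h (letter_mult x (foldr letter_mult s t))"
    by (rule word_rel_letter_mult)
  finally show ?case by simp
qed (simp add: word_rel_Id)

end

section \<open>Lengths and inverses in the free group\<close>

lemma length_letter_mult: "length (letter_mult x w) \<le> Suc (length w)"
  by (cases w) auto

lemma letter_mult_eq_Cons: "length (letter_mult x w) = Suc (length w) \<Longrightarrow> letter_mult x w = x # w"
  by (cases w) (auto split: if_splits)

text \<open>Each letter lengthens the word by at most one, so full length forces every letter to be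
  attached without cancellation.\<close>

lemma foldr_letter_mult_eq_append:
  "length (foldr letter_mult s t) = length s + length t \<Longrightarrow> foldr letter_mult s t = s @ t"
proof (induction s)
  case (Cons x s)
  have "length (foldr letter_mult s t) \<le> length s + length t" for s :: "('a \<times> bool) list"
    by (induction s) (auto intro: order_trans[OF length_letter_mult])
  then have "length (foldr letter_mult s t) = length s + length t"
    using Cons.prems length_letter_mult[of x "foldr letter_mult s t"]
    by (metis add_Suc foldr_Cons comp_apply length_Cons le_antisym not_less_eq_eq)
  then show ?case using Cons letter_mult_eq_Cons[of x "s @ t"] by simp
qed simp

lemma inv_free_group:
  assumes "t \<in> carrier (free_group L)"
  shows "inv\<^bsub>free_group L\<^esub> t = map letter_inv (rev t)"
proof (rule group.inv_equality[OF group_free_group _ assms])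
  show "map letter_inv (rev t) \<otimes>\<^bsub>free_group L\<^esub> t = \<one>\<^bsub>free_group L\<^esub>"
    using assms foldr_letter_mult_inv[of "[]" t] foldr_letter_mult_reduced[of t]
    by (simp add: free_group_def reduced_def)
  show "map letter_inv (rev t) \<in> carrier (free_group L)"
    using assms by (auto simp: free_group_def reduced_inverse letter_inv_def mem_Times_iff)
qed

text \<open>Only images of open sets under single letters need control: words inherit openness by
  composition, and the inverse of a word is again a word. The functions \<open>\<phi> t\<close>
  enter through their graphs alone.\<close>

theorem (in letter_partial_bijections) semi_saturated_partial_action:
  fixes L :: "'l set"
  assumes top: "topspace T = X"
    and opn: "\<And>x W. openin T W \<Longrightarrow> openin T (h x `` W)"
    and graph: "\<And>t x y. t \<in> carrier (free_group L) \<Longrightarrow>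
      (x, y) \<in> word_rel X h t \<longleftrightarrow> x \<in> U (map letter_inv (rev t)) \<and> y = \<phi> t x"
  shows "partial_action (free_group L) T U \<phi>" and "semi_saturated L U \<phi>"
proof -
  let ?G = "free_group L"
  let ?H = "word_rel X h"
  interpret group ?G by (rule group_free_group)
  have mult: "s \<otimes>\<^bsub>?G\<^esub> t = foldr letter_mult s t" for s t
    by (simp add: free_group_def)
  have one: "\<one>\<^bsub>?G\<^esub> = []" by (simp add: free_group_def)
  have gr: "(x, y) \<in> ?H t \<longleftrightarrow> x \<in> U (inv\<^bsub>?G\<^esub> t) \<and> y = \<phi> t x" if "t \<in> carrier ?G" for t x y
    using graph[OF that] inv_free_group[OF that] by simp
  have H_inv: "?H (inv\<^bsub>?G\<^esub> t) = (?H t)\<inverse>" if "t \<in> carrier ?G" for t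
    by (simp add: inv_free_group[OF that] word_rel_inverse)
  \<comment> \<open>\<open>U t\<close> is the domain for the inverse word, whose relation is the
    converse of that of \<open>t\<close>.\<close>
  have U_Range: "y \<in> U t \<longleftrightarrow> (\<exists>x. (x, y) \<in> ?H t)" if t: "t \<in> carrier ?G" for t y
    using gr[OF inv_closed[OF t], of y] H_inv[OF t] t by auto
  have H_mult: "(x, z) \<in> ?H (s \<otimes>\<^bsub>?G\<^esub> t)" if "(x, y) \<in> ?H t" "(y, z) \<in> ?H s" for x y z s t
    using word_rel_mult that unfolding mult by blast
  have H_open: "openin T (?H t `` W)" if "openin T W" for t W
  proof (induction t)
    case Nil
    have "Id_on X `` W = W" using openin_subset[OF that] top by auto
    then show ?case using that by simp
  next
    case (Cons x t)
    then show ?case by (simp add: relcomp_Image opn)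
  qed
  show "partial_action ?G T U \<phi>"
  proof (unfold_locales)
    fix t assume t: "t \<in> carrier ?G"
    have U_eq: "U t = ?H t `` X" if "t \<in> carrier ?G" for t
      using U_Range[OF that] word_rel_sub[of t] by auto
    then show "openin T (U t)" using H_open[of "X"] top t openin_topspace by metis
    have sub: "U t \<subseteq> X" if "t \<in> carrier ?G" for t
      using U_Range[OF that] word_rel_sub[of t] by auto
    have img: "\<phi> t ` (W \<inter> U (inv\<^bsub>?G\<^esub> t)) = ?H t `` W" for W
      using gr[OF t] by auto
    \<comment> \<open>Preimages under \<open>\<phi> t\<close> are images under the relation of the
      inverse word, which turns continuity into \<open>H_open\<close>.\<close>
    have pre: "{x \<in> U (inv\<^bsub>?G\<^esub> t). \<phi> t x \<in> W} = (?H t)\<inverse> `` W" for W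
      using gr[OF t] by auto
    have opens: "openin T (U (inv\<^bsub>?G\<^esub> t))" "openin T (U t)"
      using U_eq H_open[of "X"] top t openin_topspace inv_closed[OF t] by metis+
    show "homeomorphic_map (subtopology T (U (inv\<^bsub>?G\<^esub> t))) (subtopology T (U t)) (\<phi> t)"
    proof (rule bijective_open_imp_homeomorphic_map)
      have ts: "topspace (subtopology T (U (inv\<^bsub>?G\<^esub> t))) = U (inv\<^bsub>?G\<^esub> t)"
        "topspace (subtopology T (U t)) = U t"
        using opens by (auto dest: openin_subset)
      have "\<phi> t ` U (inv\<^bsub>?G\<^esub> t) = U t"
        using img[of UNIV] U_eq[OF t] word_rel_sub[of t] by auto
      then show surj: "\<phi> t ` topspace (subtopology T (U (inv\<^bsub>?G\<^esub> t))) = topspace (subtopology T (U t))"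
        by (simp only: ts)
      show "inj_on (\<phi> t) (topspace (subtopology T (U (inv\<^bsub>?G\<^esub> t))))"
        unfolding ts
      proof (rule inj_onI)
        fix x y assume xy: "x \<in> U (inv\<^bsub>?G\<^esub> t)" "y \<in> U (inv\<^bsub>?G\<^esub> t)" "\<phi> t x = \<phi> t y"
        then have "(x, \<phi> t x) \<in> ?H t" "(y, \<phi> t x) \<in> ?H t" using gr[OF t] by auto
        then have "(\<phi> t x, x) \<in> ?H (inv\<^bsub>?G\<^esub> t)" "(\<phi> t x, y) \<in> ?H (inv\<^bsub>?G\<^esub> t)"
          by (simp_all add: H_inv[OF t])
        then show "x = y" using word_rel_single_valued single_valuedD by metis
      qed
      show "open_map (subtopology T (U (inv\<^bsub>?G\<^esub> t))) (subtopology T (U t)) (\<phi> t)"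
        unfolding open_map_def openin_subtopology
      proof (intro allI impI, elim exE conjE)
        fix V W assume W: "openin T W" "V = W \<inter> U (inv\<^bsub>?G\<^esub> t)"
        then have "\<phi> t ` V = ?H t `` W \<inter> U t" using img U_Range[OF t] by auto
        then show "\<exists>S. openin T S \<and> \<phi> t ` V = S \<inter> U t" using H_open[OF W(1)] by blast
      qed
      show "continuous_map (subtopology T (U (inv\<^bsub>?G\<^esub> t))) (subtopology T (U t)) (\<phi> t)"
        unfolding continuous_map_def ts openin_subtopology
      proof (intro conjI allI impI)
        show "\<phi> t \<in> U (inv\<^bsub>?G\<^esub> t) \<rightarrow> U t" using surj unfolding ts by auto
        fix V assume "\<exists>W. openin T W \<and> V = W \<inter> U t"
        then obtain W where W: "openin T W" "V = W \<inter> U t" by blast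
        have "{x \<in> U (inv\<^bsub>?G\<^esub> t). \<phi> t x \<in> V} = (?H t)\<inverse> `` W \<inter> U (inv\<^bsub>?G\<^esub> t)"
          using W surj pre[of W] unfolding ts by auto
        then show "\<exists>S. openin T S \<and> {x \<in> U (inv\<^bsub>?G\<^esub> t). \<phi> t x \<in> V} = S \<inter> U (inv\<^bsub>?G\<^esub> t)"
          using H_open[OF W(1), of "inv\<^bsub>?G\<^esub> t"] by (metis H_inv[OF t])
      qed
    qed
  next
    have "x \<in> U \<one>\<^bsub>?G\<^esub> \<longleftrightarrow> x \<in> X" for x using U_Range[OF one_closed, of x] by (auto simp: one)
    then show "U \<one>\<^bsub>?G\<^esub> = topspace T" using top by blast
    fix x assume "x \<in> topspace T"
    then have "(x, x) \<in> ?H []" using top by auto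
    then show "\<phi> \<one>\<^bsub>?G\<^esub> x = x" using gr[OF one_closed, of x x] by (simp add: one)
  next
    fix s t assume st: "s \<in> carrier ?G" "t \<in> carrier ?G"
    then have stc: "s \<otimes>\<^bsub>?G\<^esub> t \<in> carrier ?G" by simp
    show "\<phi> s ` (U (inv\<^bsub>?G\<^esub> s) \<inter> U t) = U s \<inter> U (s \<otimes>\<^bsub>?G\<^esub> t)"
    proof (intro equalityI subsetI)
      fix z assume "z \<in> \<phi> s ` (U (inv\<^bsub>?G\<^esub> s) \<inter> U t)"
      then obtain y x where "(y, z) \<in> ?H s" "(x, y) \<in> ?H t"
        using gr[OF st(1)] U_Range[OF st(2)] by auto
      then show "z \<in> U s \<inter> U (s \<otimes>\<^bsub>?G\<^esub> t)"
        using U_Range[OF st(1)] U_Range[OF stc] H_mult by blast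
    next
      fix z assume "z \<in> U s \<inter> U (s \<otimes>\<^bsub>?G\<^esub> t)"
      then obtain x y where xy: "(x, z) \<in> ?H s" "(y, z) \<in> ?H (s \<otimes>\<^bsub>?G\<^esub> t)"
        using U_Range[OF st(1)] U_Range[OF stc] by blast
      then have "(z, x) \<in> ?H (inv\<^bsub>?G\<^esub> s)" by (simp add: H_inv[OF st(1)])
      \<comment> \<open>Following \<open>s \<otimes> t\<close> and then undoing \<open>s\<close>
        stays inside the relation of the product, which is \<open>t\<close>; so
        \<open>(y, x)\<close> witnesses \<open>x \<in> U t\<close>.\<close>
      then have "(y, x) \<in> ?H (inv\<^bsub>?G\<^esub> s \<otimes>\<^bsub>?G\<^esub> (s \<otimes>\<^bsub>?G\<^esub> t))" by (rule H_mult[OF xy(2)])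
      then have "x \<in> U t" using U_Range[OF st(2)] st by (auto simp: inv_solve_left' m_assoc[symmetric])
      then show "z \<in> \<phi> s ` (U (inv\<^bsub>?G\<^esub> s) \<inter> U t)" using xy(1) gr[OF st(1)] by auto
    qed
    fix x assume x: "x \<in> U (inv\<^bsub>?G\<^esub> t) \<inter> U (inv\<^bsub>?G\<^esub> (s \<otimes>\<^bsub>?G\<^esub> t))"
    then have 1: "(x, \<phi> t x) \<in> ?H t" "(x, \<phi> (s \<otimes>\<^bsub>?G\<^esub> t) x) \<in> ?H (s \<otimes>\<^bsub>?G\<^esub> t)"
      using gr[OF st(2)] gr[OF stc] by auto
    then have "(\<phi> t x, x) \<in> ?H (inv\<^bsub>?G\<^esub> t)" by (simp add: H_inv[OF st(2)])
    \<comment> \<open>Undoing \<open>t\<close> and then following \<open>s \<otimes> t\<close> stays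
      inside the relation of \<open>s\<close>, whose graph determines the value.\<close>
    then have "(\<phi> t x, \<phi> (s \<otimes>\<^bsub>?G\<^esub> t) x) \<in> ?H ((s \<otimes>\<^bsub>?G\<^esub> t) \<otimes>\<^bsub>?G\<^esub> inv\<^bsub>?G\<^esub> t)"
      by (rule H_mult[OF _ 1(2)])
    then show "\<phi> s (\<phi> t x) = \<phi> (s \<otimes>\<^bsub>?G\<^esub> t) x"
      using gr[OF st(1)] st by (simp add: m_assoc)
  qed
  show "semi_saturated L U \<phi>"
    unfolding semi_saturated_def Let_def
  proof (intro ballI impI)
    fix s t assume st: "s \<in> carrier ?G" "t \<in> carrier ?G"
      and len: "length (s \<otimes>\<^bsub>?G\<^esub> t) = length s + length t"
    have stc: "s \<otimes>\<^bsub>?G\<^esub> t \<in> carrier ?G" using st by simp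
    \<comment> \<open>When no cancellation occurs, the inclusion of \<open>H_mult\<close> becomes an
      equality.\<close>
    have "?H (s \<otimes>\<^bsub>?G\<^esub> t) = ?H t O ?H s"
      using foldr_letter_mult_eq_append[of s t] len unfolding mult by (simp add: word_rel_append)
    then have *: "x \<in> U (inv\<^bsub>?G\<^esub> (s \<otimes>\<^bsub>?G\<^esub> t)) \<and> z = \<phi> (s \<otimes>\<^bsub>?G\<^esub> t) x \<longleftrightarrow>
        x \<in> U (inv\<^bsub>?G\<^esub> t) \<and> \<phi> t x \<in> U (inv\<^bsub>?G\<^esub> s) \<and> z = \<phi> s (\<phi> t x)" for x z
      using gr[OF stc, of x z] gr[OF st(1)] gr[OF st(2)] by auto
    show "{x \<in> U (inv\<^bsub>?G\<^esub> t). \<phi> t x \<in> U (inv\<^bsub>?G\<^esub> s)} = U (inv\<^bsub>?G\<^esub> (s \<otimes>\<^bsub>?G\<^esub> t)) \<and>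
      (\<forall>x\<in>U (inv\<^bsub>?G\<^esub> (s \<otimes>\<^bsub>?G\<^esub> t)). \<phi> s (\<phi> t x) = \<phi> (s \<otimes>\<^bsub>?G\<^esub> t) x)"
      using * by auto
  qed
qed

section \<open>Paths and their shifts\<close>

context generalized_boolean_dynamical_system
begin

lemma \<theta>_mono: "a \<in> L \<Longrightarrow> A \<le> B \<Longrightarrow> \<theta> a A \<le> \<theta> a B"
  using action unfolding ba_action_def by (metis inf.absorb_iff1)

lemma \<theta>_mem: "a \<in> L \<Longrightarrow> \<theta> a A \<in> \<I> a"
  using range_subset[of a] by auto

lemma word_action_simps [simp]:
  "word_action [] A = A" "word_action (a # \<alpha>) A = word_action \<alpha> (\<theta> a A)"
  by (simp_all add: word_action_def)

lemma word_ideal_singleton [simp]: "a \<in> L \<Longrightarrow> word_ideal [a] = \<I> a"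
  using ba_ideal_down[OF ideal] by auto

lemma word_ideal_down: "A \<in> word_ideal \<alpha> \<Longrightarrow> B \<le> A \<Longrightarrow> B \<in> word_ideal \<alpha>"
  by (cases \<alpha>) (auto intro: order_trans)

lemma word_action_mem: "A \<in> \<I> a \<Longrightarrow> word_action \<alpha> A \<in> word_ideal (a # \<alpha>)"
  by auto

text \<open>By \<open>range_subset\<close> the map \<open>\<theta> c\<close> sends every element
  into \<open>\<I> c\<close>; so for \<open>B\<close> in \<open>\<I> a\<close>, the element
  \<open>\<theta> c B\<close> is an admissible witness for a word beginning with
  \<open>c\<close>.\<close>

lemma word_ideal_Cons_subset:
  assumes "a # \<alpha> \<in> lists L"
  shows "word_ideal (a # \<alpha>) \<subseteq> word_ideal \<alpha>"
proof
  fix A assume "A \<in> word_ideal (a # \<alpha>)"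
  then obtain B where B: "B \<in> \<I> a" "A \<le> word_action \<alpha> B" by auto
  show "A \<in> word_ideal \<alpha>"
  proof (cases \<alpha>)
    case (Cons c \<gamma>)
    then have "word_action \<gamma> (\<theta> c B) \<in> word_ideal \<alpha>"
      using assms word_action_mem[OF \<theta>_mem] by simp
    moreover have "A \<le> word_action \<gamma> (\<theta> c B)" using B(2) Cons by simp
    ultimately show ?thesis by (rule word_ideal_down)
  qed simp
qed

lemma E1_iff: "(a, \<eta>) \<in> E1 \<longleftrightarrow> a \<in> L \<and> \<eta> \<in> ultrafilters (\<I> a)"
  by (simp add: E1_def)

lemma edge_dom_mem: "e \<in> E1 \<Longrightarrow> edge_dom e \<in> E0"
  using ultrafilter_upclosure(1)[OF ideal] by (cases e) (auto simp: E1_iff E0_def)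

lemma edge_dom_Int: "(a, \<eta>) \<in> E1 \<Longrightarrow> edge_dom (a, \<eta>) \<inter> \<I> a = \<eta>"
  using ultrafilter_upclosure(2)[OF ideal] by (simp add: E1_iff)

lemma edge_range_mem: "e \<in> E1 \<Longrightarrow> edge_range e \<in> F0"
  using ultrafilter_preimage[OF ideal _ action, of "fst e" "snd e" "fst e"] \<theta>_mem[of "fst e"]
  by (cases e) (auto simp only: E1_iff F0_def E0_def edge_range_def f_map_def fst_conv snd_conv)

text \<open>Over a vertex that meets \<open>\<I> a\<close> there is exactly one edge labelled
  \<open>a\<close> ending there. This is the existence; uniqueness comes from
  \<open>edge_dom_Int\<close>.\<close>

lemma edge_over_vertex:
  assumes "a \<in> L" "\<xi> \<in> F0" "\<xi> \<inter> \<I> a \<noteq> {}"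
  shows "(a, \<xi> \<inter> \<I> a) \<in> E1" and "edge_dom (a, \<xi> \<inter> \<I> a) = \<xi>"
proof -
  have "\<xi> \<in> ultrafilters UNIV" using assms by (auto simp: F0_def E0_def)
  from ultrafilter_restrict[OF ideal[OF assms(1)] this assms(3)] assms(1)
  show "(a, \<xi> \<inter> \<I> a) \<in> E1" and "edge_dom (a, \<xi> \<inter> \<I> a) = \<xi>"
    by (simp_all add: E1_iff)
qed

text \<open>No condition on the endpoint: shifts are studied on all paths first and then restricted
  to the boundary, which is invariant.\<close>

definition paths :: "('l, 'b) gpath set" where
  "paths = E_star \<union> E_inf"

lemma E_star_Vertex [simp]: "Vertex v \<in> E_star \<longleftrightarrow> v \<in> E0"
  by (auto simp: E_star_def E_n_def split: if_splits)

lemma E_star_Fin_path: "Fin_path p \<in> E_star \<longleftrightarrow>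
    p \<noteq> [] \<and> p \<in> lists E1 \<and> successively (\<lambda>e e'. edge_dom e = edge_range e') p"
  by (auto simp: E_star_def E_n_def split: if_splits intro: exI[of _ "length p"])

lemma E_star_Inf_path [simp]: "Inf_path f \<notin> E_star"
  by (auto simp: E_star_def E_n_def split: if_splits)

lemma paths_Vertex [simp]: "Vertex v \<in> paths \<longleftrightarrow> v \<in> E0"
  by (auto simp: paths_def E_inf_def)

lemma paths_Fin_path: "Fin_path p \<in> paths \<longleftrightarrow> Fin_path p \<in> E_star"
  by (auto simp: paths_def E_inf_def)

lemma paths_Inf_path: "Inf_path f \<in> paths \<longleftrightarrow> (\<forall>i. f i \<in> E1 \<and> edge_dom (f i) = edge_range (f (Suc i)))"
  by (auto simp: paths_def E_inf_def)

lemma path_range_mem: "\<mu> \<in> paths \<Longrightarrow> path_range \<mu> \<in> F0"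
  by (cases \<mu>) (auto simp: F0_def[symmetric] paths_Fin_path E_star_Fin_path paths_Inf_path
      intro!: edge_range_mem intro: F0_def[THEN equalityD2, THEN subsetD])

lemma prepend_mem_paths:
  assumes "e \<in> E1" "\<nu> \<in> paths" "edge_dom e = path_range \<nu>"
  shows "prepend [e] \<nu> \<in> paths"
proof (cases \<nu>)
  case (Fin_path p)
  then show ?thesis using assms
    by (cases p) (auto simp: paths_Fin_path E_star_Fin_path)
next
  case (Inf_path f)
  have "(i = 0 \<longrightarrow> e \<in> E1 \<and> edge_dom e = edge_range (f 0)) \<and>
      (0 < i \<longrightarrow> f (i - Suc 0) \<in> E1 \<and> edge_dom (f (i - Suc 0)) = edge_range (f i))" for i
    using assms Inf_path by (cases i) (auto simp: paths_Inf_path)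
  then show ?thesis unfolding Inf_path prepend.simps paths_Inf_path by simp
qed (use assms in \<open>auto simp: paths_Fin_path E_star_Fin_path\<close>)

lemma paths_cases:
  assumes "\<mu> \<in> paths"
  obtains (Vertex) v where "\<mu> = Vertex v" "v \<in> E0"
    | (prepend) e \<nu> where "\<mu> = prepend [e] \<nu>" "e \<in> E1" "\<nu> \<in> paths" "edge_dom e = path_range \<nu>"
proof (cases \<mu>)
  case (Vertex v)
  then show ?thesis using assms that by auto
next
  case (Fin_path p)
  then obtain e q where p: "p = e # q" using assms
    by (cases p) (auto simp: paths_Fin_path E_star_Fin_path)
  show ?thesis
  proof (cases q)
    case Nil
    \<comment> \<open>A single edge is obtained by prepending it to the vertex at which it
      ends.\<close>
    then show ?thesis using that(2)[of e "Vertex (edge_dom e)"] p Fin_path assms edge_dom_mem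
      by (auto simp: paths_Fin_path E_star_Fin_path)
  next
    case (Cons e' q')
    then show ?thesis using that(2)[of e "Fin_path q"] p Fin_path assms
      by (auto simp: paths_Fin_path E_star_Fin_path)
  qed
next
  case (Inf_path f)
  have "Inf_path f = prepend [f 0] (Inf_path (\<lambda>i. f (Suc i)))"
    by (auto intro!: ext)
  then show ?thesis using that(2)[of "f 0" "Inf_path (\<lambda>i. f (Suc i))"] Inf_path assms
    by (auto simp: paths_Inf_path)
qed

text \<open>\<open>prepend\<close> forgets a vertex that it is applied to. The hypothesis on
  \<open>edge_dom e\<close> is what lets \<open>path_dom\<close> and \<open>remove_edges\<close>
  recover that vertex from the last edge.\<close>

lemma
  assumes "\<nu> \<in> paths" "edge_dom e = path_range \<nu>"
  shows plen_prepend: "plen (prepend [e] \<nu>) = eSuc (plen \<nu>)"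
    and edge_at_prepend: "enat n < plen \<nu> \<Longrightarrow> edge_at (prepend [e] \<nu>) (Suc n) = edge_at \<nu> n"
    and edge_at_prepend_0: "edge_at (prepend [e] \<nu>) 0 = e"
    and path_range_prepend: "path_range (prepend [e] \<nu>) = edge_range e"
    and path_dom_prepend: "path_dom (prepend [e] \<nu>) = path_dom \<nu>"
    and remove_edges_prepend: "remove_edges (Suc n) (prepend [e] \<nu>) = remove_edges n \<nu>"
  using assms by (cases \<nu>; auto simp: paths_Fin_path E_star_Fin_path eSuc_enat zero_enat_def)+

lemma starts_with_prepend:
  assumes "\<nu> \<in> paths" "edge_dom e = path_range \<nu>"
  shows "starts_with (a # \<alpha>) (prepend [e] \<nu>) \<longleftrightarrow> fst e = a \<and> starts_with \<alpha> \<nu>"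
proof -
  have "edge_at (prepend [e] \<nu>) (Suc i) = edge_at \<nu> i" if "enat (length \<alpha>) \<le> plen \<nu>" "i < length \<alpha>" for i
    using edge_at_prepend[OF assms] that by (meson enat_ord_simps(2) less_le_trans)
  then show ?thesis
    by (auto simp: starts_with_def plen_prepend[OF assms] edge_at_prepend_0[OF assms] less_Suc_eq_0_disj
        simp flip: eSuc_enat)
qed

lemma starts_with_Nil [simp]: "starts_with [] \<mu>"
  by (simp add: starts_with_def flip: zero_enat_def)

lemma starts_with_Vertex [simp]: "starts_with (a # \<alpha>) (Vertex v) \<longleftrightarrow> False"
  by (simp add: starts_with_def zero_enat_def)

section \<open>Removal of a labelled prefix, as a relation on all paths\<close>

lemma remove_edges_0: "\<mu> \<in> paths \<Longrightarrow> remove_edges 0 \<mu> = \<mu>"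
  by (cases \<mu>) (auto simp: paths_Fin_path E_star_Fin_path)

definition shift_rel :: "'l list \<Rightarrow> ('l, 'b) gpath rel" where
  "shift_rel \<alpha> = {(\<mu>, \<nu>). \<mu> \<in> paths \<and> starts_with \<alpha> \<mu> \<and> \<nu> = remove_edges (length \<alpha>) \<mu>}"

lemma shift_rel_Nil: "(\<mu>, \<nu>) \<in> shift_rel [] \<longleftrightarrow> \<mu> \<in> paths \<and> \<nu> = \<mu>"
  by (auto simp: shift_rel_def remove_edges_0)

text \<open>Replaces the index arithmetic of \<open>starts_with\<close> and
  \<open>remove_edges\<close> by peeling off one edge; the inductions along \<alpha> use this
  form.\<close>

lemma shift_rel_Cons: "(\<mu>, \<rho>) \<in> shift_rel (a # \<alpha>) \<longleftrightarrow>
    (\<exists>\<eta> \<nu>. (a, \<eta>) \<in> E1 \<and> \<mu> = prepend [(a, \<eta>)] \<nu> \<and> edge_dom (a, \<eta>) = path_range \<nu> \<and> (\<nu>, \<rho>) \<in> shift_rel \<alpha>)"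
proof
  assume *: "(\<mu>, \<rho>) \<in> shift_rel (a # \<alpha>)"
  then have "\<mu> \<in> paths" by (simp add: shift_rel_def)
  then show "\<exists>\<eta> \<nu>. (a, \<eta>) \<in> E1 \<and> \<mu> = prepend [(a, \<eta>)] \<nu> \<and> edge_dom (a, \<eta>) = path_range \<nu> \<and> (\<nu>, \<rho>) \<in> shift_rel \<alpha>"
  proof (cases rule: paths_cases)
    case (Vertex v)
    then show ?thesis using * by (simp add: shift_rel_def)
  next
    case (prepend e \<nu>)
    moreover have "(\<nu>, \<rho>) \<in> shift_rel \<alpha> \<and> fst e = a"
      using * prepend by (auto simp: shift_rel_def starts_with_prepend remove_edges_prepend)
    ultimately show ?thesis by (cases e) auto
  qed
next
  assume "\<exists>\<eta> \<nu>. (a, \<eta>) \<in> E1 \<and> \<mu> = prepend [(a, \<eta>)] \<nu> \<and> edge_dom (a, \<eta>) = path_range \<nu> \<and> (\<nu>, \<rho>) \<in> shift_rel \<alpha>"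
  then obtain \<eta> \<nu> where "(a, \<eta>) \<in> E1" "\<mu> = prepend [(a, \<eta>)] \<nu>" "edge_dom (a, \<eta>) = path_range \<nu>"
    "(\<nu>, \<rho>) \<in> shift_rel \<alpha>" by blast
  moreover from this have "\<nu> \<in> paths" by (simp add: shift_rel_def)
  ultimately show "(\<mu>, \<rho>) \<in> shift_rel (a # \<alpha>)"
    by (simp add: shift_rel_def prepend_mem_paths starts_with_prepend remove_edges_prepend del: edge_dom.simps)
qed

lemma shift_rel_paths: "(\<mu>, \<nu>) \<in> shift_rel \<alpha> \<Longrightarrow> \<mu> \<in> paths \<and> \<nu> \<in> paths"
proof (induction \<alpha> arbitrary: \<mu>)
  case (Cons a \<alpha>)
  then show ?case using prepend_mem_paths unfolding shift_rel_Cons by blast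
qed (simp add: shift_rel_Nil)

lemma shift_rel_append: "shift_rel (\<alpha> @ \<beta>) = shift_rel \<alpha> O shift_rel \<beta>"
proof (induction \<alpha>)
  case Nil
  then show ?case using shift_rel_paths by (auto simp: shift_rel_Nil)
next
  case (Cons a \<alpha>)
  have "(\<mu>, \<rho>) \<in> shift_rel ((a # \<alpha>) @ \<beta>) \<longleftrightarrow> (\<mu>, \<rho>) \<in> shift_rel (a # \<alpha>) O shift_rel \<beta>" for \<mu> \<rho>
    unfolding append_Cons shift_rel_Cons relcomp_unfold mem_Collect_eq prod.case Cons.IH by blast
  then show ?case by auto
qed

lemma shift_rel_single_valued: "(\<mu>, \<nu>) \<in> shift_rel \<alpha> \<Longrightarrow> (\<mu>, \<nu>') \<in> shift_rel \<alpha> \<Longrightarrow> \<nu> = \<nu>'"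
  by (simp add: shift_rel_def)

lemma shift_rel_inj: "(\<mu>, \<nu>) \<in> shift_rel \<alpha> \<Longrightarrow> (\<mu>', \<nu>) \<in> shift_rel \<alpha> \<Longrightarrow> \<mu> = \<mu>'"
proof (induction \<alpha> arbitrary: \<mu> \<mu>')
  case (Cons a \<alpha>)
  obtain \<eta> \<rho> where 1: "(a, \<eta>) \<in> E1" "\<mu> = prepend [(a, \<eta>)] \<rho>" "edge_dom (a, \<eta>) = path_range \<rho>"
    "(\<rho>, \<nu>) \<in> shift_rel \<alpha>" using Cons.prems(1) unfolding shift_rel_Cons by blast
  obtain \<eta>' \<rho>' where 2: "(a, \<eta>') \<in> E1" "\<mu>' = prepend [(a, \<eta>')] \<rho>'" "edge_dom (a, \<eta>') = path_range \<rho>'"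
    "(\<rho>', \<nu>) \<in> shift_rel \<alpha>" using Cons.prems(2) unfolding shift_rel_Cons by blast
  have "\<rho> = \<rho>'" using Cons.IH 1(4) 2(4) by blast
  moreover from this have "\<eta> = \<eta>'" using edge_dom_Int 1 2 by metis
  ultimately show ?case using 1 2 by simp
qed (simp add: shift_rel_Nil)

text \<open>The range of an edge is by definition the preimage of \<eta> under
  \<open>\<theta> a\<close>. As \<open>\<theta> a A\<close> lies in \<open>\<I> a\<close>, testing
  it on \<eta> or on the upward closure of \<eta> is the same.\<close>

lemma shift_rel_range_iff:
  assumes "(\<mu>, \<nu>) \<in> shift_rel \<alpha>"
  shows "word_action \<alpha> A \<in> path_range \<nu> \<longleftrightarrow> A \<in> path_range \<mu>"
  using assms
proof (induction \<alpha> arbitrary: \<mu> A)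
  case (Cons a \<alpha>)
  obtain \<eta> \<rho> where 1: "(a, \<eta>) \<in> E1" "\<mu> = prepend [(a, \<eta>)] \<rho>" "edge_dom (a, \<eta>) = path_range \<rho>"
    "(\<rho>, \<nu>) \<in> shift_rel \<alpha>" using Cons.prems unfolding shift_rel_Cons by blast
  have "word_action (a # \<alpha>) A \<in> path_range \<nu> \<longleftrightarrow> \<theta> a A \<in> edge_dom (a, \<eta>)"
    using Cons.IH[OF 1(4), of "\<theta> a A"] 1(3) by simp
  also have "\<dots> \<longleftrightarrow> \<theta> a A \<in> \<eta>"
    using edge_dom_Int[OF 1(1)] \<theta>_mem[of a A] 1(1) unfolding E1_iff by blast
  also have "\<dots> \<longleftrightarrow> A \<in> path_range \<mu>"
    using path_range_prepend[OF conjunct1[OF shift_rel_paths[OF 1(4)]] 1(3)] 1(2)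
    by (simp add: edge_range_def f_map_def)
  finally show ?case .
qed (simp add: shift_rel_Nil)

text \<open>A member of the first ultrafilter lies in \<open>\<I> a\<close>; the remaining letters
  carry it both into the range of the rest and into the word ideal.\<close>

lemma shift_rel_range_meets:
  assumes "(\<mu>, \<nu>) \<in> shift_rel \<alpha>" "\<alpha> \<noteq> []"
  shows "path_range \<nu> \<inter> word_ideal \<alpha> \<noteq> {}"
proof (cases \<alpha>)
  case (Cons a \<beta>)
  obtain \<eta> \<rho> where 1: "(a, \<eta>) \<in> E1" "edge_dom (a, \<eta>) = path_range \<rho>" "(\<rho>, \<nu>) \<in> shift_rel \<beta>"
    using assms unfolding Cons shift_rel_Cons by blast
  have filt: "ba_filter (\<I> a) \<eta>" using 1(1) ultrafilters_filter by (auto simp: E1_iff)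
  then obtain A where A: "A \<in> \<eta>" using ba_filter_nonempty by blast
  then have "A \<in> path_range \<rho>" using edge_dom_Int[OF 1(1)] 1(2) by blast
  then show ?thesis using shift_rel_range_iff[OF 1(3)] word_action_mem[of A a \<beta>]
      ba_filter_sub[OF filt A] Cons by blast
qed (use assms in simp)

lemma prepend_Cons: "p \<noteq> [] \<Longrightarrow> prepend (e # p) \<nu> = prepend [e] (prepend p \<nu>)"
  by (cases \<nu>) (auto simp: nth_Cons split: nat.splits intro!: ext)

lemma edges_over_nonempty: "edges_over \<zeta> (a # \<alpha>) \<noteq> [] \<and> fst (hd (edges_over \<zeta> (a # \<alpha>))) = a"
  by (cases \<alpha>) (simp_all add: Let_def)

lemma path_range_prepend_list: "p \<noteq> [] \<Longrightarrow> path_range (prepend p \<nu>) = edge_range (hd p)"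
  by (cases \<nu>) (auto simp: hd_append hd_conv_nth)

text \<open>Converse to \<open>shift_rel_range_meets\<close>. The edges are built from the last one
  backwards, following the recursion of \<open>edges_over\<close>.\<close>

lemma shift_rel_edges_over:
  assumes \<rho>: "\<rho> \<in> paths" and "\<alpha> \<in> lists L" "\<alpha> \<noteq> []" "path_range \<rho> \<inter> word_ideal \<alpha> \<noteq> {}"
  shows "(prepend (edges_over (path_range \<rho>) \<alpha>) \<rho>, \<rho>) \<in> shift_rel \<alpha>"
  using assms(2-)
proof (induction "path_range \<rho>" \<alpha> rule: edges_over.induct)
  case (2 a)
  then have a: "a \<in> L" by simp
  then have "path_range \<rho> \<inter> \<I> a \<noteq> {}" using 2 word_ideal_singleton by metis
  from edge_over_vertex[OF a path_range_mem[OF \<rho>] this] show ?case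
    unfolding shift_rel_Cons shift_rel_Nil edges_over.simps using \<rho> by blast
next
  case (3 a b \<alpha>)
  let ?p = "edges_over (path_range \<rho>) (b # \<alpha>)"
  let ?\<mu> = "prepend ?p \<rho>"
  have meets: "path_range \<rho> \<inter> word_ideal (b # \<alpha>) \<noteq> {}"
    using 3(2,4) word_ideal_Cons_subset by blast
  have \<mu>: "(?\<mu>, \<rho>) \<in> shift_rel (b # \<alpha>)"
    using 3(1)[OF _ _ meets] 3(2) by simp
  have range: "path_range ?\<mu> = f_map b (snd (hd ?p))"
    using path_range_prepend_list[of ?p \<rho>] edges_over_nonempty[of "path_range \<rho>" b \<alpha>]
    by (simp add: edge_range_def)
  \<comment> \<open>A witness for the word ideal lies below the image of some \<open>B\<close> in
    \<open>\<I> a\<close>; by \<open>shift_rel_range_iff\<close> this \<open>B\<close> belongs to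
    the range of the path built so far.\<close>
  have "path_range ?\<mu> \<inter> \<I> a \<noteq> {}"
  proof -
    obtain A B where A: "A \<in> path_range \<rho>" "B \<in> \<I> a" "A \<le> word_action (b # \<alpha>) B"
      using 3(4) by auto
    have "path_range \<rho> \<in> ultrafilters UNIV"
      using path_range_mem[OF \<rho>] A(1) by (auto simp: F0_def E0_def)
    then have "word_action (b # \<alpha>) B \<in> path_range \<rho>"
      using ba_filter_up[OF ultrafilters_filter] A by blast
    then show ?thesis using shift_rel_range_iff[OF \<mu>] A(2) by blast
  qed
  moreover have "a \<in> L" using 3(2) by simp
  ultimately have "(a, path_range ?\<mu> \<inter> \<I> a) \<in> E1 \<and> edge_dom (a, path_range ?\<mu> \<inter> \<I> a) = path_range ?\<mu>"
    using edge_over_vertex path_range_mem shift_rel_paths[OF \<mu>] by blast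
  moreover have "prepend (edges_over (path_range \<rho>) (a # b # \<alpha>)) \<rho> = prepend [(a, path_range ?\<mu> \<inter> \<I> a)] ?\<mu>"
    using prepend_Cons[of ?p] edges_over_nonempty[of "path_range \<rho>" b \<alpha>]
    unfolding range by (simp add: Let_def)
  ultimately show ?case using \<mu> unfolding shift_rel_Cons[of _ _ a] by metis
qed simp

section \<open>Invariance of the boundary under shifts\<close>

lemma boundary_subset_paths: "boundary \<subseteq> paths"
  by (auto simp: boundary_def paths_def)

text \<open>An added edge in front changes neither finiteness nor the end of a finite path, and the
  boundary condition concerns only these.\<close>

lemma boundary_prepend:
  assumes "e \<in> E1" "\<nu> \<in> paths" "edge_dom e = path_range \<nu>"
  shows "prepend [e] \<nu> \<in> boundary \<longleftrightarrow> \<nu> \<in> boundary"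
proof -
  have "prepend [e] \<nu> \<in> boundary \<longleftrightarrow> prepend [e] \<nu> \<in> E_inf \<or> path_dom (prepend [e] \<nu>) \<in> E0_sg \<and> prepend [e] \<nu> \<in> E_star"
    "\<nu> \<in> boundary \<longleftrightarrow> \<nu> \<in> E_inf \<or> path_dom \<nu> \<in> E0_sg \<and> \<nu> \<in> E_star"
    by (auto simp: boundary_def)
  moreover have "(prepend [e] \<nu> \<in> E_inf \<longleftrightarrow> \<nu> \<in> E_inf) \<and> (prepend [e] \<nu> \<in> E_star \<longleftrightarrow> \<nu> \<in> E_star)"
    using assms(2) prepend_mem_paths[OF assms] E_star_Inf_path
    by (cases \<nu>) (auto simp: paths_def E_inf_def)
  ultimately show ?thesis using path_dom_prepend[OF assms(2,3)] by simp
qed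

lemma shift_rel_boundary: "(\<mu>, \<nu>) \<in> shift_rel \<alpha> \<Longrightarrow> \<mu> \<in> boundary \<longleftrightarrow> \<nu> \<in> boundary"
proof (induction \<alpha> arbitrary: \<mu>)
  case (Cons a \<alpha>)
  then show ?case using boundary_prepend shift_rel_paths unfolding shift_rel_Cons by metis
qed (simp add: shift_rel_Nil)

section \<open>The space of finite paths\<close>

lemma topspace_E0_topology [simp]: "topspace E0_topology = E0"
  by (simp add: E0_topology_def E0_def)

lemma topspace_E1_topology [simp]: "topspace E1_topology = E1"
  by (auto simp: E1_topology_def E1_def)

lemma E_n_Suc: "p \<in> E_n (Suc n) \<longleftrightarrow> (\<exists>q. p = Fin_path q \<and> length q = Suc n \<and> p \<in> E_star)"
  by (auto simp: E_n_def E_star_Fin_path)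

lemma E_n_iff: "p \<in> E_n n \<longleftrightarrow> p \<in> E_star \<and> plen p = enat n"
proof (cases n)
  case 0
  then show ?thesis by (cases p) (auto simp: E_n_def E_star_Fin_path zero_enat_def)
next
  case (Suc m)
  then show ?thesis by (cases p) (auto simp: E_n_Suc zero_enat_def)
qed

lemma topspace_E_n_topology: "topspace (E_n_topology n) = E_n n"
proof -
  have "edge_at p i \<in> E1" if "p \<in> E_n n" "i < n" for p i
    using that nth_mem[of i] by (cases n) (fastforce simp: E_n_Suc E_star_Fin_path)+
  then show ?thesis
    by (auto simp: E_n_topology_def topspace_pullback_topology E_n_def[of 0])
qed

lemma openin_E_star_topology:
  "openin E_star_topology V \<longleftrightarrow> V \<subseteq> E_star \<and> (\<forall>n. openin (E_n_topology n) (V \<inter> E_n n))"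
proof -
  have fst_eq: "the_enat (plen p) = n" if "p \<in> E_n n" for p n
    using that by (simp add: E_n_iff)
  show ?thesis
  proof
    assume "openin E_star_topology V"
    then obtain W where W: "openin (sum_topology E_n_topology UNIV) W"
      and V: "V = (\<lambda>\<mu>. (the_enat (plen \<mu>), \<mu>)) -` W \<inter> E_star"
      unfolding E_star_topology_def openin_pullback_topology by blast
    have "V \<inter> E_n n = {p. (n, p) \<in> W}" for n
      using W V fst_eq[of _ n] E_n_iff[of _ n]
      by (auto simp: openin_sum_topology topspace_E_n_topology)
    then show "V \<subseteq> E_star \<and> (\<forall>n. openin (E_n_topology n) (V \<inter> E_n n))"
      using V W by (simp add: openin_sum_topology)
  next
    assume *: "V \<subseteq> E_star \<and> (\<forall>n. openin (E_n_topology n) (V \<inter> E_n n))"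
    let ?W = "SIGMA n:UNIV. V \<inter> E_n n"
    have "{p. (n, p) \<in> ?W} = V \<inter> E_n n" for n by auto
    then have "openin (sum_topology E_n_topology UNIV) ?W"
      using * by (auto simp: openin_sum_topology topspace_E_n_topology)
    moreover have "V = (\<lambda>\<mu>. (the_enat (plen \<mu>), \<mu>)) -` ?W \<inter> E_star"
      using * fst_eq by (auto simp: E_star_def)
    ultimately show "openin E_star_topology V"
      unfolding E_star_topology_def openin_pullback_topology by blast
  qed
qed

lemma topspace_E_star_topology [simp]: "topspace E_star_topology = E_star"
proof
  show "topspace E_star_topology \<subseteq> E_star"
    using openin_E_star_topology openin_topspace by blast
  have "E_star \<inter> E_n n = E_n n" for n by (auto simp: E_n_iff)
  then have "openin E_star_topology E_star"
    using openin_topspace[of "E_n_topology _"] by (simp add: openin_E_star_topology topspace_E_n_topology)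
  then show "E_star \<subseteq> topspace E_star_topology" by (rule openin_subset)
qed

lemma continuous_map_E_n_E_star:
  assumes "continuous_map T (E_n_topology n) f"
  shows "continuous_map T E_star_topology f"
  unfolding continuous_map_def
proof (intro conjI allI impI)
  have f: "f \<in> topspace T \<rightarrow> E_n n"
    using assms by (simp add: continuous_map_def topspace_E_n_topology)
  then show "f \<in> topspace T \<rightarrow> topspace E_star_topology" by (auto simp: E_n_iff)
  fix V assume "openin E_star_topology V"
  then have "openin T {x \<in> topspace T. f x \<in> V \<inter> E_n n}"
    using assms by (simp only: openin_E_star_topology continuous_map_def)
  moreover have "{x \<in> topspace T. f x \<in> V \<inter> E_n n} = {x \<in> topspace T. f x \<in> V}"
    using f by auto
  ultimately show "openin T {x \<in> topspace T. f x \<in> V}" by simp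
qed

text \<open>The empty word is separate because prepending no edge to a vertex would give
  \<open>Fin_path []\<close>, which is not a path.\<close>

definition path_over :: "'l list \<Rightarrow> 'b set \<Rightarrow> ('l, 'b) gpath" where
  "path_over \<alpha> \<xi> = (if \<alpha> = [] then Vertex \<xi> else prepend (edges_over \<xi> \<alpha>) (Vertex \<xi>))"

definition vertices_over :: "'l list \<Rightarrow> 'b set set" where
  "vertices_over \<alpha> = {\<xi> \<in> E0. \<xi> \<inter> word_ideal \<alpha> \<noteq> {}}"

lemma length_edges_over [simp]: "length (edges_over \<zeta> \<alpha>) = length \<alpha>"
  by (induction \<zeta> \<alpha> rule: edges_over.induct) (simp_all add: Let_def)

text \<open>Solves the backward recursion: each edge is the pullback of the end vertex along the
  letters after it. The clause that intermediate elements lie in the ideals disappears by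
  \<open>\<theta>_mem\<close>.\<close>

lemma edges_over_nth:
  assumes "\<alpha> \<in> lists L" "i < length \<alpha>"
  shows "edges_over \<zeta> \<alpha> ! i = (\<alpha> ! i, {B \<in> \<I> (\<alpha> ! i). word_action (drop (Suc i) \<alpha>) B \<in> \<zeta>})"
  using assms
proof (induction \<zeta> \<alpha> arbitrary: i rule: edges_over.induct)
  case (3 \<zeta> a b \<alpha>)
  show ?case
  proof (cases i)
    case 0
    have "hd (edges_over \<zeta> (b # \<alpha>)) = (b, {B \<in> \<I> b. word_action \<alpha> B \<in> \<zeta>})"
      using 3(1)[of 0] 3(2) edges_over_nonempty[of \<zeta> b \<alpha>] by (simp add: hd_conv_nth)
    then show ?thesis using 0 3(2) by (auto simp: Let_def f_map_def \<theta>_mem)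
  next
    case (Suc j)
    then show ?thesis using 3(1)[of j] 3(2,3) by (simp add: Let_def)
  qed
qed auto

lemma continuous_map_Vertex:
  "continuous_map (subtopology E0_topology D) (E_n_topology 0) Vertex"
proof -
  have "continuous_map (subtopology E0_topology D) E0_topology (path_dom \<circ> Vertex)"
    by (simp add: o_def continuous_map_from_subtopology flip: id_def)
  then show ?thesis
    by (auto simp: E_n_topology_def E_n_def intro!: continuous_map_pullback')
qed

lemma path_over_shift_rel:
  assumes "\<alpha> \<in> lists L" "\<xi> \<in> vertices_over \<alpha>"
  shows "(path_over \<alpha> \<xi>, Vertex \<xi>) \<in> shift_rel \<alpha>"
proof (cases "\<alpha> = []")
  case True
  then show ?thesis using assms by (simp add: path_over_def shift_rel_Nil vertices_over_def)
next
  case False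
  then show ?thesis using shift_rel_edges_over[of "Vertex \<xi>" \<alpha>] assms
    by (simp add: path_over_def vertices_over_def)
qed

lemma shift_rel_VertexD:
  assumes "(p, Vertex \<xi>) \<in> shift_rel \<alpha>"
  shows "p \<in> E_star" "plen p = enat (length \<alpha>)" "path_dom p = \<xi>" "\<xi> \<in> E0"
proof -
  show "\<xi> \<in> E0" using shift_rel_paths[OF assms] by simp
  have "p \<in> E_star \<and> plen p = enat (length \<alpha>) \<and> path_dom p = \<xi>"
    using assms
    by (cases p) (auto simp: shift_rel_def paths_Fin_path starts_with_def zero_enat_def split: if_splits)
  then show "p \<in> E_star" "plen p = enat (length \<alpha>)" "path_dom p = \<xi>" by auto
qed

lemma E_star_shift_rel:
  assumes "p \<in> E_star"
  obtains \<alpha> where "\<alpha> \<in> lists L" "(p, Vertex (path_dom p)) \<in> shift_rel \<alpha>" "path_dom p \<in> vertices_over \<alpha>"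
proof (cases p)
  case (Vertex v)
  have "v \<noteq> {}" using assms Vertex ba_filter_nonempty[OF ultrafilters_filter] by (auto simp: E0_def)
  then show ?thesis using that[of "[]"] assms Vertex by (simp add: shift_rel_Nil vertices_over_def)
next
  case (Fin_path q)
  have q: "q \<noteq> []" "q \<in> lists E1" using assms Fin_path by (auto simp: E_star_Fin_path)
  have "(p, Vertex (path_dom p)) \<in> shift_rel (map fst q)"
    using assms Fin_path by (auto simp: shift_rel_def starts_with_def paths_def)
  moreover from shift_rel_range_meets[OF this] q(1)
  have "path_dom p \<in> vertices_over (map fst q)"
    using shift_rel_VertexD(4)[OF \<open>(p, _) \<in> _\<close>] by (simp add: vertices_over_def)
  moreover have "map fst q \<in> lists L" using q(2) by (force simp: E1_def)
  ultimately show ?thesis using that by blast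
qed (use assms in simp)

lemma shift_rel_Vertex_unique:
  assumes "(p, Vertex \<xi>) \<in> shift_rel \<alpha>" "(p, Vertex \<zeta>) \<in> shift_rel \<beta>"
  shows "\<alpha> = \<beta>"
proof -
  have "length \<alpha> = length \<beta>"
    using shift_rel_VertexD(2)[OF assms(1)] shift_rel_VertexD(2)[OF assms(2)] by simp
  then show ?thesis using assms by (auto simp: shift_rel_def starts_with_def intro: nth_equalityI)
qed

text \<open>In coordinate \<open>i\<close> the preimage of the basic set of \<open>A\<close> is that
  of \<open>word_action (drop (Suc i) \<alpha>) A\<close>, by \<open>edges_over_nth\<close>.\<close>

lemma continuous_map_path_over:
  assumes \<alpha>: "\<alpha> \<in> lists L"
  shows "continuous_map (subtopology E0_topology (vertices_over \<alpha>)) E_star_topology (path_over \<alpha>)"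
proof (rule continuous_map_E_n_E_star)
  let ?T = "subtopology E0_topology (vertices_over \<alpha>)"
  let ?n = "length \<alpha>"
  have top: "topspace ?T = vertices_over \<alpha>" by (auto simp: vertices_over_def)
  show "continuous_map ?T (E_n_topology ?n) (path_over \<alpha>)"
  proof (cases "\<alpha> = []")
    case True
    then have "path_over \<alpha> = Vertex" by (simp add: path_over_def fun_eq_iff)
    then show ?thesis using continuous_map_Vertex True by simp
  next
    case False
    have in_E_n: "path_over \<alpha> \<xi> \<in> E_n ?n" if "\<xi> \<in> vertices_over \<alpha>" for \<xi>
      using shift_rel_VertexD[OF path_over_shift_rel[OF \<alpha> that]] by (simp add: E_n_iff)
    have edge: "edges_over \<xi> \<alpha> ! i \<in> E1" if "\<xi> \<in> vertices_over \<alpha>" "i < ?n" for \<xi> i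
      using in_E_n[OF that(1)] that(2) nth_mem[of i "edges_over \<xi> \<alpha>"]
      by (auto simp: E_n_iff path_over_def E_star_Fin_path False simp del: nth_mem)
    have comp: "continuous_map ?T E1_topology (\<lambda>\<xi>. edges_over \<xi> \<alpha> ! i)" if i: "i < ?n" for i
    proof -
      let ?g = "\<lambda>\<xi>. {B \<in> \<I> (\<alpha> ! i). word_action (drop (Suc i) \<alpha>) B \<in> \<xi>}"
      have eq: "edges_over \<xi> \<alpha> ! i = (\<alpha> ! i, ?g \<xi>)" for \<xi>
        using edges_over_nth[OF \<alpha> i] .
      have ai: "\<alpha> ! i \<in> L" using \<alpha> i by auto
      have g: "?g \<xi> \<in> ultrafilters (\<I> (\<alpha> ! i))" if "\<xi> \<in> vertices_over \<alpha>" for \<xi>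
        using edge[OF that i] unfolding eq E1_iff by blast
      have "continuous_map ?T (ultrafilter_topology (\<I> (\<alpha> ! i))) ?g"
        unfolding ultrafilter_topology_def
      proof (rule continuous_on_generated_topo)
        show "?g ` topspace ?T \<subseteq> \<Union>{{F \<in> ultrafilters (\<I> (\<alpha> ! i)). A \<in> F} |A. A \<in> \<I> (\<alpha> ! i)}"
          using g topspace_ultrafilter_topology[of "\<I> (\<alpha> ! i)"]
          unfolding ultrafilter_topology_def topology_generated_by_topspace top by blast
        fix V assume "V \<in> {{F \<in> ultrafilters (\<I> (\<alpha> ! i)). A \<in> F} |A. A \<in> \<I> (\<alpha> ! i)}"
        then obtain A where A: "A \<in> \<I> (\<alpha> ! i)" "V = {F \<in> ultrafilters (\<I> (\<alpha> ! i)). A \<in> F}" by blast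
        have "?g -` V \<inter> topspace ?T = {\<xi> \<in> E0. word_action (drop (Suc i) \<alpha>) A \<in> \<xi>} \<inter> vertices_over \<alpha>"
          using g A unfolding top by (auto simp: vertices_over_def)
        then show "openin ?T (?g -` V \<inter> topspace ?T)"
          using openin_ultrafilter_basic[of "word_action (drop (Suc i) \<alpha>) A" UNIV]
          by (auto simp: openin_subtopology E0_topology_def E0_def)
      qed
      then have "continuous_map ?T E1_topology ((\<lambda>\<eta>. (\<alpha> ! i, \<eta>)) \<circ> ?g)"
        unfolding E1_topology_def
        by (rule continuous_map_compose) (rule continuous_map_component_injection[OF ai])
      then show ?thesis by (simp add: eq o_def)
    qed
    have "continuous_map ?T (product_topology (\<lambda>_. E1_topology) {..<?n})
        ((\<lambda>\<mu>. restrict (edge_at \<mu>) {..<?n}) \<circ> path_over \<alpha>)"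
      unfolding continuous_map_componentwise using comp False by (auto simp: path_over_def)
    then show ?thesis
      using False in_E_n top unfolding E_n_topology_def
      by (auto intro!: continuous_map_pullback')
  qed
qed

text \<open>The set C(\<alpha>, A) for arbitrary \<open>A\<close>; membership of \<open>A\<close> in
  the word ideal is added where compactness or openness is proved.\<close>

definition cylinder :: "'l list \<Rightarrow> 'b \<Rightarrow> ('l, 'b) gpath set" where
  "cylinder \<alpha> A = {p. \<exists>\<xi>. (p, Vertex \<xi>) \<in> shift_rel \<alpha> \<and> A \<in> \<xi>}"

lemma cylinder_eq_image:
  assumes "\<alpha> \<in> lists L" "A \<in> word_ideal \<alpha>"
  shows "cylinder \<alpha> A = path_over \<alpha> ` {\<xi> \<in> E0. A \<in> \<xi>}"
proof -
  have over: "\<xi> \<in> vertices_over \<alpha>" if "\<xi> \<in> E0" "A \<in> \<xi>" for \<xi>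
    using that assms by (auto simp: vertices_over_def)
  show ?thesis
  proof (intro equalityI subsetI)
    fix p assume "p \<in> cylinder \<alpha> A"
    then obtain \<xi> where \<xi>: "(p, Vertex \<xi>) \<in> shift_rel \<alpha>" "A \<in> \<xi>" by (auto simp: cylinder_def)
    have "\<xi> \<in> E0" using shift_rel_VertexD(4)[OF \<xi>(1)] .
    moreover have "p = path_over \<alpha> \<xi>"
      using shift_rel_inj[OF \<xi>(1) path_over_shift_rel[OF assms(1) over]] calculation \<xi>(2) by blast
    ultimately show "p \<in> path_over \<alpha> ` {\<xi> \<in> E0. A \<in> \<xi>}" using \<xi>(2) by blast
  next
    fix p assume "p \<in> path_over \<alpha> ` {\<xi> \<in> E0. A \<in> \<xi>}"
    then obtain \<xi> where "p = path_over \<alpha> \<xi>" "\<xi> \<in> E0" "A \<in> \<xi>" by blast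
    then show "p \<in> cylinder \<alpha> A"
      using path_over_shift_rel[OF assms(1) over] unfolding cylinder_def by blast
  qed
qed

text \<open>Since \<open>A\<close> is in the word ideal, its whole compact basic set lies in the
  domain \<open>vertices_over \<alpha>\<close> of the continuous parametrisation.\<close>

lemma compactin_cylinder:
  assumes "\<alpha> \<in> lists L" "A \<in> word_ideal \<alpha>"
  shows "compactin E_star_topology (cylinder \<alpha> A)"
proof -
  have "compactin (subtopology E0_topology (vertices_over \<alpha>)) {\<xi> \<in> E0. A \<in> \<xi>}"
    using compactin_ultrafilter_basic[of A] assms
    by (auto simp: compactin_subtopology E0_topology_def E0_def vertices_over_def)
  then show ?thesis
    unfolding cylinder_eq_image[OF assms]
    by (rule image_compactin[OF _ continuous_map_path_over[OF assms(1)]])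
qed

text \<open>The preimage of \<open>V\<close> under \<open>path_over \<alpha>\<close> contains a
  basic neighbourhood, given by \<open>B\<close>, of the end vertex. Meeting \<open>B\<close> with
  some \<open>C\<close> of the word ideal makes the resulting cylinder compact.\<close>

lemma cylinder_neighbourhood:
  assumes V: "openin E_star_topology V" and p: "p \<in> V"
  obtains \<alpha> A where "\<alpha> \<in> lists L" "A \<in> word_ideal \<alpha>" "p \<in> cylinder \<alpha> A" "cylinder \<alpha> A \<subseteq> V"
proof -
  have pE: "p \<in> E_star" using openin_subset[OF V] p by auto
  obtain \<alpha> where \<alpha>: "\<alpha> \<in> lists L" "(p, Vertex (path_dom p)) \<in> shift_rel \<alpha>" "path_dom p \<in> vertices_over \<alpha>"
    using E_star_shift_rel[OF pE] .
  let ?\<xi> = "path_dom p"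
  have pp: "p = path_over \<alpha> ?\<xi>"
    using shift_rel_inj[OF \<alpha>(2) path_over_shift_rel[OF \<alpha>(1,3)]] .
  have "openin (subtopology E0_topology (vertices_over \<alpha>))
      {\<xi> \<in> topspace (subtopology E0_topology (vertices_over \<alpha>)). path_over \<alpha> \<xi> \<in> V}"
    by (rule openin_continuous_map_preimage[OF continuous_map_path_over[OF \<alpha>(1)] V])
  then obtain W where W: "openin E0_topology W"
    "{\<xi> \<in> topspace (subtopology E0_topology (vertices_over \<alpha>)). path_over \<alpha> \<xi> \<in> V} = W \<inter> vertices_over \<alpha>"
    unfolding openin_subtopology by blast
  have W2: "\<xi> \<in> W \<longleftrightarrow> path_over \<alpha> \<xi> \<in> V" if "\<xi> \<in> vertices_over \<alpha>" for \<xi>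
  proof -
    have "\<xi> \<in> topspace (subtopology E0_topology (vertices_over \<alpha>))"
      using that by (simp add: vertices_over_def)
    then show ?thesis using W(2) that by blast
  qed
  have "?\<xi> \<in> W" using W2[OF \<alpha>(3)] pp p by metis
  then obtain B where B: "B \<in> ?\<xi>" "{\<xi> \<in> ultrafilters UNIV. B \<in> \<xi>} \<subseteq> W"
    by (rule ultrafilter_neighbourhood[OF W(1)[unfolded E0_topology_def]])
  obtain C where C: "C \<in> ?\<xi>" "C \<in> word_ideal \<alpha>" using \<alpha>(3) by (auto simp: vertices_over_def)
  have filt: "ba_filter UNIV \<xi>" if "\<xi> \<in> E0" for \<xi>
    using ultrafilters_filter that by (simp add: E0_def)
  have \<xi>0: "?\<xi> \<in> E0" using \<alpha>(3) by (simp add: vertices_over_def)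
  have A: "inf B C \<in> ?\<xi>" "inf B C \<in> word_ideal \<alpha>"
    using ba_filter_inf[OF filt[OF \<xi>0] B(1) C(1)] word_ideal_down[OF C(2)] by simp_all
  show ?thesis
  proof (rule that[OF \<alpha>(1) A(2)])
    show "p \<in> cylinder \<alpha> (inf B C)" using \<alpha>(2) A(1) by (auto simp: cylinder_def)
    show "cylinder \<alpha> (inf B C) \<subseteq> V"
    proof
      fix q assume "q \<in> cylinder \<alpha> (inf B C)"
      then obtain \<xi> where \<xi>: "q = path_over \<alpha> \<xi>" "\<xi> \<in> E0" "inf B C \<in> \<xi>"
        unfolding cylinder_eq_image[OF \<alpha>(1) A(2)] by blast
      have "B \<in> \<xi>" using ba_filter_up[OF filt[OF \<xi>(2)] \<xi>(3)] by simp
      then have "\<xi> \<in> W" using B(2) \<xi>(2) by (auto simp: E0_def)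
      moreover have "\<xi> \<in> vertices_over \<alpha>" using \<xi>(2,3) A(2) by (auto simp: vertices_over_def)
      ultimately show "q \<in> V" using W2 \<xi>(1) by blast
    qed
  qed
qed

lemma word_ideal_subset_last:
  "\<alpha> \<in> lists L \<Longrightarrow> \<alpha> \<noteq> [] \<Longrightarrow> word_ideal \<alpha> \<subseteq> \<I> (last \<alpha>)"
proof (induction \<alpha>)
  case (Cons a \<alpha>)
  show ?case
  proof (cases "\<alpha> = []")
    case True
    then show ?thesis using Cons.prems word_ideal_singleton[of a] by simp
  next
    case False
    then show ?thesis using word_ideal_Cons_subset[OF Cons.prems(1)] Cons by (simp add: subset_trans)
  qed
qed simp

text \<open>For non-empty \<alpha> this is a product of open sets: every label is prescribed, and
  \<open>A\<close> is tested on the last edge, whose index is \<open>n - 1\<close>. The test may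
  move from the end vertex to that edge because \<open>A\<close> lies in
  \<open>\<I> (last \<alpha>)\<close>.\<close>

lemma openin_cylinder:
  assumes \<alpha>: "\<alpha> \<in> lists L" and A: "A \<in> word_ideal \<alpha>"
  shows "openin E_star_topology (cylinder \<alpha> A)"
proof -
  have sub: "cylinder \<alpha> A \<subseteq> E_n (length \<alpha>)"
    using shift_rel_VertexD by (auto simp: cylinder_def E_n_iff)
  have "openin (E_n_topology (length \<alpha>)) (cylinder \<alpha> A)"
  proof (cases "\<alpha> = []")
    case True
    have "cylinder \<alpha> A = path_dom -` {\<xi> \<in> E0. A \<in> \<xi>} \<inter> E_n 0"
    proof (intro equalityI subsetI)
      fix p assume "p \<in> cylinder \<alpha> A"
      then show "p \<in> path_dom -` {\<xi> \<in> E0. A \<in> \<xi>} \<inter> E_n 0"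
        by (auto simp: cylinder_def True shift_rel_Nil E_n_def)
    next
      fix p assume "p \<in> path_dom -` {\<xi> \<in> E0. A \<in> \<xi>} \<inter> E_n 0"
      then obtain \<xi> where "p = Vertex \<xi>" "\<xi> \<in> E0" "A \<in> \<xi>" by (auto simp: E_n_def)
      then show "p \<in> cylinder \<alpha> A" by (auto simp: cylinder_def True shift_rel_Nil)
    qed
    moreover have "openin E0_topology {\<xi> \<in> E0. A \<in> \<xi>}"
      using openin_ultrafilter_basic[of A UNIV] by (simp add: E0_topology_def E0_def)
    ultimately show ?thesis
      unfolding E_n_topology_def True openin_pullback_topology list.size(3) simp_thms if_True by blast
  next
    case False
    define n where "n = length \<alpha>"
    define W where "W i = {(a, \<eta>) \<in> E1. a = \<alpha> ! i \<and> (i = n - 1 \<longrightarrow> A \<in> \<eta>)}" for i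
    have n: "n > 0" "\<alpha> ! (n - 1) = last \<alpha>" using False by (simp_all add: n_def last_conv_nth)
    have AI: "A \<in> \<I> (last \<alpha>)" using word_ideal_subset_last[OF \<alpha> False] A by blast
    have W_open: "openin E1_topology (W i)" if "i < n" for i
      unfolding E1_topology_def openin_sum_topology
    proof (intro conjI ballI)
      show "W i \<subseteq> Sigma L (topspace \<circ> (\<lambda>a. ultrafilter_topology (\<I> a)))"
        by (auto simp: W_def E1_def)
      fix a assume a: "a \<in> L"
      show "openin (ultrafilter_topology (\<I> a)) {\<eta>. (a, \<eta>) \<in> W i}"
      proof (cases "a = \<alpha> ! i")
        case True
        show ?thesis
        proof (cases "i = n - 1")
          case True
          then have "{\<eta>. (a, \<eta>) \<in> W i} = {\<eta> \<in> ultrafilters (\<I> a). A \<in> \<eta>}"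
            using \<open>a = \<alpha> ! i\<close> a by (auto simp: W_def E1_def)
          then show ?thesis using openin_ultrafilter_basic[of A "\<I> a"] AI \<open>a = \<alpha> ! i\<close> n True by simp
        next
          case False
          then have "{\<eta>. (a, \<eta>) \<in> W i} = topspace (ultrafilter_topology (\<I> a))"
            using \<open>a = \<alpha> ! i\<close> a by (auto simp: W_def E1_def)
          then show ?thesis by (simp only: openin_topspace)
        qed
      next
        case False
        then have "{\<eta>. (a, \<eta>) \<in> W i} = {}" by (auto simp: W_def)
        then show ?thesis by simp
      qed
    qed
    then have PiE: "openin (product_topology (\<lambda>_. E1_topology) {..<n}) (PiE {..<n} W)"
      by (auto simp: openin_PiE)
    have "cylinder \<alpha> A = (\<lambda>\<mu>. restrict (edge_at \<mu>) {..<n}) -` PiE {..<n} W \<inter> E_n n"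
    proof (intro equalityI subsetI IntI)
      fix p assume p: "p \<in> cylinder \<alpha> A"
      then show pn: "p \<in> E_n n" using sub n_def by blast
      obtain \<xi> where \<xi>: "(p, Vertex \<xi>) \<in> shift_rel \<alpha>" "A \<in> \<xi>" using p by (auto simp: cylinder_def)
      obtain q where q: "p = Fin_path q" "length q = n" using pn n by (cases n) (auto simp: E_n_Suc)
      have qE: "q \<in> lists E1" using pn q by (simp add: E_n_iff E_star_Fin_path)
      have lab: "fst (q ! i) = \<alpha> ! i" if "i < n" for i
        using \<xi>(1) q that by (simp add: shift_rel_def starts_with_def n_def)
      have "edge_dom (last q) = \<xi>" using shift_rel_VertexD(3)[OF \<xi>(1)] q by simp
      moreover have lastq: "last q = q ! (n - 1)" using n(1) q(2) by (cases q) (auto simp: last_conv_nth)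
      moreover have "q ! (n - 1) = (last \<alpha>, snd (q ! (n - 1)))"
        using lab[of "n - 1"] n by (simp add: prod_eq_iff)
      moreover have "q ! (n - 1) \<in> E1" using qE q(2) n(1) by auto
      ultimately have "A \<in> snd (q ! (n - 1))"
        using edge_dom_Int[of "last \<alpha>" "snd (q ! (n - 1))"] AI \<xi>(2) by auto
      moreover have "(\<alpha> ! i, snd (q ! i)) \<in> E1" if "i < n" for i
      proof -
        have "q ! i \<in> E1" using qE q(2) that by auto
        then show ?thesis unfolding lab[OF that, symmetric] by simp
      qed
      ultimately have "q ! i \<in> W i" if "i < n" for i
        using lab that unfolding W_def by (simp add: case_prod_beta)
      then show "p \<in> (\<lambda>\<mu>. restrict (edge_at \<mu>) {..<n}) -` PiE {..<n} W"
        using q by auto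
    next
      fix p assume p: "p \<in> (\<lambda>\<mu>. restrict (edge_at \<mu>) {..<n}) -` PiE {..<n} W \<inter> E_n n"
      obtain q where q: "p = Fin_path q" "length q = n" using p n by (cases n) (auto simp: E_n_Suc)
      have W: "q ! i \<in> W i" if "i < n" for i using p q that by (auto simp: PiE_iff)
      have "fst (q ! i) = \<alpha> ! i" if "i < n" for i
        using W[OF that] by (auto simp: W_def)
      then have "(p, Vertex (edge_dom (last q))) \<in> shift_rel \<alpha>"
        using p q by (auto simp: shift_rel_def starts_with_def paths_def E_n_iff n_def)
      moreover have "last q = q ! (n - 1)" using n(1) q(2) by (cases q) (auto simp: last_conv_nth)
      then have "A \<in> edge_dom (last q)" using W[of "n - 1"] n(1) by (auto simp: W_def)
      ultimately show "p \<in> cylinder \<alpha> A" by (auto simp: cylinder_def)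
    qed
    moreover have "n \<noteq> 0" using n(1) by simp
    ultimately show ?thesis
      using PiE unfolding E_n_topology_def n_def[symmetric] by (auto simp: openin_pullback_topology)
  qed
  moreover have "cylinder \<alpha> A \<inter> E_n n = (if n = length \<alpha> then cylinder \<alpha> A else {})" for n
    using sub by (auto simp: E_n_iff)
  moreover have "cylinder \<alpha> A \<subseteq> E_star" using sub by (auto simp: E_n_iff)
  ultimately show ?thesis by (simp add: openin_E_star_topology)
qed

text \<open>Different label sequences have disjoint cylinders. For equal labels the end vertices
  differ, and by maximality neither contains the other; an element \<open>C\<close> in only one of
  them separates the paths through \<open>inf A C\<close> and \<open>B - C\<close>.\<close>

lemma Hausdorff_E_star: "Hausdorff_space E_star_topology"
  unfolding Hausdorff_space_def
proof (intro allI impI)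
  fix p q assume "p \<in> topspace E_star_topology \<and> q \<in> topspace E_star_topology \<and> p \<noteq> q"
  then have pq: "p \<in> E_star" "q \<in> E_star" "p \<noteq> q" by auto
  obtain \<alpha> where \<alpha>: "\<alpha> \<in> lists L" "(p, Vertex (path_dom p)) \<in> shift_rel \<alpha>" "path_dom p \<in> vertices_over \<alpha>"
    using E_star_shift_rel[OF pq(1)] .
  obtain \<beta> where \<beta>: "\<beta> \<in> lists L" "(q, Vertex (path_dom q)) \<in> shift_rel \<beta>" "path_dom q \<in> vertices_over \<beta>"
    using E_star_shift_rel[OF pq(2)] .
  obtain A where A: "A \<in> path_dom p" "A \<in> word_ideal \<alpha>" using \<alpha>(3) by (auto simp: vertices_over_def)
  obtain B where B: "B \<in> path_dom q" "B \<in> word_ideal \<beta>" using \<beta>(3) by (auto simp: vertices_over_def)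
  have sep: "\<exists>V W. openin E_star_topology V \<and> openin E_star_topology W \<and> p \<in> V \<and> q \<in> W \<and> disjnt V W"
    if "A' \<in> path_dom p" "A' \<in> word_ideal \<alpha>" "B' \<in> path_dom q" "B' \<in> word_ideal \<beta>"
      "disjnt (cylinder \<alpha> A') (cylinder \<beta> B')" for A' B'
  proof (intro exI conjI)
    show "openin E_star_topology (cylinder \<alpha> A')" "openin E_star_topology (cylinder \<beta> B')"
      using openin_cylinder \<alpha>(1) \<beta>(1) that by auto
    show "p \<in> cylinder \<alpha> A'" "q \<in> cylinder \<beta> B'" using \<alpha>(2) \<beta>(2) that by (auto simp: cylinder_def)
  qed (rule that(5))
  show "\<exists>V W. openin E_star_topology V \<and> openin E_star_topology W \<and> p \<in> V \<and> q \<in> W \<and> disjnt V W"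
  proof (cases "\<alpha> = \<beta>")
    case False
    then have "disjnt (cylinder \<alpha> A) (cylinder \<beta> B)"
      using shift_rel_Vertex_unique unfolding disjnt_def cylinder_def by blast
    then show ?thesis using sep A B by blast
  next
    case True
    have uf: "path_dom p \<in> ultrafilters UNIV" "path_dom q \<in> ultrafilters UNIV"
      using \<alpha>(3) \<beta>(3) by (auto simp: vertices_over_def E0_def)
    have "path_dom p \<noteq> path_dom q" using shift_rel_inj \<alpha>(2) \<beta>(2) pq(3) True by metis
    then have "\<not> path_dom p \<subseteq> path_dom q"
      using uf unfolding ultrafilters_def by auto
    then obtain C where C: "C \<in> path_dom p" "C \<notin> path_dom q" by blast
    have "inf B C \<notin> path_dom q"
      using C(2) ba_filter_up[OF ultrafilters_filter[OF uf(2)], of "inf B C" C] by auto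
    then have BC: "B - C \<in> path_dom q" using uf(2) B(1) by (auto simp: ultrafilters_iff[OF ba_ideal_UNIV])
    have AC: "inf A C \<in> path_dom p" using ba_filter_inf[OF ultrafilters_filter[OF uf(1)] A(1) C(1)] .
    have "disjnt (cylinder \<alpha> (inf A C)) (cylinder \<beta> (B - C))"
      unfolding disjnt_iff
    proof (intro allI notI, elim conjE)
      fix r assume r: "r \<in> cylinder \<alpha> (inf A C)" "r \<in> cylinder \<beta> (B - C)"
      then have "inf A C \<in> path_dom r" "B - C \<in> path_dom r" "path_dom r \<in> E0"
        using shift_rel_VertexD unfolding cylinder_def by blast+
      then have "inf (B - C) (inf A C) \<in> path_dom r" "ba_filter UNIV (path_dom r)"
        using ba_filter_inf ultrafilters_filter unfolding E0_def by blast+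
      moreover have "inf (B - C) (inf A C) = bot"
        using inf_diff_self[of B C] by (metis bot_unique inf.assoc inf.commute inf_le1)
      ultimately show False using ba_filter_bot by metis
    qed
    moreover have "inf A C \<in> word_ideal \<alpha>" "B - C \<in> word_ideal \<beta>"
      using word_ideal_down[OF A(2)] word_ideal_down[OF B(2)] diff_le by auto
    ultimately show ?thesis using sep AC BC by blast
  qed
qed

section \<open>The boundary path space\<close>

text \<open>Counts r(\<mu>) as the segment of length 0, so that \<open>Z\<close> needs a single
  quantifier over lengths.\<close>

definition initial_segment :: "nat \<Rightarrow> ('l, 'b) gpath \<Rightarrow> ('l, 'b) gpath" where
  "initial_segment n \<mu> = (if n = 0 then Vertex (path_range \<mu>) else initial_path n \<mu>)"

lemma Z_eq: "Z S = {\<mu> \<in> boundary. \<exists>n. enat n \<le> plen \<mu> \<and> initial_segment n \<mu> \<in> S}"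
proof -
  have "(Vertex (path_range \<mu>) \<in> S \<or> (\<exists>i. 1 \<le> i \<and> enat i \<le> plen \<mu> \<and> initial_path i \<mu> \<in> S)) \<longleftrightarrow>
      (\<exists>n. enat n \<le> plen \<mu> \<and> initial_segment n \<mu> \<in> S)" (is "?l \<longleftrightarrow> ?r") for \<mu>
  proof
    assume ?l
    then show ?r
    proof (elim disjE exE conjE)
      assume "Vertex (path_range \<mu>) \<in> S"
      then show ?r by (intro exI[of _ 0]) (simp add: initial_segment_def flip: zero_enat_def)
    next
      fix i assume "1 \<le> i" "enat i \<le> plen \<mu>" "initial_path i \<mu> \<in> S"
      then show ?r by (intro exI[of _ i]) (simp add: initial_segment_def)
    qed
  next
    assume ?r
    then obtain n where "enat n \<le> plen \<mu>" "initial_segment n \<mu> \<in> S" by blast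
    then show ?l by (cases "n = 0") (auto simp: initial_segment_def)
  qed
  then show ?thesis unfolding Z_def by blast
qed

lemma initial_segment_prepend:
  assumes "\<nu> \<in> paths" "edge_dom e = path_range \<nu>" "enat n \<le> plen \<nu>"
  shows "initial_segment (Suc n) (prepend [e] \<nu>) = prepend [e] (initial_segment n \<nu>)"
proof -
  have "map (edge_at (prepend [e] \<nu>)) [0..<Suc n] = e # map (edge_at \<nu>) [0..<n]"
  proof (rule nth_equalityI)
    fix i assume "i < length (map (edge_at (prepend [e] \<nu>)) [0..<Suc n])"
    then have i: "i < Suc n" by simp
    show "map (edge_at (prepend [e] \<nu>)) [0..<Suc n] ! i = (e # map (edge_at \<nu>) [0..<n]) ! i"
    proof (cases i)
      case 0
      then show ?thesis using edge_at_prepend_0[OF assms(1,2)] by (simp del: upt_Suc)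
    next
      case (Suc j)
      then have "enat j < plen \<nu>" using i assms(3) by (meson enat_ord_simps(2) less_le_trans Suc_less_SucD)
      then show ?thesis using Suc i edge_at_prepend[OF assms(1,2)] by (simp del: upt_Suc)
    qed
  qed simp
  then show ?thesis by (simp add: initial_segment_def initial_path_def del: upt_Suc)
qed

lemma path_range_initial_segment:
  assumes "\<mu> \<in> paths" "enat n \<le> plen \<mu>"
  shows "path_range (initial_segment n \<mu>) = path_range \<mu>"
proof (cases n)
  case (Suc m)
  have "path_range (initial_segment n \<mu>) = edge_range (edge_at \<mu> 0)"
    using Suc by (simp add: initial_segment_def initial_path_def hd_map del: upt_Suc)
  also have "\<dots> = path_range \<mu>"
    using assms Suc by (cases \<mu>) (auto simp: zero_enat_def hd_conv_nth paths_Fin_path E_star_Fin_path)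
  finally show ?thesis .
qed (simp add: initial_segment_def)

lemma shift_rel_plen: "(\<mu>, \<rho>) \<in> shift_rel \<alpha> \<Longrightarrow> enat (length \<alpha>) \<le> plen \<mu>"
  by (simp add: shift_rel_def starts_with_def)

text \<open>The prefix ends where the remainder begins. For the empty word that point may be
  \<open>{}\<close>, which is no vertex; hence the second hypothesis.\<close>

lemma shift_rel_initial_segment:
  assumes "(\<mu>, \<rho>) \<in> shift_rel \<alpha>" "path_range \<rho> \<in> E0"
  shows "(initial_segment (length \<alpha>) \<mu>, Vertex (path_range \<rho>)) \<in> shift_rel \<alpha>"
  using assms(1)
proof (induction \<alpha> arbitrary: \<mu>)
  case Nil
  then show ?case using assms(2) by (simp add: shift_rel_Nil initial_segment_def)
next
  case (Cons a \<alpha>)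
  obtain \<eta> \<nu> where \<nu>: "(a, \<eta>) \<in> E1" "\<mu> = prepend [(a, \<eta>)] \<nu>" "edge_dom (a, \<eta>) = path_range \<nu>"
    "(\<nu>, \<rho>) \<in> shift_rel \<alpha>" using Cons.prems unfolding shift_rel_Cons by blast
  have \<nu>p: "\<nu> \<in> paths" "enat (length \<alpha>) \<le> plen \<nu>" using shift_rel_paths shift_rel_plen \<nu>(4) by auto
  show ?case
    unfolding shift_rel_Cons \<nu>(2) length_Cons initial_segment_prepend[OF \<nu>p(1) \<nu>(3) \<nu>p(2)]
    using Cons.IH[OF \<nu>(4)] \<nu>(1,3) path_range_initial_segment[OF \<nu>p] by metis
qed

lemma initial_segment_shift_rel:
  assumes \<mu>: "\<mu> \<in> paths" "enat n \<le> plen \<mu>" and seg: "(initial_segment n \<mu>, Vertex \<xi>) \<in> shift_rel \<alpha>"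
  obtains \<rho> where "n = length \<alpha>" "(\<mu>, \<rho>) \<in> shift_rel \<alpha>" "path_range \<rho> = \<xi>"
proof -
  have "plen (initial_segment n \<mu>) = enat n"
    by (simp add: initial_segment_def initial_path_def zero_enat_def)
  then have n: "n = length \<alpha>" using shift_rel_VertexD(2)[OF seg] by simp
  have "starts_with \<alpha> \<mu>"
    using seg \<mu>(2) n by (auto simp: shift_rel_def starts_with_def initial_segment_def initial_path_def
        split: if_splits)
  then obtain \<rho> where \<rho>: "(\<mu>, \<rho>) \<in> shift_rel \<alpha>" using \<mu>(1) by (simp add: shift_rel_def)
  have "path_range \<rho> \<in> E0"
  proof (cases "\<alpha> = []")
    case True
    then show ?thesis using \<rho> seg n shift_rel_VertexD(1)[OF seg]
      by (simp add: shift_rel_Nil initial_segment_def)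
  next
    case False
    then show ?thesis
      using shift_rel_range_meets[OF \<rho>] path_range_mem[of \<rho>] shift_rel_paths[OF \<rho>] by (auto simp: F0_def)
  qed
  then have "path_range \<rho> = \<xi>"
    using shift_rel_single_valued[OF shift_rel_initial_segment[OF \<rho>]] seg n by blast
  then show ?thesis using that n \<rho> by blast
qed

definition boundary_cylinder :: "'l list \<Rightarrow> 'b \<Rightarrow> ('l, 'b) gpath set" where
  "boundary_cylinder \<alpha> A = {\<mu> \<in> boundary. \<exists>\<rho>. (\<mu>, \<rho>) \<in> shift_rel \<alpha> \<and> A \<in> path_range \<rho>}"

lemma path_range_nonempty: "\<rho> \<in> paths \<Longrightarrow> A \<in> path_range \<rho> \<Longrightarrow> path_range \<rho> \<in> E0"
  using path_range_mem[of \<rho>] by (auto simp: F0_def)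

lemma initial_segment_cylinder_iff:
  assumes "\<mu> \<in> boundary" "enat n \<le> plen \<mu>"
  shows "initial_segment n \<mu> \<in> cylinder \<alpha> A \<longleftrightarrow> n = length \<alpha> \<and> \<mu> \<in> boundary_cylinder \<alpha> A"
proof
  have \<mu>: "\<mu> \<in> paths" using assms boundary_subset_paths by blast
  assume "initial_segment n \<mu> \<in> cylinder \<alpha> A"
  then obtain \<xi> where \<xi>: "(initial_segment n \<mu>, Vertex \<xi>) \<in> shift_rel \<alpha>" "A \<in> \<xi>"
    by (auto simp: cylinder_def)
  obtain \<rho> where "n = length \<alpha>" "(\<mu>, \<rho>) \<in> shift_rel \<alpha>" "path_range \<rho> = \<xi>"
    using initial_segment_shift_rel[OF \<mu> assms(2) \<xi>(1)] .
  then show "n = length \<alpha> \<and> \<mu> \<in> boundary_cylinder \<alpha> A"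
    using assms(1) \<xi>(2) by (auto simp: boundary_cylinder_def)
next
  assume *: "n = length \<alpha> \<and> \<mu> \<in> boundary_cylinder \<alpha> A"
  then obtain \<rho> where \<rho>: "(\<mu>, \<rho>) \<in> shift_rel \<alpha>" "A \<in> path_range \<rho>" by (auto simp: boundary_cylinder_def)
  have "path_range \<rho> \<in> E0" using path_range_nonempty \<rho>(2) shift_rel_paths[OF \<rho>(1)] by blast
  from shift_rel_initial_segment[OF \<rho>(1) this] show "initial_segment n \<mu> \<in> cylinder \<alpha> A"
    using * \<rho>(2) by (auto simp: cylinder_def)
qed

lemma Z_cylinder: "Z (cylinder \<alpha> A) = boundary_cylinder \<alpha> A"
proof (intro equalityI subsetI)
  fix \<mu> assume "\<mu> \<in> Z (cylinder \<alpha> A)"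
  then show "\<mu> \<in> boundary_cylinder \<alpha> A" using initial_segment_cylinder_iff by (auto simp: Z_eq)
next
  fix \<mu> assume \<mu>: "\<mu> \<in> boundary_cylinder \<alpha> A"
  then have "\<mu> \<in> boundary" "enat (length \<alpha>) \<le> plen \<mu>"
    using shift_rel_plen by (auto simp: boundary_cylinder_def)
  then show "\<mu> \<in> Z (cylinder \<alpha> A)" using initial_segment_cylinder_iff \<mu> by (auto simp: Z_eq)
qed

lemma Z_Union: "Z (\<Union>\<S>) = (\<Union>S\<in>\<S>. Z S)"
  unfolding Z_eq by blast

text \<open>The range of a path can be \<open>{}\<close>, in which case the segment of length 0 is
  not in \<open>E_star\<close>; the first edge always is.\<close>

lemma boundary_in_Z_E_star:
  assumes "\<mu> \<in> boundary"
  shows "\<mu> \<in> Z E_star"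
proof -
  have \<mu>: "\<mu> \<in> paths" using assms boundary_subset_paths by blast
  then show ?thesis
  proof (cases rule: paths_cases)
    case (Vertex v)
    then show ?thesis using assms
      by (auto simp: Z_eq initial_segment_def zero_enat_def intro!: exI[of _ 0])
  next
    case (prepend e \<nu>)
    have "(\<mu>, \<nu>) \<in> shift_rel [fst e]"
      using prepend by (cases e) (auto simp: shift_rel_Cons shift_rel_Nil)
    moreover from this have "path_range \<nu> \<in> E0"
      using prepend edge_dom_mem by metis
    ultimately have "(initial_segment 1 \<mu>, Vertex (path_range \<nu>)) \<in> shift_rel [fst e]"
      "enat 1 \<le> plen \<mu>"
      using shift_rel_initial_segment shift_rel_plen by fastforce+
    then show ?thesis using shift_rel_VertexD(1) assms unfolding Z_eq by blast
  qed
qed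

text \<open>The cylinder arises with \<open>K\<close> empty, its complement with \<open>V\<close>
  all of \<open>E_star\<close> and \<open>K\<close> the cylinder itself, which is compact.\<close>

lemma openin_boundary_cylinder:
  assumes "\<alpha> \<in> lists L" "A \<in> word_ideal \<alpha>"
  shows "openin boundary_topology (boundary_cylinder \<alpha> A)"
    and "openin boundary_topology (boundary - boundary_cylinder \<alpha> A)"
proof -
  have gen: "openin boundary_topology (Z V \<inter> (boundary - Z K))"
    if "openin E_star_topology V" "compactin E_star_topology K" for V K
    unfolding boundary_topology_def by (rule topology_generated_by_Basis) (use that in blast)
  have "Z {} = {}" by (auto simp: Z_eq)
  moreover have "Z S \<subseteq> boundary" for S by (auto simp: Z_def)
  ultimately show "openin boundary_topology (boundary_cylinder \<alpha> A)"
    using gen[OF openin_cylinder[OF assms], of "{}"] by (metis Diff_empty Int_absorb2 Z_cylinder compactin_empty)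
  have "Z E_star = boundary" using boundary_in_Z_E_star by (auto simp: Z_eq)
  then show "openin boundary_topology (boundary - boundary_cylinder \<alpha> A)"
    using gen[OF _ compactin_cylinder[OF assms], of E_star] openin_topspace[of E_star_topology]
    by (simp add: Z_cylinder Int_absorb1)
qed

text \<open>Says that cylinders and their complements form a subbase, so open images can be checked
  on these two kinds of sets.\<close>

lemma openin_boundary_induct [consumes 1, case_names cylinder compl Int Union]:
  assumes "openin boundary_topology W"
    and cyl: "\<And>\<alpha> A. \<alpha> \<in> lists L \<Longrightarrow> A \<in> word_ideal \<alpha> \<Longrightarrow> P (boundary_cylinder \<alpha> A)"
    and compl: "\<And>\<alpha> A. \<alpha> \<in> lists L \<Longrightarrow> A \<in> word_ideal \<alpha> \<Longrightarrow> P (boundary - boundary_cylinder \<alpha> A)"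
    and int: "\<And>V W. P V \<Longrightarrow> P W \<Longrightarrow> P (V \<inter> W)"
    and un: "\<And>\<W>. (\<And>W. W \<in> \<W> \<Longrightarrow> P W) \<Longrightarrow> P (\<Union>\<W>)"
  shows "P W"
proof -
  have Z_open: "P (Z V)" if V: "openin E_star_topology V" for V
  proof -
    let ?\<C> = "{cylinder \<alpha> A |\<alpha> A. \<alpha> \<in> lists L \<and> A \<in> word_ideal \<alpha> \<and> cylinder \<alpha> A \<subseteq> V}"
    have "V = \<Union>?\<C>"
    proof (intro equalityI subsetI)
      fix p assume "p \<in> V"
      then obtain \<alpha> A where "\<alpha> \<in> lists L" "A \<in> word_ideal \<alpha>" "p \<in> cylinder \<alpha> A" "cylinder \<alpha> A \<subseteq> V"
        by (rule cylinder_neighbourhood[OF V])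
      then show "p \<in> \<Union>?\<C>" by blast
    qed blast
    then have "Z V = \<Union>(Z ` ?\<C>)" using Z_Union[of ?\<C>] by simp
    moreover have "P (\<Union>(Z ` ?\<C>))"
    proof (rule un)
      fix W assume "W \<in> Z ` ?\<C>"
      then obtain \<alpha> A where "\<alpha> \<in> lists L" "A \<in> word_ideal \<alpha>" "W = boundary_cylinder \<alpha> A"
        using Z_cylinder by blast
      then show "P W" using cyl by blast
    qed
    ultimately show ?thesis by simp
  qed
  have P_boundary: "P boundary"
  proof -
    have "Z E_star = boundary" using boundary_in_Z_E_star by (auto simp: Z_eq)
    then show ?thesis using Z_open[of E_star] openin_topspace[of E_star_topology] by simp
  qed
  have un2: "P (V \<union> W)" if "P V" "P W" for V W
    using un[of "{V, W}"] that by auto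
  have Z_compact: "P (boundary - Z K)" if K: "compactin E_star_topology K" for K
  proof -
    \<comment> \<open>Needed so that the difference of a cylinder and \<open>K\<close> is
      open.\<close>
    have K_closed: "closedin E_star_topology K"
      by (rule compactin_imp_closedin[OF Hausdorff_E_star K])
    let ?I = "{(\<alpha>, A). \<alpha> \<in> lists L \<and> A \<in> word_ideal \<alpha>}"
    let ?\<C> = "case_prod cylinder ` ?I"
    have "K \<subseteq> \<Union>?\<C>"
    proof
      fix p assume "p \<in> K"
      then have "p \<in> topspace E_star_topology" using compactin_subset_topspace[OF K] by auto
      then obtain \<alpha> A where "\<alpha> \<in> lists L" "A \<in> word_ideal \<alpha>" "p \<in> cylinder \<alpha> A"
        by (rule cylinder_neighbourhood[OF openin_topspace])
      then show "p \<in> \<Union>?\<C>" by force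
    qed
    moreover have "\<forall>C\<in>?\<C>. openin E_star_topology C" using openin_cylinder by auto
    ultimately obtain \<F> where \<F>: "finite \<F>" "\<F> \<subseteq> ?\<C>" "K \<subseteq> \<Union>\<F>"
      using K unfolding compactin_def by meson
    obtain J where "J \<subseteq> ?I" "finite J" "\<F> = case_prod cylinder ` J"
      using finite_subset_image[OF \<F>(1,2)] by blast
    then have J: "finite J" "J \<subseteq> ?I" "K \<subseteq> \<Union>(case_prod cylinder ` J)" using \<F>(3) by auto
    \<comment> \<open>A path avoids \<open>Z K\<close> iff, for each covering cylinder that it
      enters, its unique segment there lies outside \<open>K\<close>; \<open>R j\<close> is this
      condition for one cylinder.\<close>
    define R where "R j = (boundary - boundary_cylinder (fst j) (snd j)) \<union> Z (cylinder (fst j) (snd j) - K)" for j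
    have R: "P (R j)" if "j \<in> J" for j
    proof -
      have "fst j \<in> lists L" "snd j \<in> word_ideal (fst j)" using that J(2) by auto
      then show ?thesis unfolding R_def
        by (intro un2 compl Z_open openin_diff K_closed openin_cylinder)
    qed
    from J(1) R have "P (boundary \<inter> (\<Inter>j\<in>J. R j))"
    proof (induction J rule: finite_induct)
      case (insert j F)
      have "boundary \<inter> (\<Inter>j\<in>insert j F. R j) = R j \<inter> (boundary \<inter> (\<Inter>j\<in>F. R j))" by auto
      then show ?case using insert int by simp
    qed (simp add: P_boundary)
    moreover have "boundary - Z K = boundary \<inter> (\<Inter>j\<in>J. R j)"
    proof (intro equalityI subsetI)
      fix \<mu> assume \<mu>: "\<mu> \<in> boundary - Z K"
      have "\<mu> \<in> R j" for j
      proof (cases "\<mu> \<in> boundary_cylinder (fst j) (snd j)")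
        case True
        then obtain n where "enat n \<le> plen \<mu>" "initial_segment n \<mu> \<in> cylinder (fst j) (snd j)"
          unfolding Z_cylinder[symmetric] Z_eq by blast
        then show ?thesis using \<mu> unfolding R_def Z_eq by blast
      qed (use \<mu> in \<open>simp add: R_def\<close>)
      then show "\<mu> \<in> boundary \<inter> (\<Inter>j\<in>J. R j)" using \<mu> by blast
    next
      fix \<mu> assume \<mu>: "\<mu> \<in> boundary \<inter> (\<Inter>j\<in>J. R j)"
      have False if n: "enat n \<le> plen \<mu>" "initial_segment n \<mu> \<in> K" for n
      proof -
        obtain j where j: "j \<in> J" "initial_segment n \<mu> \<in> cylinder (fst j) (snd j)"
          using J(3) n(2) by fastforce
        then have n_eq: "n = length (fst j)" "\<mu> \<in> boundary_cylinder (fst j) (snd j)"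
          using initial_segment_cylinder_iff n(1) \<mu> by blast+
        then obtain m where m: "enat m \<le> plen \<mu>" "initial_segment m \<mu> \<in> cylinder (fst j) (snd j) - K"
          using \<mu> j(1) unfolding R_def Z_eq by blast
        \<comment> \<open>Both lengths equal that of the label word, so the segment outside
          \<open>K\<close> is the one assumed to be in \<open>K\<close>.\<close>
        then have "m = n" using initial_segment_cylinder_iff \<mu> n_eq by blast
        then show False using m n by blast
      qed
      then show "\<mu> \<in> boundary - Z K" using \<mu> by (auto simp: Z_eq)
    qed
    ultimately show ?thesis by simp
  qed
  have "generate_topology_on {Z V \<inter> (boundary - Z K) |V K. openin E_star_topology V \<and> compactin E_star_topology K} W"
    using assms(1) unfolding boundary_topology_def openin_topology_generated_by_iff .
  then show ?thesis
  proof induction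
    case Empty
    show ?case using un[of "{}"] by simp
  next
    case (Basis s)
    then show ?case using Z_open Z_compact int by auto
  qed (auto intro: int un)
qed

lemma topspace_boundary_topology [simp]: "topspace boundary_topology = boundary"
proof
  have "W \<subseteq> boundary" if "openin boundary_topology W" for W
    using that by (induction rule: openin_boundary_induct) (auto simp: boundary_cylinder_def)
  then show "topspace boundary_topology \<subseteq> boundary" by blast
  have "openin boundary_topology (Z E_star \<inter> (boundary - Z {}))"
    unfolding boundary_topology_def
    using openin_topspace[of E_star_topology] by (intro topology_generated_by_Basis) auto
  moreover have "Z E_star \<inter> (boundary - Z {}) = boundary" using boundary_in_Z_E_star by (auto simp: Z_eq)
  ultimately show "boundary \<subseteq> topspace boundary_topology" using openin_subset by metis
qed

text \<open>Paths with label \<alpha> have a remainder whose range meets the word ideal, so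
  \<open>B\<close> can be replaced near each path by a smaller element of that ideal. Only openness
  survives this; closedness is not claimed.\<close>

lemma openin_boundary_cylinder_general:
  assumes \<alpha>: "\<alpha> \<in> lists L"
  shows "openin boundary_topology (boundary_cylinder \<alpha> B)"
proof (cases "\<alpha> = []")
  case True
  then show ?thesis using openin_boundary_cylinder(1)[of "[]" B] by simp
next
  case False
  let ?\<C> = "{boundary_cylinder \<alpha> A |A. A \<in> word_ideal \<alpha> \<and> A \<le> B}"
  have "boundary_cylinder \<alpha> B = \<Union>?\<C>"
  proof (intro equalityI subsetI)
    fix \<mu> assume "\<mu> \<in> boundary_cylinder \<alpha> B"
    then obtain \<rho> where \<rho>: "\<mu> \<in> boundary" "(\<mu>, \<rho>) \<in> shift_rel \<alpha>" "B \<in> path_range \<rho>"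
      by (auto simp: boundary_cylinder_def)
    have uf: "path_range \<rho> \<in> ultrafilters UNIV"
      using path_range_nonempty shift_rel_paths[OF \<rho>(2)] \<rho>(3) by (auto simp: E0_def)
    obtain C where C: "C \<in> path_range \<rho>" "C \<in> word_ideal \<alpha>"
      using shift_rel_range_meets[OF \<rho>(2) False] by blast
    have "inf C B \<in> path_range \<rho>" using ba_filter_inf[OF ultrafilters_filter[OF uf] C(1) \<rho>(3)] .
    then have "\<mu> \<in> boundary_cylinder \<alpha> (inf C B)" using \<rho> by (auto simp: boundary_cylinder_def)
    moreover have "inf C B \<in> word_ideal \<alpha>" using word_ideal_down[OF C(2)] by simp
    ultimately show "\<mu> \<in> \<Union>?\<C>" using inf_le2[of C B] by blast
  next
    fix \<mu> assume "\<mu> \<in> \<Union>?\<C>"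
    then obtain A \<rho> where \<rho>: "A \<le> B" "\<mu> \<in> boundary" "(\<mu>, \<rho>) \<in> shift_rel \<alpha>" "A \<in> path_range \<rho>"
      by (auto simp: boundary_cylinder_def)
    have uf: "path_range \<rho> \<in> ultrafilters UNIV"
      using path_range_nonempty shift_rel_paths[OF \<rho>(3)] \<rho>(4) by (auto simp: E0_def)
    then have "B \<in> path_range \<rho>" using ba_filter_up[OF ultrafilters_filter[OF uf] \<rho>(4)] \<rho>(1) by simp
    then show "\<mu> \<in> boundary_cylinder \<alpha> B" using \<rho> by (auto simp: boundary_cylinder_def)
  qed
  moreover have "openin boundary_topology (\<Union>?\<C>)"
    by (rule openin_Union) (use openin_boundary_cylinder(1)[OF \<alpha>] in auto)
  ultimately show ?thesis by simp
qed

section \<open>Shifts of the boundary and their inverses map open sets to open sets\<close>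

definition boundary_shift :: "'l list \<Rightarrow> ('l, 'b) gpath rel" where
  "boundary_shift \<alpha> = shift_rel \<alpha> \<inter> boundary \<times> boundary"

lemma boundary_shift_iff: "(\<mu>, \<nu>) \<in> boundary_shift \<alpha> \<longleftrightarrow> (\<mu>, \<nu>) \<in> shift_rel \<alpha> \<and> \<mu> \<in> boundary"
  using shift_rel_boundary by (auto simp: boundary_shift_def)

lemma boundary_shift_label: "(\<mu>, \<nu>) \<in> boundary_shift [a] \<Longrightarrow> a \<in> L"
  by (auto simp: boundary_shift_iff shift_rel_Cons E1_iff)

lemma Range_boundary_shift:
  assumes "\<alpha> \<in> lists L" "\<alpha> \<noteq> []" "\<nu> \<in> boundary"
  shows "(\<exists>\<mu>. (\<mu>, \<nu>) \<in> boundary_shift \<alpha>) \<longleftrightarrow> path_range \<nu> \<inter> word_ideal \<alpha> \<noteq> {}"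
proof
  assume "\<exists>\<mu>. (\<mu>, \<nu>) \<in> boundary_shift \<alpha>"
  then show "path_range \<nu> \<inter> word_ideal \<alpha> \<noteq> {}"
    using shift_rel_range_meets assms(2) by (auto simp: boundary_shift_iff)
next
  assume "path_range \<nu> \<inter> word_ideal \<alpha> \<noteq> {}"
  moreover have "\<nu> \<in> paths" using assms(3) boundary_subset_paths by blast
  ultimately have "\<exists>\<mu>. (\<mu>, \<nu>) \<in> shift_rel \<alpha>" using shift_rel_edges_over assms(1,2) by blast
  then show "\<exists>\<mu>. (\<mu>, \<nu>) \<in> boundary_shift \<alpha>"
    using shift_rel_boundary assms(3) by (auto simp: boundary_shift_iff)
qed

lemma openin_boundary_shift_range:
  assumes a: "a \<in> L"
  shows "openin boundary_topology (boundary_shift [a] `` boundary)"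
proof -
  have "boundary_shift [a] `` boundary = \<Union>(boundary_cylinder [] ` \<I> a)"
  proof (intro equalityI subsetI)
    fix \<nu> assume "\<nu> \<in> boundary_shift [a] `` boundary"
    then have "\<exists>\<mu>. (\<mu>, \<nu>) \<in> boundary_shift [a]" "\<nu> \<in> boundary" by (auto simp: boundary_shift_def)
    moreover from this have "path_range \<nu> \<inter> \<I> a \<noteq> {}"
      using Range_boundary_shift[of "[a]" \<nu>] word_ideal_singleton[OF a] a by simp
    ultimately show "\<nu> \<in> \<Union>(boundary_cylinder [] ` \<I> a)"
      using boundary_subset_paths by (auto simp: boundary_cylinder_def shift_rel_Nil)
  next
    fix \<nu> assume "\<nu> \<in> \<Union>(boundary_cylinder [] ` \<I> a)"
    then have \<nu>: "\<nu> \<in> boundary" "path_range \<nu> \<inter> \<I> a \<noteq> {}"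
      by (auto simp: boundary_cylinder_def shift_rel_Nil)
    then have "\<exists>\<mu>. (\<mu>, \<nu>) \<in> boundary_shift [a]"
      using Range_boundary_shift[of "[a]" \<nu>] word_ideal_singleton[OF a] a by simp
    then show "\<nu> \<in> boundary_shift [a] `` boundary" by (auto simp: boundary_shift_def)
  qed
  then show ?thesis using openin_boundary_cylinder(1)[of "[]"] by auto
qed

text \<open>For the empty word \<open>A\<close> moves to \<open>\<theta> a A\<close>; otherwise the
  first letter is dropped if it is \<open>a\<close>, and nothing remains if it is not.\<close>

lemma boundary_shift_cylinder:
  assumes a: "a \<in> L" and \<alpha>: "\<alpha> \<in> lists L" and A: "A \<in> word_ideal \<alpha>"
  shows "boundary_shift [a] `` boundary_cylinder \<alpha> A = {} \<or>
    (\<exists>\<beta>\<in>lists L. \<exists>B\<in>word_ideal \<beta>.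
      boundary_shift [a] `` boundary_cylinder \<alpha> A = boundary_shift [a] `` boundary \<inter> boundary_cylinder \<beta> B)"
proof (cases \<alpha>)
  case Nil
  have "boundary_shift [a] `` boundary_cylinder \<alpha> A = boundary_shift [a] `` boundary \<inter> boundary_cylinder [] (\<theta> a A)"
    using shift_rel_range_iff[of _ _ "[a]" A] shift_rel_paths Nil
    by (fastforce simp: boundary_shift_def boundary_cylinder_def shift_rel_Nil)
  then show ?thesis by fastforce
next
  case (Cons b \<beta>)
  show ?thesis
  proof (cases "a = b")
    case False
    then have "boundary_shift [a] `` boundary_cylinder \<alpha> A = {}"
      using Cons by (auto simp: boundary_shift_def boundary_cylinder_def shift_rel_def starts_with_def)
    then show ?thesis ..
  next
    case True
    have split: "shift_rel \<alpha> = shift_rel [a] O shift_rel \<beta>"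
      using shift_rel_append[of "[a]" \<beta>] Cons True by simp
    have "boundary_shift [a] `` boundary_cylinder \<alpha> A = boundary_shift [a] `` boundary \<inter> boundary_cylinder \<beta> A"
    proof (intro equalityI subsetI)
      fix \<nu> assume "\<nu> \<in> boundary_shift [a] `` boundary_cylinder \<alpha> A"
      then obtain \<mu> \<rho> \<nu>' where 1: "(\<mu>, \<nu>) \<in> boundary_shift [a]" "\<mu> \<in> boundary" "A \<in> path_range \<rho>"
        "(\<mu>, \<nu>') \<in> shift_rel [a]" "(\<nu>', \<rho>) \<in> shift_rel \<beta>"
        unfolding boundary_cylinder_def split by blast
      moreover have "\<nu>' = \<nu>" using 1 shift_rel_single_valued by (auto simp: boundary_shift_def)
      ultimately show "\<nu> \<in> boundary_shift [a] `` boundary \<inter> boundary_cylinder \<beta> A"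
        by (auto simp: boundary_shift_def boundary_cylinder_def)
    next
      fix \<nu> assume "\<nu> \<in> boundary_shift [a] `` boundary \<inter> boundary_cylinder \<beta> A"
      then obtain \<mu> \<rho> where "(\<mu>, \<nu>) \<in> boundary_shift [a]" "\<mu> \<in> boundary" "(\<nu>, \<rho>) \<in> shift_rel \<beta>" "A \<in> path_range \<rho>"
        by (auto simp: boundary_cylinder_def)
      then show "\<nu> \<in> boundary_shift [a] `` boundary_cylinder \<alpha> A"
        unfolding boundary_cylinder_def split by (auto simp: boundary_shift_def)
    qed
    moreover have "A \<in> word_ideal \<beta>" using word_ideal_Cons_subset \<alpha> A Cons by blast
    ultimately show ?thesis using \<alpha> Cons by auto
  qed
qed

lemma single_valued_boundary_shift: "single_valued (boundary_shift \<alpha>)"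
  using shift_rel_single_valued by (auto simp: single_valued_def boundary_shift_def)

lemma single_valued_converse_boundary_shift: "single_valued ((boundary_shift \<alpha>)\<inverse>)"
  using shift_rel_inj by (auto simp: single_valued_def boundary_shift_def)

text \<open>Images commute with intersections, and likewise with differences below, because the
  relations are injective and single-valued.\<close>

lemma boundary_shift_Image_Int:
  "boundary_shift \<alpha> `` (V \<inter> W) = boundary_shift \<alpha> `` V \<inter> boundary_shift \<alpha> `` W"
  "(boundary_shift \<alpha>)\<inverse> `` (V \<inter> W) = (boundary_shift \<alpha>)\<inverse> `` V \<inter> (boundary_shift \<alpha>)\<inverse> `` W"
  using shift_rel_inj shift_rel_single_valued
  by (auto simp: boundary_shift_def Image_iff; blast)+

lemma boundary_shift_Image_Diff:
  "boundary_shift \<alpha> `` (V - W) = boundary_shift \<alpha> `` V - boundary_shift \<alpha> `` W"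
  "(boundary_shift \<alpha>)\<inverse> `` (V - W) = (boundary_shift \<alpha>)\<inverse> `` V - (boundary_shift \<alpha>)\<inverse> `` W"
  using shift_rel_inj shift_rel_single_valued
  by (auto simp: boundary_shift_def Image_iff; blast)+

lemma openin_boundary_shift:
  assumes "openin boundary_topology W"
  shows "openin boundary_topology (boundary_shift [a] `` W)"
proof (cases "a \<in> L")
  case False
  then have "boundary_shift [a] = {}" using boundary_shift_label by auto
  then show ?thesis by simp
next
  case a: True
  note D = openin_boundary_shift_range[OF a]
  from assms show ?thesis
  proof (induction rule: openin_boundary_induct)
    case (cylinder \<alpha> A)
    then show ?case
      using boundary_shift_cylinder[OF a cylinder] D openin_boundary_cylinder(1)
      by (elim disjE bexE) (simp_all add: openin_Int)
  next
    case (compl \<alpha> A)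
    let ?S = "boundary_shift [a]"
    have *: "?S `` (boundary - boundary_cylinder \<alpha> A) = ?S `` boundary - ?S `` boundary_cylinder \<alpha> A"
      by (rule boundary_shift_Image_Diff(1))
    from boundary_shift_cylinder[OF a compl] show ?case
    proof (elim disjE bexE)
      assume "?S `` boundary_cylinder \<alpha> A = {}"
      then show ?thesis using * D by simp
    next
      fix \<beta> B assume B: "\<beta> \<in> lists L" "B \<in> word_ideal \<beta>"
        "?S `` boundary_cylinder \<alpha> A = ?S `` boundary \<inter> boundary_cylinder \<beta> B"
      have "?S `` boundary \<subseteq> boundary" by (auto simp: boundary_shift_def)
      then have "?S `` (boundary - boundary_cylinder \<alpha> A) = ?S `` boundary \<inter> (boundary - boundary_cylinder \<beta> B)"
        using * B(3) by blast
      then show ?thesis using openin_Int[OF D openin_boundary_cylinder(2)[OF B(1,2)]] by simp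
    qed
  next
    case (Int V W)
    then show ?case by (simp add: boundary_shift_Image_Int openin_Int)
  next
    case (Union \<W>)
    moreover have "boundary_shift [a] `` \<Union>\<W> = \<Union>((``) (boundary_shift [a]) ` \<W>)" by blast
    ultimately show ?case by auto
  qed
qed

text \<open>Here \<open>A\<close> may lie in the word ideal of \<alpha> but not in that of
  \<open>a # \<alpha>\<close>, which is why \<open>openin_boundary_cylinder_general\<close> is
  required.\<close>

lemma converse_boundary_shift_cylinder:
  "(boundary_shift [a])\<inverse> `` boundary_cylinder \<alpha> A = boundary_cylinder (a # \<alpha>) A"
proof -
  have "shift_rel (a # \<alpha>) = shift_rel [a] O shift_rel \<alpha>" using shift_rel_append[of "[a]" \<alpha>] by simp
  then show ?thesis using shift_rel_boundary
    by (auto simp: boundary_cylinder_def boundary_shift_def)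
qed

lemma openin_converse_boundary_shift:
  assumes "openin boundary_topology W"
  shows "openin boundary_topology ((boundary_shift [a])\<inverse> `` W)"
proof (cases "a \<in> L")
  case False
  then have "boundary_shift [a] = {}" using boundary_shift_label by auto
  then show ?thesis by simp
next
  case a: True
  let ?S = "(boundary_shift [a])\<inverse>"
  \<comment> \<open>Covers the domain of the shift by cylinders on which complements can be treated
    one \<open>A\<close> at a time.\<close>
  have dom: "?S `` boundary = \<Union>(boundary_cylinder [a] ` \<I> a)"
  proof (intro equalityI subsetI)
    fix \<mu> assume "\<mu> \<in> ?S `` boundary"
    then obtain \<nu> where \<nu>: "(\<mu>, \<nu>) \<in> shift_rel [a]" "\<mu> \<in> boundary" by (auto simp: boundary_shift_def)
    then show "\<mu> \<in> \<Union>(boundary_cylinder [a] ` \<I> a)"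
      using shift_rel_range_meets[OF \<nu>(1)] word_ideal_singleton[OF a] by (auto simp: boundary_cylinder_def simp del: word_ideal.simps)
  next
    fix \<mu> assume "\<mu> \<in> \<Union>(boundary_cylinder [a] ` \<I> a)"
    then show "\<mu> \<in> ?S `` boundary"
      using shift_rel_boundary by (auto simp: boundary_cylinder_def boundary_shift_def)
  qed
  from assms show ?thesis
  proof (induction rule: openin_boundary_induct)
    case (cylinder \<alpha> A)
    then show ?case
      unfolding converse_boundary_shift_cylinder using a by (intro openin_boundary_cylinder_general) simp
  next
    case (compl \<alpha> B)
    have a\<alpha>: "a # \<alpha> \<in> lists L" using a compl by simp
    have "openin boundary_topology (boundary_cylinder [a] A - boundary_cylinder (a # \<alpha>) B)" if A: "A \<in> \<I> a" for A
    proof -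
      \<comment> \<open>On the cylinder of \<open>A\<close> the set \<open>B\<close> may be cut down to one that lies in the ideal of \<open>a # \<alpha>\<close>,
        for which the cylinder is closed.\<close>
      let ?C = "inf B (word_action \<alpha> A)"
      have C: "?C \<in> word_ideal (a # \<alpha>)" using word_ideal_down[OF word_action_mem[OF A]] by simp
      have "\<mu> \<in> boundary_cylinder (a # \<alpha>) B \<longleftrightarrow> \<mu> \<in> boundary_cylinder (a # \<alpha>) ?C"
        if \<mu>: "\<mu> \<in> boundary_cylinder [a] A" for \<mu>
      proof -
        obtain \<nu> where \<nu>: "(\<mu>, \<nu>) \<in> shift_rel [a]" "A \<in> path_range \<nu>" using \<mu> by (auto simp: boundary_cylinder_def)
        have "B \<in> path_range \<rho> \<longleftrightarrow> ?C \<in> path_range \<rho>" if "(\<mu>, \<rho>) \<in> shift_rel (a # \<alpha>)" for \<rho>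
        proof -
          have "(\<mu>, \<rho>) \<in> shift_rel [a] O shift_rel \<alpha>" using that shift_rel_append[of "[a]" \<alpha>] by simp
          then have \<rho>: "(\<nu>, \<rho>) \<in> shift_rel \<alpha>" using shift_rel_single_valued \<nu>(1) by blast
          then have act: "word_action \<alpha> A \<in> path_range \<rho>" using shift_rel_range_iff \<nu>(2) by blast
          then have "path_range \<rho> \<in> ultrafilters UNIV"
            using path_range_nonempty shift_rel_paths[OF \<rho>] by (auto simp: E0_def)
          note filt = ultrafilters_filter[OF this]
          show ?thesis
            using ba_filter_inf[OF filt _ act, of B] ba_filter_up[OF filt, of ?C B] by auto
        qed
        then show ?thesis by (auto simp: boundary_cylinder_def)
      qed
      then have "boundary_cylinder [a] A - boundary_cylinder (a # \<alpha>) B =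
          boundary_cylinder [a] A \<inter> (boundary - boundary_cylinder (a # \<alpha>) ?C)"
        by (auto simp: boundary_cylinder_def[of "[a]"])
      then show ?thesis
        using openin_Int[OF openin_boundary_cylinder(1)[of "[a]" A] openin_boundary_cylinder(2)[OF a\<alpha> C]]
          A a word_ideal_singleton[OF a] by (simp del: word_ideal.simps)
    qed
    then have "openin boundary_topology (\<Union>A\<in>\<I> a. boundary_cylinder [a] A - boundary_cylinder (a # \<alpha>) B)"
      by (intro openin_Union) blast
    moreover have "?S `` (boundary - boundary_cylinder \<alpha> B) =
        (\<Union>A\<in>\<I> a. boundary_cylinder [a] A - boundary_cylinder (a # \<alpha>) B)"
      unfolding boundary_shift_Image_Diff converse_boundary_shift_cylinder dom by blast
    ultimately show ?case by metis
  next
    case (Int V W)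
    then show ?case by (simp add: boundary_shift_Image_Int openin_Int)
  next
    case (Union \<W>)
    moreover have "?S `` \<Union>\<W> = \<Union>((``) ?S ` \<W>)" by blast
    ultimately show ?case by auto
  qed
qed

end

section \<open>The partial action on the boundary path space\<close>

lemma takeWhile_quot_word [simp]: "takeWhile snd (quot_word \<alpha> \<beta>) = map (\<lambda>a. (a, True)) \<alpha>"
  and dropWhile_quot_word [simp]: "dropWhile snd (quot_word \<alpha> \<beta>) = map (\<lambda>b. (b, False)) (rev \<beta>)"
proof -
  have "takeWhile snd (map (\<lambda>b. (b, False)) \<gamma>) = []" "dropWhile snd (map (\<lambda>b. (b, False)) \<gamma>) = map (\<lambda>b. (b, False)) \<gamma>"
    for \<gamma> :: "'a list" by (cases \<gamma>; simp)+
  then show "takeWhile snd (quot_word \<alpha> \<beta>) = map (\<lambda>a. (a, True)) \<alpha>"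
    "dropWhile snd (quot_word \<alpha> \<beta>) = map (\<lambda>b. (b, False)) (rev \<beta>)"
    by (induction \<alpha>) (simp_all add: quot_word_def)
qed

lemma quot_word_eq_iff [simp]: "quot_word \<alpha> \<beta> = quot_word \<alpha>' \<beta>' \<longleftrightarrow> \<alpha> = \<alpha>' \<and> \<beta> = \<beta>'"
proof -
  have "\<alpha> = map fst (takeWhile snd (quot_word \<alpha> \<beta>)) \<and> \<beta> = rev (map fst (dropWhile snd (quot_word \<alpha> \<beta>)))"
    for \<alpha> \<beta> :: "'a list" by (simp add: o_def rev_map)
  then show ?thesis by metis
qed

lemma quot_word_eq_Nil_iff [simp]: "quot_word \<alpha> \<beta> = [] \<longleftrightarrow> \<alpha> = [] \<and> \<beta> = []"
  by (simp add: quot_word_def)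

lemma inverse_quot_word: "map letter_inv (rev (quot_word \<alpha> \<beta>)) = quot_word \<beta> \<alpha>"
  by (simp add: quot_word_def letter_inv_def rev_map)

text \<open>The obstruction to the form \<alpha>\<beta>^-1 is a negative letter directly before a
  positive one. A new first letter creates it only if it is negative and the positive block is
  non-empty.\<close>

lemma quot_word_cases:
  obtains (quot) \<alpha> \<beta> where "t = quot_word \<alpha> \<beta>"
    | (inner) u a b v where "t = u @ [(a, False), (b, True)] @ v"
proof (induction t arbitrary: thesis)
  case Nil
  then show ?case using quot_word_eq_Nil_iff by metis
next
  case (Cons x t)
  show ?case
  proof (rule Cons.IH)
    fix \<alpha> \<beta> assume t: "t = quot_word \<alpha> \<beta>"
    obtain a b where x: "x = (a, b)" by (cases x)
    show thesis
    proof (cases b)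
      case True
      then have "x # t = quot_word (a # \<alpha>) \<beta>" using t x by (simp add: quot_word_def)
      then show thesis by (rule Cons.prems(1))
    next
      case False
      show thesis
      proof (cases \<alpha>)
        case Nil
        then have "x # t = quot_word [] (\<beta> @ [a])" using False t x by (simp add: quot_word_def)
        then show thesis by (rule Cons.prems(1))
      next
        case (Cons c \<gamma>)
        then have "x # t = [] @ [(a, False), (c, True)] @ (map (\<lambda>a. (a, True)) \<gamma> @ map (\<lambda>b. (b, False)) (rev \<beta>))"
          using False t x by (simp add: quot_word_def)
        then show thesis by (rule Cons.prems(2))
      qed
    qed
  next
    fix u a b v assume "t = u @ [(a, False), (b, True)] @ v"
    then have "x # t = (x # u) @ [(a, False), (b, True)] @ v" by simp
    then show thesis by (rule Cons.prems(2))
  qed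
qed

context generalized_boolean_dynamical_system
begin

section \<open>The letters as partial bijections of the boundary\<close>

definition letter_rel :: "'l \<times> bool \<Rightarrow> ('l, 'b) gpath rel" where
  "letter_rel x = (if snd x then (boundary_shift [fst x])\<inverse> else boundary_shift [fst x])"

lemma letter_rel_simps [simp]:
  "letter_rel (a, True) = (boundary_shift [a])\<inverse>" "letter_rel (a, False) = boundary_shift [a]"
  by (simp_all add: letter_rel_def)

sublocale letters: letter_partial_bijections boundary letter_rel
proof
  fix x :: "'l \<times> bool"
  show "letter_rel x \<subseteq> boundary \<times> boundary" by (auto simp: letter_rel_def boundary_shift_def)
  show "letter_rel (letter_inv x) = (letter_rel x)\<inverse>" by (simp add: letter_rel_def letter_inv_def)
  show "single_valued (letter_rel x)"
    by (simp add: letter_rel_def single_valued_boundary_shift single_valued_converse_boundary_shift)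
qed

lemma boundary_shift_Nil: "boundary_shift [] = Id_on boundary"
  using boundary_subset_paths by (auto simp: boundary_shift_def shift_rel_Nil)

lemma boundary_shift_Cons: "boundary_shift (a # \<alpha>) = boundary_shift [a] O boundary_shift \<alpha>"
proof -
  have "shift_rel (a # \<alpha>) = shift_rel [a] O shift_rel \<alpha>" using shift_rel_append[of "[a]" \<alpha>] by simp
  then show ?thesis using shift_rel_boundary by (auto simp: boundary_shift_def)
qed

text \<open>The inverse word lists \<beta> backwards and its last letter acts first, so the edges
  are removed in the order of \<beta>.\<close>

lemma word_rel_negative: "word_rel boundary letter_rel (map (\<lambda>b. (b, False)) (rev \<beta>)) = boundary_shift \<beta>"
proof (induction \<beta>)
  case (Cons b \<beta>)
  have "Id_on boundary O boundary_shift [b] = boundary_shift [b]" by (auto simp: boundary_shift_def)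
  then show ?case using Cons
    by (simp add: letters.word_rel_append boundary_shift_Cons[of b \<beta>])
qed (simp add: boundary_shift_Nil)

lemma word_rel_quot_word:
  "word_rel boundary letter_rel (quot_word \<alpha> \<beta>) = boundary_shift \<beta> O (boundary_shift \<alpha>)\<inverse>"
proof -
  have "map (\<lambda>a. (a, True)) \<alpha> = map letter_inv (rev (map (\<lambda>b. (b, False)) (rev \<alpha>)))"
    by (simp add: rev_map letter_inv_def)
  then have "word_rel boundary letter_rel (map (\<lambda>a. (a, True)) \<alpha>) = (boundary_shift \<alpha>)\<inverse>"
    by (simp only: letters.word_rel_inverse word_rel_negative)
  then show ?thesis by (simp add: quot_word_def letters.word_rel_append word_rel_negative)
qed

lemma word_rel_inner:
  assumes "a \<noteq> b"
  shows "word_rel boundary letter_rel (u @ [(a, False), (b, True)] @ v) = {}"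
proof -
  have "(boundary_shift [b])\<inverse> O boundary_shift [a] = {}"
    using assms by (auto simp: boundary_shift_def shift_rel_def starts_with_def)
  then have "word_rel boundary letter_rel [(a, False), (b, True)] = {}"
    by (simp add: O_assoc)
  then show ?thesis unfolding letters.word_rel_append by simp
qed

text \<open>A proper ultrafilter meeting the word ideal provides an element other than
  \<open>bot\<close> in it. Hence the restriction to \<W>^* in the sets U_t agrees with the domains
  of the shifts.\<close>

lemma shift_rel_W_ge1:
  assumes "(\<mu>, \<rho>) \<in> shift_rel \<alpha>" "\<alpha> \<in> lists L" "\<alpha> \<noteq> []"
  shows "\<alpha> \<in> W_ge1"
proof -
  obtain A where A: "A \<in> path_range \<rho>" "A \<in> word_ideal \<alpha>"
    using shift_rel_range_meets[OF assms(1,3)] by blast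
  have "path_range \<rho> \<in> ultrafilters UNIV"
    using path_range_nonempty A(1) shift_rel_paths[OF assms(1)] by (auto simp: E0_def)
  then have "A \<noteq> bot" using ba_filter_bot[OF ultrafilters_filter] A(1) by blast
  then show ?thesis using A(2) assms(2,3) by (auto simp: W_ge1_def W_star_def Suc_le_eq simp del: in_lists_conv_set)
qed

text \<open>Links the last edge of the prefix, on which \<open>U\<close> and \<open>quot_map\<close>
  are based, to the range of the remainder. Its index is \<open>length \<alpha> - 1\<close> since
  edges are numbered from 0.\<close>

lemma shift_rel_last_edge:
  assumes "(\<mu>, \<rho>) \<in> shift_rel \<alpha>" "\<alpha> \<noteq> []"
  shows "edge_at \<mu> (length \<alpha> - 1) \<in> E1 \<and> edge_dom (edge_at \<mu> (length \<alpha> - 1)) = path_range \<rho>"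
  using assms
proof (induction \<alpha> arbitrary: \<mu>)
  case (Cons a \<alpha>)
  obtain \<eta> \<nu> where \<nu>: "(a, \<eta>) \<in> E1" "\<mu> = prepend [(a, \<eta>)] \<nu>" "edge_dom (a, \<eta>) = path_range \<nu>"
    "(\<nu>, \<rho>) \<in> shift_rel \<alpha>" using Cons.prems unfolding shift_rel_Cons by blast
  have \<nu>p: "\<nu> \<in> paths" "enat (length \<alpha>) \<le> plen \<nu>" using shift_rel_paths shift_rel_plen \<nu>(4) by auto
  show ?case
  proof (cases \<alpha>)
    case Nil
    then show ?thesis using \<nu> edge_at_prepend_0[OF \<nu>p(1) \<nu>(3)] by (simp add: shift_rel_Nil del: edge_dom.simps)
  next
    case (Cons b \<beta>)
    then have "enat (length \<alpha> - 1) < plen \<nu>"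
      using \<nu>p(2) by (metis diff_less enat_ord_simps(2) length_greater_0_conv less_le_trans list.discI zero_less_one)
    then have "edge_at \<mu> (length (a # \<alpha>) - 1) = edge_at \<nu> (length \<alpha> - 1)"
      using edge_at_prepend[OF \<nu>p(1) \<nu>(3)] \<nu>(2) Cons by simp
    then show ?thesis using Cons.IH[OF \<nu>(4)] Cons by simp
  qed
qed simp

lemma shift_rel_unique_path:
  assumes "(\<nu>, \<rho>) \<in> shift_rel \<alpha>" "\<alpha> \<in> lists L" "\<alpha> \<noteq> []"
  shows "\<nu> = prepend (edges_over (path_range \<rho>) \<alpha>) \<rho>"
proof -
  have "(prepend (edges_over (path_range \<rho>) \<alpha>) \<rho>, \<rho>) \<in> shift_rel \<alpha>"
    using shift_rel_edges_over shift_rel_range_meets[OF assms(1,3)] shift_rel_paths[OF assms(1)] assms(2,3)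
    by blast
  then show ?thesis by (rule shift_rel_inj[OF assms(1)])
qed

lemma shift_rel_iff_range_meets:
  assumes "(\<mu>, \<rho>) \<in> shift_rel \<beta>" "\<mu> \<in> boundary" "\<alpha> \<in> lists L" "\<alpha> \<noteq> []"
  shows "(\<exists>\<nu>. (\<nu>, \<rho>) \<in> boundary_shift \<alpha>) \<longleftrightarrow> path_range \<rho> \<inter> word_ideal \<alpha> \<noteq> {}"
  using Range_boundary_shift[OF assms(3,4)] shift_rel_boundary[OF assms(1)] assms(2) by blast

text \<open>The word ideal is downward closed, so closing \<open>snd e\<close> upwards does not
  affect whether it is met.\<close>

lemma edge_dom_meets_iff:
  "snd e \<inter> word_ideal \<alpha> \<noteq> {} \<longleftrightarrow> edge_dom e \<inter> word_ideal \<alpha> \<noteq> {}"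
  using word_ideal_down[of _ \<alpha>] by (cases e) auto

text \<open>Unifies the clauses of \<open>U\<close>: a prefix \<beta> can be removed, and the range
  of the remainder meets the word ideal of \<alpha>, which is the condition for a prefix \<alpha> to
  be added.\<close>

lemma U_quot_word_iff:
  assumes L: "\<alpha> \<in> lists L" "\<beta> \<in> lists L" and red: "reduced (quot_word \<beta> \<alpha>)"
  shows "\<mu> \<in> U (quot_word \<beta> \<alpha>) \<longleftrightarrow> (\<exists>\<rho> \<nu>. (\<mu>, \<rho>) \<in> boundary_shift \<beta> \<and> (\<nu>, \<rho>) \<in> boundary_shift \<alpha>)"
    (is "_ \<longleftrightarrow> ?r")
proof (cases "\<alpha> = [] \<and> \<beta> = []")
  case True
  then show ?thesis by (auto simp: U_def boundary_shift_Nil quot_word_def)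
next
  case False
  let ?C = "\<alpha> \<in> W_ge1 \<and> \<beta> \<in> W_ge1 \<and> starts_with \<beta> \<mu> \<and> snd (edge_at \<mu> (length \<beta> - 1)) \<inter> word_ideal \<alpha> \<noteq> {}
      \<or> \<alpha> = [] \<and> \<beta> \<in> W_ge1 \<and> starts_with \<beta> \<mu>
      \<or> \<beta> = [] \<and> \<alpha> \<in> W_ge1 \<and> path_range \<mu> \<inter> word_ideal \<alpha> \<noteq> {}"
  have W_ne: "[] \<notin> W_ge1" by (simp add: W_ge1_def)
  have "\<mu> \<in> U (quot_word \<beta> \<alpha>) \<longleftrightarrow> \<mu> \<in> boundary \<and> ?C"
    using False red by (auto simp: U_def)
  also have "\<dots> \<longleftrightarrow> ?r"
  proof
    assume C: "\<mu> \<in> boundary \<and> ?C"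
    then have \<mu>: "\<mu> \<in> boundary" "\<mu> \<in> paths" using boundary_subset_paths by auto
    have "starts_with \<beta> \<mu>" using C by auto
    then obtain \<rho> where \<rho>: "(\<mu>, \<rho>) \<in> shift_rel \<beta>" using \<mu>(2) by (simp add: shift_rel_def)
    then have \<rho>b: "(\<mu>, \<rho>) \<in> boundary_shift \<beta>" using \<mu>(1) by (simp add: boundary_shift_iff)
    have "\<exists>\<nu>. (\<nu>, \<rho>) \<in> boundary_shift \<alpha>"
    proof (cases "\<alpha> = []")
      case True
      have "\<rho> \<in> boundary" using \<rho>b by (simp add: boundary_shift_def)
      then show ?thesis using True by (auto simp: boundary_shift_Nil)
    next
      case \<alpha>: False
      have "path_range \<rho> \<inter> word_ideal \<alpha> \<noteq> {}"
      proof (cases "\<beta> = []")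
        case True
        then show ?thesis using C \<alpha> W_ne \<rho> by (auto simp: shift_rel_Nil)
      next
        case False
        then show ?thesis using C \<alpha> shift_rel_last_edge[OF \<rho> False] edge_dom_meets_iff by metis
      qed
      then show ?thesis using shift_rel_iff_range_meets[OF \<rho> \<mu>(1) L(1) \<alpha>] by blast
    qed
    then show ?r using \<rho>b by blast
  next
    assume ?r
    then obtain \<rho> \<nu> where *: "(\<mu>, \<rho>) \<in> shift_rel \<beta>" "\<mu> \<in> boundary" "(\<nu>, \<rho>) \<in> shift_rel \<alpha>"
      by (auto simp: boundary_shift_iff)
    have W: "\<alpha> = [] \<or> \<alpha> \<in> W_ge1" "\<beta> = [] \<or> \<beta> \<in> W_ge1"
      using shift_rel_W_ge1 * L by blast+
    have start: "starts_with \<beta> \<mu>" using *(1) by (simp add: shift_rel_def)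
    have meets: "path_range \<rho> \<inter> word_ideal \<alpha> \<noteq> {}" if "\<alpha> \<noteq> []"
      using shift_rel_range_meets[OF *(3) that] .
    show "\<mu> \<in> boundary \<and> ?C"
    proof (cases "\<alpha> = [] \<or> \<beta> = []")
      case True
      then show ?thesis using False W start meets *(1,2) by (auto simp: shift_rel_Nil)
    next
      case ne: False
      then have "snd (edge_at \<mu> (length \<beta> - 1)) \<inter> word_ideal \<alpha> \<noteq> {}"
        using shift_rel_last_edge[OF *(1)] meets edge_dom_meets_iff by metis
      then show ?thesis using ne W start *(2) by blast
    qed
  qed
  finally show ?thesis .
qed

text \<open>The ultrafilter from which the new edges are computed is the range of the remainder,
  whether or not \<beta> is empty; injectivity of the shift then identifies the result.\<close>

lemma quot_map_eq:
  assumes "(\<mu>, \<rho>) \<in> shift_rel \<beta>" "(\<nu>, \<rho>) \<in> shift_rel \<alpha>" "\<alpha> \<in> lists L"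
  shows "quot_map \<alpha> \<beta> \<mu> = \<nu>"
proof -
  have \<rho>: "remove_edges (length \<beta>) \<mu> = \<rho>" using assms(1) by (simp add: shift_rel_def)
  show ?thesis
  proof (cases "\<alpha> = []")
    case True
    then show ?thesis using \<rho> assms(2) by (simp add: quot_map_def shift_rel_Nil)
  next
    case False
    have "(if \<beta> = [] then path_range \<mu> else edge_dom (edge_at \<mu> (length \<beta> - 1))) = path_range \<rho>"
      using assms(1) shift_rel_last_edge[OF assms(1)] by (auto simp: shift_rel_Nil)
    then show ?thesis
      using False \<rho> shift_rel_unique_path[OF assms(2,3) False] by (simp add: quot_map_def)
  qed
qed

lemma \<phi>_quot_word:
  assumes "quot_word \<alpha> \<beta> \<noteq> []"
  shows "\<phi> (quot_word \<alpha> \<beta>) \<mu> = quot_map \<alpha> \<beta> \<mu>"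
  unfolding \<phi>_def if_not_P[OF assms] by (simp add: o_def rev_map)

lemma U_nonempty_quot_word: "U t \<noteq> {} \<Longrightarrow> \<exists>\<alpha> \<beta>. t = quot_word \<alpha> \<beta>"
proof (cases "t = []")
  case True
  then have "t = quot_word [] []" by (simp add: quot_word_def)
  then show ?thesis by blast
qed (auto simp: U_def)

lemma word_rel_graph:
  assumes t: "t \<in> carrier (free_group L)"
  shows "(\<mu>, \<nu>) \<in> word_rel boundary letter_rel t \<longleftrightarrow> \<mu> \<in> U (map letter_inv (rev t)) \<and> \<nu> = \<phi> t \<mu>"
proof (cases t rule: quot_word_cases)
  case (quot \<alpha> \<beta>)
  have red: "reduced (quot_word \<beta> \<alpha>)"
    using reduced_inverse[of t] t quot by (simp add: free_group_def inverse_quot_word)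
  have L: "\<alpha> \<in> lists L" "\<beta> \<in> lists L"
    using t quot by (auto simp: free_group_def quot_word_def)
  have "(\<mu>, \<nu>) \<in> word_rel boundary letter_rel t \<longleftrightarrow>
      (\<exists>\<rho>. (\<mu>, \<rho>) \<in> boundary_shift \<beta> \<and> (\<nu>, \<rho>) \<in> boundary_shift \<alpha>)"
    unfolding quot word_rel_quot_word by auto
  also have "\<dots> \<longleftrightarrow> \<mu> \<in> U (quot_word \<beta> \<alpha>) \<and> \<nu> = quot_map \<alpha> \<beta> \<mu>"
    unfolding U_quot_word_iff[OF L red] using quot_map_eq[OF _ _ L(1)] by (auto simp: boundary_shift_iff)
  also have "\<dots> \<longleftrightarrow> \<mu> \<in> U (quot_word \<beta> \<alpha>) \<and> \<nu> = \<phi> t \<mu>"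
  proof (cases "t = []")
    case True
    then have "\<alpha> = []" "\<beta> = []" using quot by (auto simp: quot_word_def)
    moreover have "U [] = boundary" by (simp add: U_def)
    ultimately show ?thesis using remove_edges_0 boundary_subset_paths
      by (auto simp: quot quot_map_def \<phi>_def quot_word_def)
  next
    case False
    then show ?thesis using \<phi>_quot_word quot by simp
  qed
  finally show ?thesis unfolding quot inverse_quot_word .
next
  case (inner u a b v)
  have "reduced t" using t by (simp add: free_group_def)
  \<comment> \<open>With equal labels the two letters would be mutually inverse, which a reduced
    word excludes.\<close>
  then have "a \<noteq> b"
    by (auto simp: inner reduced_def successively_append_iff letter_inv_def)
  then have "word_rel boundary letter_rel t = {}" using word_rel_inner inner by blast
  moreover have "U (map letter_inv (rev t)) = {}"
  proof (rule ccontr)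
    assume "U (map letter_inv (rev t)) \<noteq> {}"
    then obtain \<alpha> \<beta> where "map letter_inv (rev t) = quot_word \<alpha> \<beta>" using U_nonempty_quot_word by blast
    then have "map letter_inv (rev (map letter_inv (rev t))) = quot_word \<beta> \<alpha>"
      by (simp only: inverse_quot_word)
    then have "t = quot_word \<beta> \<alpha>" by (simp add: rev_map o_def)
    then have "u @ [(a, False)] @ [(b, True)] @ v = quot_word \<beta> \<alpha>" using inner by simp
    \<comment> \<open>After its first negative letter a word of the form \<beta>\<alpha>^-1 has
      negative letters only, yet \<open>(b, True)\<close> survives \<open>dropWhile\<close>.\<close>
    then have "dropWhile snd (u @ [(a, False)] @ [(b, True)] @ v) = map (\<lambda>b. (b, False)) (rev \<alpha>)"
      by simp
    moreover have "(b, True) \<in> set (dropWhile snd (u @ [(a, False)] @ [(b, True)] @ v))"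
      by (induction u) auto
    ultimately show False by auto
  qed
  ultimately show ?thesis by simp
qed

lemma openin_letter_rel: "openin boundary_topology W \<Longrightarrow> openin boundary_topology (letter_rel x `` W)"
  by (simp add: letter_rel_def openin_boundary_shift openin_converse_boundary_shift)

lemma orthogonal_domains_U: "orthogonal_domains L U"
  unfolding orthogonal_domains_def
proof (intro ballI impI)
  fix a b assume ab: "a \<in> L" "b \<in> L" "a \<noteq> b"
  have start: "starts_with [c] \<mu>" if "c \<in> L" "\<mu> \<in> U [(c, True)]" for c \<mu>
  proof -
    have c: "[(c, True)] = quot_word [c] []" by (simp add: quot_word_def)
    have "reduced (quot_word [c] [])" by (simp add: reduced_def flip: c)
    then have "\<exists>\<rho>. (\<mu>, \<rho>) \<in> boundary_shift [c]"
      using that U_quot_word_iff[of "[]" "[c]" \<mu>] unfolding c by auto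
    then show ?thesis by (auto simp: boundary_shift_def shift_rel_def)
  qed
  have "a = b" if "starts_with [a] \<mu>" "starts_with [b] \<mu>" for \<mu>
    using that by (simp add: starts_with_def)
  then show "U [(a, True)] \<inter> U [(b, True)] = {}" using start ab by blast
qed

end

theorem proposition3p16:
  fixes L :: "'l set"
    and \<theta> :: "'l \<Rightarrow> 'b::generalized_boolean_algebra \<Rightarrow> 'b"
    and \<I> :: "'l \<Rightarrow> 'b set"
  assumes "generalized_boolean_dynamical_system L \<theta> \<I>"
  shows "partial_action (free_group L)
           (generalized_boolean_dynamical_system.boundary_topology L \<theta> \<I>)
           (generalized_boolean_dynamical_system.U L \<theta> \<I>)
           (generalized_boolean_dynamical_system.\<phi> \<theta> \<I>)
       \<and> semi_saturated L
           (generalized_boolean_dynamical_system.U L \<theta> \<I>)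
           (generalized_boolean_dynamical_system.\<phi> \<theta> \<I>)
       \<and> orthogonal_domains L (generalized_boolean_dynamical_system.U L \<theta> \<I>)"
proof -
  interpret generalized_boolean_dynamical_system L \<theta> \<I> by (rule assms)
  show ?thesis
    using letters.semi_saturated_partial_action[OF topspace_boundary_topology openin_letter_rel word_rel_graph]
      orthogonal_domains_U by blast
qed

end
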